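(* Fix integers $k \ge 4$, $a \ge 0$ and $b \ge 0$, and set $\gamma := \max\{0, k - b - 4\}$. If $$10a + 4b \ge \binom{k+3}{3} + 3\gamma + 2k,$$ then for a general union $Z \subset \mathbb{P}^3$ of $a$ triple points and $b$ double points the restriction map $$\rho_{Z,k} : H^0(\mathbb{P}^3, \mathcal{O}_{\mathbb{P}^3}(k)) \to H^0(Z, \mathcal{O}_Z(k))$$ is injective.
   Context: We work over $\mathbb{C}$. For a point $P \in \mathbb{P}^3$, the double (resp. triple) point supported at $P$ is the closed subscheme of $\mathbb{P}^3$ with ideal sheaf $\mathcal{I}_P^2$ (resp. $\mathcal{I}_P^3$); it has length $4$ (resp. $10$). A "general union of $a$ triple points and $b$ double points" is the union of such schemes supported at $a+b$ general points of $\mathbb{P}^3$, i.e. the statement holds for all supports in some nonempty Zariski open subset of $(\mathbb{P}^3)^{a+b}$. *)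

theory Defs
  imports
    "HOL-Analysis.Analysis"
    "HOL-Library.Poly_Mapping"
    "HOL-Library.Numeral_Type"
    "HOL-Computational_Algebra.Fraction_Field"
begin

section \<open>Polynomials\<close>

text \<open>Polynomials over the complex numbers in variables indexed by \<open>'v\<close>: finitely supported
  functions from exponent vectors to coefficients.\<close>

type_synonym 'v cpoly = "('v \<Rightarrow>\<^sub>0 nat) \<Rightarrow>\<^sub>0 complex"

definition poly_eval :: "'v cpoly \<Rightarrow> ('v \<Rightarrow> complex) \<Rightarrow> complex" where
  "poly_eval f x =
     (\<Sum>m\<in>Poly_Mapping.keys f.
        Poly_Mapping.lookup f m * (\<Prod>j\<in>Poly_Mapping.keys m. x j ^ Poly_Mapping.lookup m j))"

text \<open>The index type \<open>4\<close> is the library type with four elements. The zero polynomial is homogeneous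
  of every degree.\<close>

definition homogeneous :: "nat \<Rightarrow> 4 cpoly \<Rightarrow> bool" where
  "homogeneous d f \<longleftrightarrow>
     (\<forall>m\<in>Poly_Mapping.keys f. (\<Sum>j\<in>UNIV. Poly_Mapping.lookup m j) = d)"

section \<open>Projective 3-space\<close>

typedef proj3 = "{L :: (complex ^ 4) set. \<exists>v. v \<noteq> 0 \<and> L = vec.span {v}}"
proof -
  have "\<exists>v :: complex ^ 4. v \<noteq> 0"
    by (rule exI[of _ "axis 1 1"]) (simp add: axis_eq_0_iff)
  then show ?thesis by blast
qed

text \<open>All systems of homogeneous coordinates of a point.\<close>

definition hcoords :: "proj3 \<Rightarrow> (complex ^ 4) set" where
  "hcoords P = Rep_proj3 P - {0}"

definition vanishes_at :: "4 cpoly \<Rightarrow> proj3 \<Rightarrow> bool" where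
  "vanishes_at f P \<longleftrightarrow> (\<forall>v\<in>hcoords P. poly_eval f (\<lambda>j. v $ j) = 0)"

section \<open>The Zariski topology on a power of projective 3-space\<close>

definition proj3_power :: "nat \<Rightarrow> (nat \<Rightarrow> proj3) set" where
  "proj3_power n = ({..<n} \<rightarrow>\<^sub>E UNIV)"

text \<open>The variable \<open>(i, j)\<close> is the \<open>j\<close>-th homogeneous coordinate on the \<open>i\<close>-th factor.\<close>

definition multihomogeneous :: "nat \<Rightarrow> (nat \<times> 4) cpoly \<Rightarrow> bool" where
  "multihomogeneous n f \<longleftrightarrow>
     (\<exists>d :: nat \<Rightarrow> nat. \<forall>m\<in>Poly_Mapping.keys f.
        Poly_Mapping.keys m \<subseteq> {..<n} \<times> UNIV \<and>
        (\<forall>i<n. (\<Sum>j\<in>UNIV. Poly_Mapping.lookup m (i, j)) = d i))"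

definition multi_vanishes_at :: "nat \<Rightarrow> (nat \<times> 4) cpoly \<Rightarrow> (nat \<Rightarrow> proj3) \<Rightarrow> bool" where
  "multi_vanishes_at n f p \<longleftrightarrow>
     (\<forall>v. (\<forall>i<n. v i \<in> hcoords (p i)) \<longrightarrow> poly_eval f (\<lambda>(i, j). v i $ j) = 0)"

definition zariski_closed :: "nat \<Rightarrow> (nat \<Rightarrow> proj3) set \<Rightarrow> bool" where
  "zariski_closed n C \<longleftrightarrow>
     (\<exists>S. (\<forall>f\<in>S. multihomogeneous n f) \<and>
          C = {p \<in> proj3_power n. \<forall>f\<in>S. multi_vanishes_at n f p})"

definition zariski_open :: "nat \<Rightarrow> (nat \<Rightarrow> proj3) set \<Rightarrow> bool" where
  "zariski_open n U \<longleftrightarrow> U \<subseteq> proj3_power n \<and> zariski_closed n (proj3_power n - U)"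

section \<open>Stalks of the sheaves O(k)\<close>

text \<open>All stalks are realised inside the fraction field of the homogeneous coordinate ring: the
  stalk of \<open>O(k)\<close> at \<open>Q\<close> is the degree \<open>k\<close> part of the homogeneous localisation at \<open>Q\<close>.
  For \<open>k = 0\<close> it is the local ring of projective space at \<open>Q\<close>.\<close>

type_synonym ratfun = "4 cpoly fract"

definition stalk_O :: "nat \<Rightarrow> proj3 \<Rightarrow> ratfun set" where
  "stalk_O k Q = {Fraction_Field.Fract f g | f g d.
     homogeneous (d + k) f \<and> homogeneous d g \<and> \<not> vanishes_at g Q}"

text \<open>Additive subgroup generated by products; for ideals, and for an ideal times a module,
  this is the usual product. No clause for negatives is needed, as one factor is always
  closed under negation.\<close>

inductive_set ideal_mult :: "ratfun set \<Rightarrow> ratfun set \<Rightarrow> ratfun set"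
  for A B :: "ratfun set" where
  zero: "0 \<in> ideal_mult A B"
| add: "x \<in> A \<Longrightarrow> y \<in> B \<Longrightarrow> z \<in> ideal_mult A B \<Longrightarrow> x * y + z \<in> ideal_mult A B"

section \<open>Closed subschemes and multiple points\<close>

text \<open>A closed subscheme is given by its ideal sheaf, and the ideal sheaf by its stalks.\<close>

type_synonym ideal_sheaf = "proj3 \<Rightarrow> ratfun set"

text \<open>Stalk at \<open>Q\<close> of the ideal sheaf of the reduced point \<open>P\<close>: the maximal ideal of the local ring
  if \<open>Q = P\<close>, and the whole local ring otherwise.\<close>

definition point_ideal :: "proj3 \<Rightarrow> ideal_sheaf" where
  "point_ideal P Q = {Fraction_Field.Fract f g | f g d.
     homogeneous d f \<and> homogeneous d g \<and> vanishes_at f P \<and> \<not> vanishes_at g Q}"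

primrec ideal_sheaf_power :: "ideal_sheaf \<Rightarrow> nat \<Rightarrow> ideal_sheaf" where
  "ideal_sheaf_power I 0 Q = stalk_O 0 Q"
| "ideal_sheaf_power I (Suc m) Q = ideal_mult (I Q) (ideal_sheaf_power I m Q)"

definition double_point :: "proj3 \<Rightarrow> ideal_sheaf" where
  "double_point P = ideal_sheaf_power (point_ideal P) 2"

definition triple_point :: "proj3 \<Rightarrow> ideal_sheaf" where
  "triple_point P = ideal_sheaf_power (point_ideal P) 3"

text \<open>The ideal sheaf of a union of closed subschemes is the intersection of their ideal sheaves;
  the factor \<open>stalk_O 0 Q\<close> takes care of the empty union. The first \<open>a\<close> points support
  the triple points and the next \<open>b\<close> points support the double points.\<close>

definition multiple_points_union :: "nat \<Rightarrow> nat \<Rightarrow> (nat \<Rightarrow> proj3) \<Rightarrow> ideal_sheaf" where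
  "multiple_points_union a b p Q =
     stalk_O 0 Q \<inter> (\<Inter>i\<in>{..<a}. triple_point (p i) Q)
                 \<inter> (\<Inter>i\<in>{a..<a + b}. double_point (p i) Q)"

definition scheme_support :: "ideal_sheaf \<Rightarrow> proj3 set" where
  "scheme_support I = {Q. I Q \<noteq> stalk_O 0 Q}"

section \<open>Global sections and restriction\<close>

definition H0_proj3 :: "nat \<Rightarrow> 4 cpoly set" where
  "H0_proj3 k = {F. homogeneous k F}"

text \<open>Congruence modulo \<open>I(k)\<close> on the stalk of \<open>O(k)\<close> at \<open>Q\<close>; its quotient is the stalk of
  \<open>O_Z(k)\<close> at \<open>Q\<close>, where \<open>Z\<close> is the subscheme with ideal sheaf \<open>I\<close>.\<close>

definition stalk_cong :: "ideal_sheaf \<Rightarrow> nat \<Rightarrow> proj3 \<Rightarrow> (ratfun \<times> ratfun) set" where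
  "stalk_cong I k Q = {(s, t). s \<in> stalk_O k Q \<and> t \<in> stalk_O k Q \<and>
     s - t \<in> ideal_mult (I Q) (stalk_O k Q)}"

text \<open>For a zero-dimensional \<open>Z\<close>, whose support is finite and discrete, the global sections of
  \<open>O_Z(k)\<close> are the product of its stalks over the support.\<close>

definition H0_scheme :: "ideal_sheaf \<Rightarrow> nat \<Rightarrow> (proj3 \<Rightarrow> ratfun set) set" where
  "H0_scheme I k = (\<Pi>\<^sub>E Q\<in>scheme_support I. stalk_O k Q // stalk_cong I k Q)"

definition restriction :: "ideal_sheaf \<Rightarrow> nat \<Rightarrow> 4 cpoly \<Rightarrow> (proj3 \<Rightarrow> ratfun set)" where
  "restriction I k F =
     (\<lambda>Q\<in>scheme_support I. stalk_cong I k Q `` {Fraction_Field.Fract F 1})"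

lemma Fract_1_in_stalk_O:
  assumes "F \<in> H0_proj3 k"
  shows "Fraction_Field.Fract F 1 \<in> stalk_O k Q"
proof -
  have "homogeneous 0 (1 :: 4 cpoly)"
    by (simp add: homogeneous_def)
  moreover have "\<not> vanishes_at 1 Q"
  proof -
    obtain v where v: "v \<noteq> 0" "Rep_proj3 Q = vec.span {v}"
      using Rep_proj3[of Q] by blast
    then have "v \<in> hcoords Q"
      by (simp add: hcoords_def vec.span_base)
    moreover have "poly_eval 1 (\<lambda>j. v $ j) = 1"
      by (simp add: poly_eval_def)
    ultimately show ?thesis
      unfolding vanishes_at_def by (metis zero_neq_one)
  qed
  ultimately show ?thesis
    using assms by (force simp: stalk_O_def H0_proj3_def)
qed

lemma restriction_in_H0_scheme:
  "restriction I k \<in> H0_proj3 k \<rightarrow> H0_scheme I k"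
  by (auto simp: restriction_def H0_scheme_def intro!: quotientI Fract_1_in_stalk_O)

end

theory Submission
  imports Defs
begin

text \<open>The proof specialises the points to a plane, in the manner of Horace. If \<open>x\<close> triple and
  \<open>y\<close> double points lie in a plane, a form of degree \<open>k\<close> restricts to a plane curve with these
  points as triple and double points. If no such curve exists, the form is divisible by the equation of
  the plane, and the quotient has degree \<open>k - 1\<close> and points of multiplicity one less there. So one
  carries along numbers \<open>u, v\<close> of double and simple points left behind in the plane. Choosing \<open>x\<close> as
  large as possible and adding at most one double point wastes at most \<open>2\<close> conditions in each degree,
  or \<open>5\<close> if no double point is left: this is where \<open>2 k + 3 \<gamma>\<close> comes from.

  For the plane curves, let the points degenerate to the boundary of the torus one after the other. Each
  of them then kills a set of monomials, and for triple points in a lexicographic degeneration these are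
  \<open>3, 2, 1\<close> monomials of three successive rows of the triangle of exponents. It remains to play a
  game with the lengths of the rows, which is exact as long as the rows are long; finitely many positions
  near the corner of the triangle are evaluated.

  All the conditions on the points are open. This is expressed by one elimination argument, which also
  provides the multihomogeneous polynomial that defines the open set.\<close>

text \<open>The obstacle is the exact fit. If triple and double points alone are to impose exactly
  as many conditions as a plane curve has coefficients, the row game can get stuck in the corner of
  the triangle: five double points, for instance, do not exclude a plane quartic. From plane degree
  6 on, one simple point and two double points repair this. The residual points provide them from
  the third plane step on; in the first two steps one surplus condition is spent instead. So the
  counts carry slack 0, then 1, then 2. The final 2 is available because the descent stops at
  quintics (64 instead of 56 + 10), where a direct search takes over; degrees 4, 5, 6 are searched
  from the start.

  The other resource is the growth of dimension. A point imposes in space at most 5/3 as many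
  conditions as in the plane (10 against 6, 4 against 3), whereas forms of degree d in space have (d
  + 3) / 3 times as many coefficients as those in the plane. From degree 5 on there are therefore
  enough points to fill the plane.\<close>

section \<open>Elimination with polynomial entries\<close>

text \<open>Fraction-free Gaussian elimination; \<open>H a f\<close> is to be read as homogeneity of
  \<open>f\<close> of degree \<open>a\<close>. Cross-multiplying two rows keeps each row homogeneous
  of a single degree, so the product \<open>g\<close> of the pivots is again of this kind. It is
  applied to polynomials in one variable, with the degree ignored, and to multihomogeneous
  polynomials.\<close>

lemma elimination:
  fixes H :: "(nat \<Rightarrow> nat) \<Rightarrow> ('x \<Rightarrow> complex) \<Rightarrow> bool"
    and A :: "'r \<Rightarrow> 'm \<Rightarrow> 'x \<Rightarrow> complex"
  assumes one: "H (\<lambda>_. 0) (\<lambda>_. 1)"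
    and mult: "\<And>a b f g. H a f \<Longrightarrow> H b g \<Longrightarrow> H (\<lambda>i. a i + b i) (\<lambda>x. f x * g x)"
    and diff: "\<And>a f g. H a f \<Longrightarrow> H a g \<Longrightarrow> H a (\<lambda>x. f x - g x)"
    and fin: "finite M"
    and A: "\<And>r m. r \<in> R \<Longrightarrow> m \<in> M \<Longrightarrow> H (dg r) (A r m)"
    and inj: "\<And>c. \<forall>r\<in>R. (\<Sum>m\<in>M. c m * A r m x0) = 0 \<Longrightarrow> \<forall>m\<in>M. c m = 0"
  shows "\<exists>\<delta> g. H \<delta> g \<and> g x0 \<noteq> 0 \<and>
    (\<forall>x. g x \<noteq> 0 \<longrightarrow> (\<forall>c. (\<forall>r\<in>R. (\<Sum>m\<in>M. c m * A r m x) = 0) \<longrightarrow> (\<forall>m\<in>M. c m = 0)))"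
  using fin A inj
proof (induction M arbitrary: A dg rule: finite_induct)
  case empty
  show ?case using one by (intro exI[of _ "\<lambda>_. 0"] exI[of _ "\<lambda>_. 1"]) simp
next
  case (insert m M)
  have "\<exists>r\<in>R. A r m x0 \<noteq> 0"
  proof (rule ccontr)
    assume "\<not> ?thesis"
    then have "\<forall>r\<in>R. (\<Sum>m'\<in>insert m M. (if m' = m then 1 else 0) * A r m' x0) = 0"
      using insert.hyps by (auto intro!: sum.neutral)
    from insert.prems(2)[OF this] show False by simp
  qed
  then obtain r where r: "r \<in> R" "A r m x0 \<noteq> 0" by blast
  define A' where "A' s m' x = A s m' x * A r m x - A s m x * A r m' x" for s m' x
  \<comment> \<open>Solving the pivot row for the unknown \<open>m\<close> turns a solution of the
    reduced system at \<open>x0\<close> into one of the full system.\<close>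
  define ext where "ext c x = (\<lambda>m'. if m' = m then - (\<Sum>m'\<in>M. c m' * A r m' x) / A r m x else c m')"
    for c :: "'m \<Rightarrow> complex" and x
  have key: "(\<Sum>m'\<in>M. c m' * A' s m' x)
      = A r m x * (\<Sum>m'\<in>M. c m' * A s m' x) - A s m x * (\<Sum>m'\<in>M. c m' * A r m' x)" for c s x
    by (simp add: A'_def sum_distrib_left algebra_simps flip: sum_subtractf)
  have 1: "H (\<lambda>i. dg s i + dg r i) (A' s m')" if "s \<in> R" "m' \<in> M" for s m'
  proof -
    have a: "H (\<lambda>i. dg s i + dg r i) (\<lambda>x. A s m' x * A r m x)"
      by (rule mult) (use insert.prems(1) that r in auto)
    have b: "H (\<lambda>i. dg s i + dg r i) (\<lambda>x. A s m x * A r m' x)"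
      by (rule mult) (use insert.prems(1) that r in auto)
    show ?thesis using diff[OF a b] by (simp add: A'_def[abs_def])
  qed
  have 2: "\<forall>m'\<in>M. c m' = 0" if c: "\<forall>s\<in>R. (\<Sum>m'\<in>M. c m' * A' s m' x0) = 0" for c
  proof -
    have "(\<Sum>m'\<in>insert m M. ext c x0 m' * A s m' x0) = 0" if "s \<in> R" for s
    proof -
      have "(\<Sum>m'\<in>M. ext c x0 m' * A s m' x0) = (\<Sum>m'\<in>M. c m' * A s m' x0)"
        using insert.hyps by (intro sum.cong) (auto simp: ext_def)
      then have "(\<Sum>m'\<in>insert m M. ext c x0 m' * A s m' x0)
          = (\<Sum>m'\<in>M. c m' * A s m' x0) - A s m x0 * (\<Sum>m'\<in>M. c m' * A r m' x0) / A r m x0"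
        using insert.hyps by (simp add: ext_def)
      also have "\<dots> = (\<Sum>m'\<in>M. c m' * A' s m' x0) / A r m x0"
        using r by (simp add: key field_simps)
      finally show ?thesis using c that by simp
    qed
    then have "\<forall>m'\<in>insert m M. ext c x0 m' = 0" by (intro insert.prems(2)) blast
    moreover have "ext c x0 m' = c m'" if "m' \<in> M" for m'
      using that insert.hyps by (auto simp: ext_def)
    ultimately show ?thesis by auto
  qed
  have "\<exists>\<delta> g. H \<delta> g \<and> g x0 \<noteq> 0 \<and>
    (\<forall>x. g x \<noteq> 0 \<longrightarrow> (\<forall>c. (\<forall>r\<in>R. (\<Sum>m\<in>M. c m * A' r m x) = 0) \<longrightarrow> (\<forall>m\<in>M. c m = 0)))"
    by (rule insert.IH[where dg = "\<lambda>s i. dg s i + dg r i"]) (fact 1, fact 2)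
  then obtain \<delta> g where g: "H \<delta> g" "g x0 \<noteq> 0"
    "\<And>x c. g x \<noteq> 0 \<Longrightarrow> \<forall>r\<in>R. (\<Sum>m\<in>M. c m * A' r m x) = 0 \<Longrightarrow> \<forall>m\<in>M. c m = 0"
    by blast
  have fin: "\<forall>m'\<in>insert m M. c m' = 0"
    if x: "g x * A r m x \<noteq> 0" and c: "\<forall>s\<in>R. (\<Sum>m'\<in>insert m M. c m' * A s m' x) = 0" for x c
  proof -
    have "(\<Sum>m'\<in>M. c m' * A' s m' x) = 0" if "s \<in> R" for s
    proof -
      have e: "(\<Sum>m'\<in>M. c m' * A s m' x) = - c m * A s m x" if "s \<in> R" for s
        using c that insert.hyps by (simp add: add_eq_0_iff) 
      show ?thesis unfolding key e[OF that] e[OF r(1)] by simp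
    qed
    then have M: "\<forall>m'\<in>M. c m' = 0" using g(3) x by auto
    moreover have "c m * A r m x + (\<Sum>m'\<in>M. c m' * A r m' x) = 0" using c r insert.hyps by simp
    ultimately show ?thesis using x by auto
  qed
  have "H (\<lambda>i. \<delta> i + dg r i) (\<lambda>x. g x * A r m x)"
    by (rule mult) (use g insert.prems(1) r in auto)
  then show ?case using fin g(2) r by (intro exI[of _ "\<lambda>i. \<delta> i + dg r i"] exI[of _ "\<lambda>x. g x * A r m x"]) auto
qed

section \<open>Generic configurations\<close>

definition polyfun :: "(complex \<Rightarrow> complex) \<Rightarrow> bool" where
  "polyfun f \<longleftrightarrow> (\<exists>p. f = poly p)"

lemma polyfun_const [intro, simp]: "polyfun (\<lambda>_. c)"
  unfolding polyfun_def by (rule exI[of _ "[:c:]"]) auto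

lemma polyfun_id [intro, simp]: "polyfun (\<lambda>t. t)"
  unfolding polyfun_def by (rule exI[of _ "[:0, 1:]"]) auto

lemma polyfun_add [intro]: "polyfun f \<Longrightarrow> polyfun g \<Longrightarrow> polyfun (\<lambda>t. f t + g t)"
  unfolding polyfun_def by (auto simp: fun_eq_iff simp flip: poly_add)

lemma polyfun_diff [intro]: "polyfun f \<Longrightarrow> polyfun g \<Longrightarrow> polyfun (\<lambda>t. f t - g t)"
  unfolding polyfun_def by (auto simp: fun_eq_iff simp flip: poly_diff)

lemma polyfun_mult [intro]: "polyfun f \<Longrightarrow> polyfun g \<Longrightarrow> polyfun (\<lambda>t. f t * g t)"
  unfolding polyfun_def by (auto simp: fun_eq_iff simp flip: poly_mult)

lemma polyfun_power [intro]: "polyfun f \<Longrightarrow> polyfun (\<lambda>t. f t ^ n)"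
  unfolding polyfun_def by (auto simp: fun_eq_iff simp flip: poly_power)

lemma polyfun_finite_zeros:
  assumes "polyfun f" "f a \<noteq> 0" shows "finite {t. f t = 0}"
proof -
  from assms(1) obtain p where p: "f = poly p" by (auto simp: polyfun_def)
  with assms(2) have "p \<noteq> 0" by auto
  then show ?thesis unfolding p by (rule poly_roots_finite)
qed

lemma polyfun_elimination:
  fixes A :: "'r \<Rightarrow> 'm \<Rightarrow> complex \<Rightarrow> complex"
  assumes "finite M" and "\<And>r m. r \<in> R \<Longrightarrow> m \<in> M \<Longrightarrow> polyfun (A r m)"
    and "\<And>c. \<forall>r\<in>R. (\<Sum>m\<in>M. c m * A r m t0) = 0 \<Longrightarrow> \<forall>m\<in>M. c m = 0"
  shows "finite {t. \<exists>c. (\<forall>r\<in>R. (\<Sum>m\<in>M. c m * A r m t) = 0) \<and> \<not> (\<forall>m\<in>M. c m = 0)}"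
proof -
  have "\<exists>(\<delta> :: nat \<Rightarrow> nat) g. polyfun g \<and> g t0 \<noteq> 0 \<and>
    (\<forall>t. g t \<noteq> 0 \<longrightarrow> (\<forall>c. (\<forall>r\<in>R. (\<Sum>m\<in>M. c m * A r m t) = 0) \<longrightarrow> (\<forall>m\<in>M. c m = 0)))"
    by (rule elimination[where H = "\<lambda>_. polyfun"]) (use assms in auto)
  then obtain g where g: "polyfun g" "g t0 \<noteq> 0"
    "\<And>t c. g t \<noteq> 0 \<Longrightarrow> (\<forall>r\<in>R. (\<Sum>m\<in>M. c m * A r m t) = 0) \<Longrightarrow> (\<forall>m\<in>M. c m = 0)"
    by blast
  show ?thesis
    by (rule finite_subset[OF _ polyfun_finite_zeros[OF g(1,2)]]) (use g(3) in blast)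
qed

section \<open>Sets that are cofinite on lines\<close>

definition along :: "('i \<Rightarrow> complex) \<Rightarrow> ('i \<Rightarrow> complex) \<Rightarrow> complex \<Rightarrow> 'i \<Rightarrow> complex" where
  "along P Q t = (\<lambda>i. P i + t * (Q i - P i))"

text \<open>Nonempty sets of this kind are closed under finite intersections, so they serve as a substitute
  for nonempty Zariski open sets.\<close>

definition line_open :: "('i \<Rightarrow> complex) set \<Rightarrow> bool" where
  "line_open G \<longleftrightarrow> (\<forall>P\<in>G. \<forall>Q. finite {t. along P Q t \<notin> G})"

lemma line_open_Int:
  assumes "line_open G" "line_open G'" shows "line_open (G \<inter> G')"
  unfolding line_open_def
proof (intro ballI allI)
  fix P Q assume P: "P \<in> G \<inter> G'"
  have "{t. along P Q t \<notin> G \<inter> G'} = {t. along P Q t \<notin> G} \<union> {t. along P Q t \<notin> G'}" by auto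
  then show "finite {t. along P Q t \<notin> G \<inter> G'}" using assms P by (simp add: line_open_def)
qed

text \<open>On the line from a point of \<open>G\<close> to a point of \<open>G'\<close> each set
  misses only finitely many parameters. For \<open>G'\<close> the line is run backwards, hence
  \<open>1 - t\<close>.\<close>

lemma line_open_Int_nonempty:
  assumes "line_open G" "line_open G'" "G \<noteq> {}" "G' \<noteq> {}" shows "G \<inter> G' \<noteq> {}"
proof -
  obtain P Q where PQ: "P \<in> G" "Q \<in> G'" using assms by blast
  have swap: "along P Q t = along Q P (1 - t)" for t
    by (rule ext) (simp add: along_def algebra_simps)
  have "finite {t. along P Q t \<notin> G}" "finite {t. along Q P t \<notin> G'}"
    using assms PQ by (simp_all add: line_open_def)
  then have "finite ({t. along P Q t \<notin> G} \<union> (\<lambda>t. 1 - t) ` {t. along Q P t \<notin> G'})" by blast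
  then obtain t where "t \<notin> {t. along P Q t \<notin> G} \<union> (\<lambda>t. 1 - t) ` {t. along Q P t \<notin> G'}"
    using ex_new_if_finite[OF infinite_UNIV_char_0] by blast
  moreover have "t = 1 - (1 - t)" by simp
  ultimately have "along P Q t \<in> G" "along Q P (1 - t) \<in> G'" by blast+
  then show ?thesis using swap by auto
qed

lemma line_open_INT:
  assumes "finite I" "\<And>i. i \<in> I \<Longrightarrow> line_open (G i)" "\<And>i. i \<in> I \<Longrightarrow> G i \<noteq> {}"
  shows "line_open (\<Inter>i\<in>I. G i) \<and> (\<Inter>i\<in>I. G i) \<noteq> {}"
  using assms
proof (induction I)
  case empty
  then show ?case by (simp add: line_open_def)
next
  case (insert i I)
  then show ?case using line_open_Int[of "G i" "\<Inter>i\<in>I. G i"] line_open_Int_nonempty[of "G i" "\<Inter>i\<in>I. G i"]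
    by auto
qed

lemma polyfun_along [simp, intro]: "polyfun (\<lambda>t. along P Q t i)"
  unfolding along_def by (intro polyfun_add polyfun_mult) auto

lemma line_open_neq0: "line_open {P. P i \<noteq> 0}"
  unfolding line_open_def
proof (intro ballI allI)
  fix P Q :: "'a \<Rightarrow> complex" assume "P \<in> {P. P i \<noteq> 0}"
  then have "along P Q 0 i \<noteq> 0" by (simp add: along_def)
  from polyfun_finite_zeros[of "\<lambda>t. along P Q t i", OF _ this]
  show "finite {t. along P Q t \<notin> {P. P i \<noteq> 0}}" by simp
qed

text \<open>Injectivity at \<open>P\<close>, the parameter 0 of the line, yields by elimination a
  polynomial in the parameter that is not identically zero.\<close>

lemma line_open_injective:
  fixes A :: "'r \<Rightarrow> 'm \<Rightarrow> ('i \<Rightarrow> complex) \<Rightarrow> complex"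
  assumes "finite M" and "\<And>r m P Q. r \<in> R \<Longrightarrow> m \<in> M \<Longrightarrow> polyfun (\<lambda>t. A r m (along P Q t))"
  shows "line_open {P. \<forall>c. (\<forall>r\<in>R. (\<Sum>m\<in>M. c m * A r m P) = 0) \<longrightarrow> (\<forall>m\<in>M. c m = 0)}"
  unfolding line_open_def
proof (intro ballI allI)
  fix P Q
  assume P: "P \<in> {P. \<forall>c. (\<forall>r\<in>R. (\<Sum>m\<in>M. c m * A r m P) = 0) \<longrightarrow> (\<forall>m\<in>M. c m = 0)}"
  have 0: "along P Q 0 = P" by (rule ext) (simp add: along_def)
  have "finite {t. \<exists>c. (\<forall>r\<in>R. (\<Sum>m\<in>M. c m * A r m (along P Q t)) = 0) \<and> \<not> (\<forall>m\<in>M. c m = 0)}"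
    by (rule polyfun_elimination[where ?t0.0 = 0]) (use assms P in \<open>auto simp: 0\<close>)
  then show "finite {t. along P Q t \<notin>
      {P. \<forall>c. (\<forall>r\<in>R. (\<Sum>m\<in>M. c m * A r m P) = 0) \<longrightarrow> (\<forall>m\<in>M. c m = 0)}}"
    by (rule rev_finite_subset) blast
qed

section \<open>Multiple points in the plane\<close>

text \<open>The Hasse derivative of order \<open>r\<close> of the \<open>e\<close>-th power: the
  coefficient of \<open>h ^ r\<close> in \<open>(x + h) ^ e\<close>.\<close>

definition hasse :: "nat \<Rightarrow> nat \<Rightarrow> complex \<Rightarrow> complex" where
  "hasse r e x = of_nat (e choose r) * x ^ (e - r)"

lemma hasse_mult_power: "hasse r e x * x ^ r = of_nat (e choose r) * x ^ e"
  by (cases "r \<le> e") (auto simp: hasse_def binomial_eq_0 simp flip: power_add)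

definition vanish2 :: "(nat \<times> nat) set \<Rightarrow> (nat \<times> nat \<Rightarrow> complex) \<Rightarrow> nat \<Rightarrow> complex \<times> complex \<Rightarrow> bool" where
  "vanish2 D c m P \<longleftrightarrow> (\<forall>p q. p + q < m \<longrightarrow>
     (\<Sum>\<alpha>\<in>D. c \<alpha> * (hasse p (fst \<alpha>) (fst P) * hasse q (snd \<alpha>) (snd P))) = 0)"

text \<open>Injectivity of evaluation: no nonzero polynomial with exponents in \<open>D\<close> has
  the multiplicities prescribed by the pairs (multiplicity, point) in \<open>K\<close>.\<close>

definition indep2 :: "(nat \<times> nat) set \<Rightarrow> (nat \<times> (complex \<times> complex)) set \<Rightarrow> bool" where
  "indep2 D K \<longleftrightarrow> (\<forall>c. (\<forall>(m, P)\<in>K. vanish2 D c m P) \<longrightarrow> (\<forall>\<alpha>\<in>D. c \<alpha> = 0))"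

text \<open>Polynomials of degree below \<open>m\<close> in the two exponents. The binomial basis is
  the one in which Hasse derivatives act on monomials.\<close>

definition qform :: "nat \<Rightarrow> (nat \<times> nat \<Rightarrow> complex) \<Rightarrow> bool" where
  "qform m f \<longleftrightarrow> (\<exists>l. \<forall>\<alpha>. f \<alpha> =
     (\<Sum>p<m. \<Sum>q<m - p. l p q * (of_nat (fst \<alpha> choose p) * of_nat (snd \<alpha> choose q))))"

lemma qform_const: "qform 1 (\<lambda>_. 1)"
  unfolding qform_def by (rule exI[of _ "\<lambda>_ _. 1"]) simp

lemma qform_affine: "qform 2 (\<lambda>\<alpha>. a + b * of_nat (fst \<alpha>) + c * of_nat (snd \<alpha>))"
  unfolding qform_def
  by (rule exI[of _ "\<lambda>p q. if p = 1 then b else if q = 1 then c else a"])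
     (simp add: numeral_eq_Suc algebra_simps)

lemma of_nat_square_choose:
  "(of_nat n :: complex) * of_nat n = 2 * of_nat (n choose Suc (Suc 0)) + of_nat n"
  by (induction n) (simp_all add: algebra_simps)

lemma qform_product:
  "qform 3 (\<lambda>\<alpha>. (a + b * of_nat (fst \<alpha>) + c * of_nat (snd \<alpha>)) *
                (a' + b' * of_nat (fst \<alpha>) + c' * of_nat (snd \<alpha>)))"
  unfolding qform_def
  \<comment> \<open>The product is expanded with \<open>i * i = 2 * (i choose 2) + i\<close>, which
    explains the extra terms in the linear coefficients.\<close>
  apply (rule exI[of _ "\<lambda>p q. if p = 0 \<and> q = 0 then a * a'
      else if p = 1 \<and> q = 0 then a * b' + b * a' + b * b'
      else if p = 0 \<and> q = 1 then a * c' + c * a' + c * c'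
      else if p = 1 \<and> q = 1 then b * c' + c * b'
      else if p = 2 then 2 * b * b' else 2 * c * c'"])
  apply (intro allI)
  apply (simp add: eval_nat_numeral(2,3) lessThan_Suc)
  apply (simp add: of_nat_square_choose algebra_simps)
  done

text \<open>Multiplying the Hasse derivative of order \<open>(p, q)\<close> by
  \<open>s ^ p * t ^ q\<close> makes it act on each coefficient by binomials of the exponents
  (\<open>hasse_mult_power\<close>). So a point of multiplicity \<open>m\<close> annihilates every
  weighting of degree below \<open>m\<close>.\<close>

lemma vanish2_qform:
  assumes "vanish2 D c m (s, t)" "qform m f"
  shows "(\<Sum>\<alpha>\<in>D. c \<alpha> * f \<alpha> * (s ^ fst \<alpha> * t ^ snd \<alpha>)) = 0"
proof -
  obtain l where f: "\<And>\<alpha>. f \<alpha> =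
     (\<Sum>p<m. \<Sum>q<m - p. l p q * (of_nat (fst \<alpha> choose p) * of_nat (snd \<alpha> choose q)))"
    using assms(2) by (auto simp: qform_def)
  have z: "(\<Sum>\<alpha>\<in>D. c \<alpha> * (of_nat (fst \<alpha> choose p) * of_nat (snd \<alpha> choose q)) * (s ^ fst \<alpha> * t ^ snd \<alpha>)) = 0"
    if "p + q < m" for p q
  proof -
    have "(\<Sum>\<alpha>\<in>D. c \<alpha> * (of_nat (fst \<alpha> choose p) * of_nat (snd \<alpha> choose q)) * (s ^ fst \<alpha> * t ^ snd \<alpha>))
      = (\<Sum>\<alpha>\<in>D. c \<alpha> * ((of_nat (fst \<alpha> choose p) * s ^ fst \<alpha>) * (of_nat (snd \<alpha> choose q) * t ^ snd \<alpha>)))"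
      by (simp add: mult_ac)
    also have "\<dots> = (\<Sum>\<alpha>\<in>D. c \<alpha> * (hasse p (fst \<alpha>) s * hasse q (snd \<alpha>) t)) * (s ^ p * t ^ q)"
      unfolding hasse_mult_power[symmetric] by (simp add: sum_distrib_left sum_distrib_right mult_ac)
    also have "\<dots> = 0" using assms(1) that by (simp add: vanish2_def)
    finally show ?thesis .
  qed
  have "(\<Sum>\<alpha>\<in>D. c \<alpha> * f \<alpha> * (s ^ fst \<alpha> * t ^ snd \<alpha>)) = (\<Sum>\<alpha>\<in>D. \<Sum>p<m. \<Sum>q<m - p. l p q *
      (c \<alpha> * (of_nat (fst \<alpha> choose p) * of_nat (snd \<alpha> choose q)) * (s ^ fst \<alpha> * t ^ snd \<alpha>)))"
    unfolding f by (simp add: sum_distrib_left sum_distrib_right mult_ac)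
  also have "\<dots> = (\<Sum>p<m. \<Sum>q<m - p. l p q * (\<Sum>\<alpha>\<in>D.
      c \<alpha> * (of_nat (fst \<alpha> choose p) * of_nat (snd \<alpha> choose q)) * (s ^ fst \<alpha> * t ^ snd \<alpha>)))"
    by (subst sum.swap, intro sum.cong refl, subst sum.swap) (simp add: sum_distrib_left)
  also have "\<dots> = 0" by (intro sum.neutral ballI) (simp add: z)
  finally show ?thesis .
qed

text \<open>Toric degeneration: let the point \<open>(\<tau> ^ M, \<tau>\<inverse>)\<close> tend to the boundary of the torus. In
  the limit \<open>\<tau> \<rightarrow> 0\<close> its conditions kill exactly the coefficients of the monomials in \<open>D'\<close>.\<close>

lemma degeneration:
  fixes M :: nat
  defines "e \<equiv> \<lambda>\<alpha>. int M * int (fst \<alpha>) - int (snd \<alpha>)"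
  assumes fin: "finite D" and sub: "D' \<subseteq> D" and K: "indep2 (D - D') K"
    and f: "\<And>\<beta>. \<beta> \<in> D' \<Longrightarrow> \<exists>f. qform m f \<and> f \<beta> \<noteq> 0 \<and> (\<forall>\<alpha>\<in>D. \<alpha> \<noteq> \<beta> \<longrightarrow> e \<alpha> \<le> e \<beta> \<longrightarrow> f \<alpha> = 0)"
  shows "\<exists>P. indep2 D (insert (m, P) K)"
proof -
  obtain F where F: "\<And>\<beta>. \<beta> \<in> D' \<Longrightarrow> qform m (F \<beta>)" "\<And>\<beta>. \<beta> \<in> D' \<Longrightarrow> F \<beta> \<beta> \<noteq> 0"
    "\<And>\<beta> \<alpha>. \<beta> \<in> D' \<Longrightarrow> \<alpha> \<in> D \<Longrightarrow> \<alpha> \<noteq> \<beta> \<Longrightarrow> e \<alpha> \<le> e \<beta> \<Longrightarrow> F \<beta> \<alpha> = 0"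
    using f by metis
  \<comment> \<open>One row for each condition of \<open>K\<close>, and for each
    \<open>\<beta>\<close> a combination of the conditions at the new point, divided by
    \<open>\<tau>\<close> to the power \<open>e \<beta>\<close>. Where \<open>F \<beta>\<close> is
    nonzero the exponent is positive except at \<open>\<beta>\<close> itself, so at
    \<open>\<tau> = 0\<close> the row reads
    \<open>c \<beta> * F \<beta> \<beta> = 0\<close>.\<close>
  define R where "R = (\<lambda>(k, p, q). Inl (k, p, q)) ` {(k, p, q). k \<in> K \<and> p + q < fst k} \<union> Inr ` D'"
  define A where "A r \<alpha> \<tau> = (case r of
      Inl (k, p, q) \<Rightarrow> hasse p (fst \<alpha>) (fst (snd k)) * hasse q (snd \<alpha>) (snd (snd k))
    | Inr \<beta> \<Rightarrow> F \<beta> \<alpha> * \<tau> ^ nat (e \<alpha> - e \<beta>))"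
    for r :: "(nat \<times> complex \<times> complex) \<times> nat \<times> nat + nat \<times> nat" and \<alpha> \<tau>
  have rows: "(\<forall>r\<in>R. (\<Sum>\<alpha>\<in>D. c \<alpha> * A r \<alpha> \<tau>) = 0) \<longleftrightarrow>
     (\<forall>(m, P)\<in>K. vanish2 D c m P) \<and> (\<forall>\<beta>\<in>D'. (\<Sum>\<alpha>\<in>D. c \<alpha> * (F \<beta> \<alpha> * \<tau> ^ nat (e \<alpha> - e \<beta>))) = 0)" for c \<tau>
    unfolding R_def A_def ball_Un by (auto simp: vanish2_def split: sum.splits) 
  have "finite {\<tau>. \<exists>c. (\<forall>r\<in>R. (\<Sum>\<alpha>\<in>D. c \<alpha> * A r \<alpha> \<tau>) = 0) \<and> \<not> (\<forall>\<alpha>\<in>D. c \<alpha> = 0)}"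
  proof (rule polyfun_elimination[where ?t0.0 = 0])
    show "polyfun (A r \<alpha>)" for r \<alpha>
      unfolding A_def by (cases r) (auto split: prod.splits intro!: polyfun_mult polyfun_power)
  next
    fix c assume "\<forall>r\<in>R. (\<Sum>\<alpha>\<in>D. c \<alpha> * A r \<alpha> 0) = 0"
    then have c: "\<forall>(m, P)\<in>K. vanish2 D c m P"
      "\<And>\<beta>. \<beta> \<in> D' \<Longrightarrow> (\<Sum>\<alpha>\<in>D. c \<alpha> * (F \<beta> \<alpha> * 0 ^ nat (e \<alpha> - e \<beta>))) = 0"
      by (auto simp: rows)
    have 0: "c \<beta> = 0" if "\<beta> \<in> D'" for \<beta>
    proof -
      have "(\<Sum>\<alpha>\<in>D. c \<alpha> * (F \<beta> \<alpha> * 0 ^ nat (e \<alpha> - e \<beta>))) = (\<Sum>\<alpha>\<in>{\<beta>}. c \<alpha> * (F \<beta> \<alpha> * 0 ^ nat (e \<alpha> - e \<beta>)))"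
        by (rule sum.mono_neutral_right[OF fin]) (use that sub F(3)[OF that] in \<open>force+\<close>)
      then show ?thesis using c(2)[OF that] F(2)[OF that] by simp
    qed
    have "(\<Sum>\<alpha>\<in>D - D'. c \<alpha> * h \<alpha>) = (\<Sum>\<alpha>\<in>D. c \<alpha> * h \<alpha>)" for h
      by (rule sum.mono_neutral_left[OF fin]) (use 0 in auto)
    then have "\<forall>(m, P)\<in>K. vanish2 (D - D') c m P" using c(1) by (simp add: vanish2_def)
    then have "\<forall>\<alpha>\<in>D - D'. c \<alpha> = 0" using K by (auto simp: indep2_def)
    then show "\<forall>\<alpha>\<in>D. c \<alpha> = 0" using 0 by blast
  qed (use fin in auto)
  \<comment> \<open>The value 0 is excluded because the new point has \<open>inverse \<tau>\<close>
    as a coordinate; there the monomial \<open>\<alpha>\<close> takes the value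
    \<open>\<tau> powi e \<alpha>\<close>.\<close>
  then have "finite (insert 0 {\<tau>. \<exists>c. (\<forall>r\<in>R. (\<Sum>\<alpha>\<in>D. c \<alpha> * A r \<alpha> \<tau>) = 0) \<and> \<not> (\<forall>\<alpha>\<in>D. c \<alpha> = 0)})" by simp
  then obtain \<tau> :: complex where "\<tau> \<notin> insert 0 {\<tau>. \<exists>c. (\<forall>r\<in>R. (\<Sum>\<alpha>\<in>D. c \<alpha> * A r \<alpha> \<tau>) = 0) \<and> \<not> (\<forall>\<alpha>\<in>D. c \<alpha> = 0)}"
    using ex_new_if_finite[OF infinite_UNIV_char_0] by blast
  then have \<tau>: "\<tau> \<noteq> 0" "\<And>c. (\<forall>r\<in>R. (\<Sum>\<alpha>\<in>D. c \<alpha> * A r \<alpha> \<tau>) = 0) \<Longrightarrow> (\<forall>\<alpha>\<in>D. c \<alpha> = 0)" by auto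
  have "indep2 D (insert (m, (\<tau> ^ M, inverse \<tau>)) K)"
    unfolding indep2_def
  proof (intro allI impI)
    fix c assume c: "\<forall>(m, P)\<in>insert (m, (\<tau> ^ M, inverse \<tau>)) K. vanish2 D c m P"
    have "(\<Sum>\<alpha>\<in>D. c \<alpha> * (F \<beta> \<alpha> * \<tau> ^ nat (e \<alpha> - e \<beta>))) = 0" if "\<beta> \<in> D'" for \<beta>
    proof -
      have pw: "(\<tau> ^ M) ^ i * inverse \<tau> ^ j = \<tau> powi (int M * int i - int j)" for i j
        using \<tau>(1) by (simp add: power_int_diff power_int_mult divide_inverse power_inverse power_mult)
      have "(\<Sum>\<alpha>\<in>D. c \<alpha> * (F \<beta> \<alpha> * \<tau> ^ nat (e \<alpha> - e \<beta>))) * \<tau> powi e \<beta>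
          = (\<Sum>\<alpha>\<in>D. c \<alpha> * F \<beta> \<alpha> * ((\<tau> ^ M) ^ fst \<alpha> * inverse \<tau> ^ snd \<alpha>))"
        unfolding sum_distrib_right
      proof (rule sum.cong[OF refl])
        fix \<alpha> assume \<alpha>: "\<alpha> \<in> D"
        show "c \<alpha> * (F \<beta> \<alpha> * \<tau> ^ nat (e \<alpha> - e \<beta>)) * \<tau> powi e \<beta>
            = c \<alpha> * F \<beta> \<alpha> * ((\<tau> ^ M) ^ fst \<alpha> * inverse \<tau> ^ snd \<alpha>)"
        proof (cases "F \<beta> \<alpha> = 0")
          case False
          then have "e \<beta> \<le> e \<alpha>" using F(3)[OF that \<alpha>] by force
          then have "\<tau> ^ nat (e \<alpha> - e \<beta>) = \<tau> powi (e \<alpha> - e \<beta>)" by (simp add: power_int_def)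
          then have "\<tau> ^ nat (e \<alpha> - e \<beta>) * \<tau> powi e \<beta> = \<tau> powi e \<alpha>"
            using \<tau>(1) by (simp flip: power_int_add)
          then show ?thesis by (simp add: pw mult.assoc) (simp add: e_def)
        qed simp
      qed
      also have "\<dots> = 0" by (rule vanish2_qform) (use c F(1)[OF that] in auto)
      finally show ?thesis using \<tau>(1) by simp
    qed
    with c show "\<forall>\<alpha>\<in>D. c \<alpha> = 0" by (intro \<tau>(2)) (auto simp: rows)
  qed
  then show ?thesis ..
qed

section \<open>Row games\<close>

fun rowset :: "nat \<Rightarrow> nat list \<Rightarrow> (nat \<times> nat) set" where
  "rowset f [] = {}"
| "rowset f (n # l) = {f} \<times> {..<n} \<union> rowset (Suc f) l"

lemma finite_rowset [simp]: "finite (rowset f l)"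
  by (induction f l rule: rowset.induct) auto

lemma rowset_ge: "\<alpha> \<in> rowset f l \<Longrightarrow> f \<le> fst \<alpha>"
  by (induction f l rule: rowset.induct) auto

text \<open>If \<open>M\<close> exceeds all second exponents, the weight orders cells first by row
  and, inside a row, from right to left.\<close>

lemma degeneration_lex:
  assumes fin: "finite D" and sub: "D0 \<subseteq> D" and K: "indep2 D0 K"
    and f: "\<And>\<beta>. \<beta> \<in> D - D0 \<Longrightarrow> \<exists>f. qform m f \<and> f \<beta> \<noteq> 0 \<and>
      (\<forall>\<alpha>\<in>D. fst \<alpha> < fst \<beta> \<or> fst \<alpha> = fst \<beta> \<and> snd \<beta> < snd \<alpha> \<longrightarrow> f \<alpha> = 0)"
  shows "\<exists>P. indep2 D (insert (m, P) K)"
proof -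
  obtain M where M: "\<And>\<alpha>. \<alpha> \<in> D \<Longrightarrow> snd \<alpha> < M"
    using finite_nat_set_iff_bounded[of "snd ` D"] fin by auto
  have lex: "fst \<alpha> < fst \<beta> \<or> fst \<alpha> = fst \<beta> \<and> snd \<beta> < snd \<alpha>"
    if "\<alpha> \<in> D" "\<beta> \<in> D" "\<alpha> \<noteq> \<beta>"
      "int M * int (fst \<alpha>) - int (snd \<alpha>) \<le> int M * int (fst \<beta>) - int (snd \<beta>)" for \<alpha> \<beta>
  proof (cases "fst \<beta> < fst \<alpha>")
    case True
    then have "int M * (int (fst \<beta>) + 1) \<le> int M * int (fst \<alpha>)" by (intro mult_left_mono) auto
    then have "int M \<le> int (snd \<alpha>)" using that(4) by (simp add: algebra_simps)
    then show ?thesis using M[OF that(1)] by simp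
  next
    case False
    then show ?thesis using that by (cases \<alpha>; cases \<beta>) auto
  qed
  have "indep2 (D - (D - D0)) K" using K sub by (simp add: double_diff)
  then show ?thesis
  proof (rule degeneration[OF fin _, where M = M, rotated])
    fix \<beta> assume \<beta>: "\<beta> \<in> D - D0"
    from f[OF this] obtain g where g: "qform m g" "g \<beta> \<noteq> 0"
      "\<And>\<alpha>. \<alpha> \<in> D \<Longrightarrow> fst \<alpha> < fst \<beta> \<or> fst \<alpha> = fst \<beta> \<and> snd \<beta> < snd \<alpha> \<Longrightarrow> g \<alpha> = 0" by blast
    show "\<exists>f. qform m f \<and> f \<beta> \<noteq> 0 \<and> (\<forall>\<alpha>\<in>D. \<alpha> \<noteq> \<beta> \<longrightarrow>
      int M * int (fst \<alpha>) - int (snd \<alpha>) \<le> int M * int (fst \<beta>) - int (snd \<beta>) \<longrightarrow> f \<alpha> = 0)"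
      using g lex \<beta> by (intro exI[of _ g]) blast
  qed auto
qed

text \<open>Lists fix the number of points while allowing repetitions.\<close>

definition planar :: "(nat \<times> nat) set \<Rightarrow> nat \<Rightarrow> nat \<Rightarrow> nat \<Rightarrow> bool" where
  "planar D x y v \<longleftrightarrow> (\<exists>T U V. length T = x \<and> length U = y \<and> length V = v \<and>
     indep2 D (Pair 3 ` set T \<union> Pair 2 ` set U \<union> Pair 1 ` set V))"

lemma planar_remove:
  assumes "planar D0 x y v" "finite D" "D0 \<subseteq> D"
    and "\<And>\<beta>. \<beta> \<in> D - D0 \<Longrightarrow> \<exists>f. qform m f \<and> f \<beta> \<noteq> 0 \<and>
      (\<forall>\<alpha>\<in>D. fst \<alpha> < fst \<beta> \<or> fst \<alpha> = fst \<beta> \<and> snd \<beta> < snd \<alpha> \<longrightarrow> f \<alpha> = 0)"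
  shows "m = 3 \<Longrightarrow> planar D (Suc x) y v" "m = 2 \<Longrightarrow> planar D x (Suc y) v" "m = 1 \<Longrightarrow> planar D x y (Suc v)"
proof -
  obtain T U V where TUV: "length T = x" "length U = y" "length V = v"
    "indep2 D0 (Pair 3 ` set T \<union> Pair 2 ` set U \<union> Pair 1 ` set V)"
    using assms(1) by (auto simp: planar_def)
  obtain P where P: "indep2 D (insert (m, P) (Pair 3 ` set T \<union> Pair 2 ` set U \<union> Pair 1 ` set V))"
    using degeneration_lex[OF assms(2,3) TUV(4) assms(4)] by blast
  show "planar D (Suc x) y v" if "m = 3"
    unfolding planar_def
    by (rule exI[of _ "P # T"], rule exI[of _ U], rule exI[of _ V]) (use P TUV that in simp)
  show "planar D x (Suc y) v" if "m = 2"
    unfolding planar_def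
    by (rule exI[of _ T], rule exI[of _ "P # U"], rule exI[of _ V]) (use P TUV that in simp)
  show "planar D x y (Suc v)" if "m = 1"
    unfolding planar_def
    by (rule exI[of _ T], rule exI[of _ U], rule exI[of _ "P # V"]) (use P TUV that in simp)
qed

text \<open>A triple point takes \<open>3, 2, 1\<close> from the first rows; if the first row is nearly exhausted, it
  takes what is left there and \<open>3\<close> from the second row. Double points behave likewise.\<close>

inductive win :: "nat list \<Rightarrow> nat \<Rightarrow> nat \<Rightarrow> nat \<Rightarrow> bool" where
  nil: "win [] x y v"
| zero: "win l x y v \<Longrightarrow> win (0 # l) x y v"
| simple: "win (n # l) x y v \<Longrightarrow> win (Suc n # l) x y (Suc v)"
| double: "win (n0 # n1 # l) x y v \<Longrightarrow> a \<le> 2 \<Longrightarrow> b \<le> 1 \<Longrightarrow>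
    win ((n0 + a) # (n1 + b) # l) x (Suc y) v"
| double1: "win (0 # n1 # l) x y v \<Longrightarrow> b \<le> 2 \<Longrightarrow> win (1 # (n1 + b) # l) x (Suc y) v"
| triple: "win (n0 # n1 # n2 # l) x y v \<Longrightarrow> a \<le> 3 \<Longrightarrow> b \<le> 2 \<Longrightarrow> c \<le> 1 \<Longrightarrow>
    win ((n0 + a) # (n1 + b) # (n2 + c) # l) (Suc x) y v"
| triple1: "win (0 # n1 # n2 # l) x y v \<Longrightarrow> b \<le> 3 \<Longrightarrow> c \<le> 2 \<Longrightarrow>
    win (1 # (n1 + b) # (n2 + c) # l) (Suc x) y v"
| triple2: "win (0 # n1 # n2 # l) x y v \<Longrightarrow> b \<le> 3 \<Longrightarrow> c \<le> 1 \<Longrightarrow>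
    win (2 # (n1 + b) # (n2 + c) # l) (Suc x) y v"

abbreviation (input) "aff a b c \<equiv> (\<lambda>\<alpha>. a + b * of_nat (fst \<alpha>) + c * of_nat (snd \<alpha>) :: complex)"

text \<open>A cell \<open>\<beta>\<close> taken by a point of multiplicity \<open>m\<close> needs a
  product of \<open>m - 1\<close> affine functions that vanishes on the earlier rows and on the
  cells to the right of \<open>\<beta>\<close>, but not at \<open>\<beta>\<close>. In a regular move
  an earlier row costs one line and each cell to the right costs one line; the bounds 3, 2, 1 say
  that two lines always suffice.\<close>

lemma win_planar: "win l x y v \<Longrightarrow> planar (rowset f l) x y v"
proof (induction l x y v arbitrary: f rule: win.induct)
  case (nil x y v)
  show ?case unfolding planar_def
    by (rule exI[of _ "replicate x undefined"], rule exI[of _ "replicate y undefined"],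
        rule exI[of _ "replicate v undefined"]) (simp add: indep2_def)
next
  case (zero l x y v)
  then show ?case by simp
next
  case (simple n l x y v)
  show ?case
  proof (rule planar_remove(3)[OF simple.IH[of f]])
    fix \<beta> assume \<beta>: "\<beta> \<in> rowset f (Suc n # l) - rowset f (n # l)"
    then have "\<beta> = (f, n)" by (auto simp: less_Suc_eq)
    then show "\<exists>g. qform 1 g \<and> g \<beta> \<noteq> 0 \<and> (\<forall>\<alpha>\<in>rowset f (Suc n # l).
        fst \<alpha> < fst \<beta> \<or> fst \<alpha> = fst \<beta> \<and> snd \<beta> < snd \<alpha> \<longrightarrow> g \<alpha> = 0)"
      by (intro exI[of _ "\<lambda>_. 1"]) (auto simp: qform_const[simplified] dest: rowset_ge)
  qed auto
next
  case (double n0 n1 l x y v a b)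
  let ?D = "rowset f ((n0 + a) # (n1 + b) # l)"
  show ?case
  proof (rule planar_remove(2)[OF double.IH[of f]])
    fix \<beta> assume \<beta>: "\<beta> \<in> ?D - rowset f (n0 # n1 # l)"
    then consider j where "\<beta> = (f, j)" "n0 \<le> j" "j < n0 + a" | j where "\<beta> = (Suc f, j)" "n1 \<le> j" "j < n1 + b"
      by (auto; meson not_le)
    then show "\<exists>g. qform 2 g \<and> g \<beta> \<noteq> 0 \<and> (\<forall>\<alpha>\<in>?D.
        fst \<alpha> < fst \<beta> \<or> fst \<alpha> = fst \<beta> \<and> snd \<beta> < snd \<alpha> \<longrightarrow> g \<alpha> = 0)"
    proof cases
      case (1 j)
      have "\<alpha> = (f, j + 1)" if "\<alpha> \<in> ?D" "fst \<alpha> < f \<or> fst \<alpha> = f \<and> j < snd \<alpha>" for \<alpha>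
        using that 1 double.hyps by (auto dest: rowset_ge)
      then show ?thesis using 1
        by (intro exI[of _ "aff (- of_nat (j + 1)) 0 1"] conjI qform_affine) (fastforce simp: algebra_simps)+
    next
      case (2 j)
      have "fst \<alpha> = f" if "\<alpha> \<in> ?D" "fst \<alpha> < Suc f \<or> fst \<alpha> = Suc f \<and> j < snd \<alpha>" for \<alpha>
        using that 2 double.hyps by (auto dest: rowset_ge)
      then show ?thesis using 2
        by (intro exI[of _ "aff (- of_nat f) 1 0"] conjI qform_affine) (fastforce simp: algebra_simps)+
    qed
  qed auto
next
  case (double1 n1 l x y v b)
  let ?D = "rowset f (1 # (n1 + b) # l)"
  show ?case
  proof (rule planar_remove(2)[OF double1.IH[of f]])
    fix \<beta> assume \<beta>: "\<beta> \<in> ?D - rowset f (0 # n1 # l)"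
    then consider "\<beta> = (f, 0)" | j where "\<beta> = (Suc f, j)" "n1 \<le> j" "j < n1 + b"
      by (auto; meson not_le)
    then show "\<exists>g. qform 2 g \<and> g \<beta> \<noteq> 0 \<and> (\<forall>\<alpha>\<in>?D.
        fst \<alpha> < fst \<beta> \<or> fst \<alpha> = fst \<beta> \<and> snd \<beta> < snd \<alpha> \<longrightarrow> g \<alpha> = 0)"
    proof cases
      case 1
      then show ?thesis
        by (intro exI[of _ "aff 1 0 0"] conjI qform_affine) (auto dest: rowset_ge)
    next
      case (2 j)
      have "\<alpha> = (f, 0) \<or> \<alpha> = (Suc f, j + 1)" if "\<alpha> \<in> ?D" "fst \<alpha> < Suc f \<or> fst \<alpha> = Suc f \<and> j < snd \<alpha>" for \<alpha>
        using that 2 double1.hyps by (auto dest: rowset_ge)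
      then show ?thesis using 2
        \<comment> \<open>Row \<open>f\<close> consists of one cell, so a slanted line through
          \<open>(f, 0)\<close> and \<open>(Suc f, j + 1)\<close> deals with it and with the cell to
          the right at once.\<close>
        by (intro exI[of _ "aff (of_nat f * of_nat (j + 1)) (- of_nat (j + 1)) 1"] conjI qform_affine)
           (fastforce simp: algebra_simps)+
    qed
  qed auto
next
  case (triple n0 n1 n2 l x y v a b c)
  let ?D = "rowset f ((n0 + a) # (n1 + b) # (n2 + c) # l)"
  show ?case
  proof (rule planar_remove(1)[OF triple.IH[of f]])
    fix \<beta> assume \<beta>: "\<beta> \<in> ?D - rowset f (n0 # n1 # n2 # l)"
    then consider j where "\<beta> = (f, j)" "n0 \<le> j" "j < n0 + a" | j where "\<beta> = (Suc f, j)" "n1 \<le> j" "j < n1 + b"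
      | j where "\<beta> = (Suc (Suc f), j)" "n2 \<le> j" "j < n2 + c"
      by (auto; meson not_le)
    then show "\<exists>g. qform 3 g \<and> g \<beta> \<noteq> 0 \<and> (\<forall>\<alpha>\<in>?D.
        fst \<alpha> < fst \<beta> \<or> fst \<alpha> = fst \<beta> \<and> snd \<beta> < snd \<alpha> \<longrightarrow> g \<alpha> = 0)"
    proof cases
      case (1 j)
      have "\<alpha> = (f, j + 1) \<or> \<alpha> = (f, j + 2)" if "\<alpha> \<in> ?D" "fst \<alpha> < f \<or> fst \<alpha> = f \<and> j < snd \<alpha>" for \<alpha>
        using that 1 triple.hyps by (auto dest: rowset_ge)
      then show ?thesis using 1
        by (intro exI[of _ "\<lambda>\<alpha>. aff (- of_nat (j + 1)) 0 1 \<alpha> * aff (- of_nat (j + 2)) 0 1 \<alpha>"]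
              conjI qform_product) (fastforce simp: algebra_simps)+
    next
      case (2 j)
      have "fst \<alpha> = f \<or> \<alpha> = (Suc f, j + 1)" if "\<alpha> \<in> ?D" "fst \<alpha> < Suc f \<or> fst \<alpha> = Suc f \<and> j < snd \<alpha>" for \<alpha>
        using that 2 triple.hyps by (auto dest: rowset_ge)
      then show ?thesis using 2
        by (intro exI[of _ "\<lambda>\<alpha>. aff (- of_nat f) 1 0 \<alpha> * aff (- of_nat (j + 1)) 0 1 \<alpha>"]
              conjI qform_product) (fastforce simp: algebra_simps)+
    next
      case (3 j)
      have "fst \<alpha> = f \<or> fst \<alpha> = Suc f" if "\<alpha> \<in> ?D"
        "fst \<alpha> < Suc (Suc f) \<or> fst \<alpha> = Suc (Suc f) \<and> j < snd \<alpha>" for \<alpha>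
        using that 3 triple.hyps by (auto dest: rowset_ge)
      then show ?thesis using 3
        by (intro exI[of _ "\<lambda>\<alpha>. aff (- of_nat f) 1 0 \<alpha> * aff (- of_nat (Suc f)) 1 0 \<alpha>"]
              conjI qform_product) (fastforce simp: algebra_simps)+
    qed
  qed auto
next
  case (triple1 n1 n2 l x y v b c)
  let ?D = "rowset f (1 # (n1 + b) # (n2 + c) # l)"
  show ?case
  proof (rule planar_remove(1)[OF triple1.IH[of f]])
    fix \<beta> assume \<beta>: "\<beta> \<in> ?D - rowset f (0 # n1 # n2 # l)"
    then consider "\<beta> = (f, 0)" | j where "\<beta> = (Suc f, j)" "n1 \<le> j" "j < n1 + b"
      | j where "\<beta> = (Suc (Suc f), j)" "n2 \<le> j" "j < n2 + c"
      by (auto; meson not_le)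
    then show "\<exists>g. qform 3 g \<and> g \<beta> \<noteq> 0 \<and> (\<forall>\<alpha>\<in>?D.
        fst \<alpha> < fst \<beta> \<or> fst \<alpha> = fst \<beta> \<and> snd \<beta> < snd \<alpha> \<longrightarrow> g \<alpha> = 0)"
    proof cases
      case 1
      then show ?thesis
        by (intro exI[of _ "\<lambda>\<alpha>. aff 1 0 0 \<alpha> * aff 1 0 0 \<alpha>"] conjI qform_product) (auto dest: rowset_ge)
    next
      case (2 j)
      have "\<alpha> = (f, 0) \<or> \<alpha> = (Suc f, j + 1) \<or> \<alpha> = (Suc f, j + 2)"
        if "\<alpha> \<in> ?D" "fst \<alpha> < Suc f \<or> fst \<alpha> = Suc f \<and> j < snd \<alpha>" for \<alpha>
        using that 2 triple1.hyps by (auto dest: rowset_ge)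
      then show ?thesis using 2
        by (intro exI[of _ "\<lambda>\<alpha>. aff (of_nat f * of_nat (j + 1)) (- of_nat (j + 1)) 1 \<alpha> *
              aff (- of_nat (j + 2)) 0 1 \<alpha>"] conjI qform_product) (fastforce simp: algebra_simps)+
    next
      case (3 j)
      have "\<alpha> = (f, 0) \<or> fst \<alpha> = Suc f \<or> \<alpha> = (Suc (Suc f), j + 1)" if "\<alpha> \<in> ?D"
        "fst \<alpha> < Suc (Suc f) \<or> fst \<alpha> = Suc (Suc f) \<and> j < snd \<alpha>" for \<alpha>
        using that 3 triple1.hyps by (auto dest: rowset_ge)
      then show ?thesis using 3
        \<comment> \<open>The first line is the row \<open>Suc f\<close>; the second joins
          \<open>(f, 0)\<close> to \<open>(Suc (Suc f), j + 1)\<close>, two rows apart, hence the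
          coefficient 2.\<close>
        by (intro exI[of _ "\<lambda>\<alpha>. aff (- of_nat (Suc f)) 1 0 \<alpha> *
              aff (of_nat f * of_nat (j + 1)) (- of_nat (j + 1)) 2 \<alpha>"] conjI qform_product)
           (fastforce simp: algebra_simps)+
    qed
  qed auto
next
  case (triple2 n1 n2 l x y v b c)
  let ?D = "rowset f (2 # (n1 + b) # (n2 + c) # l)"
  show ?case
  proof (rule planar_remove(1)[OF triple2.IH[of f]])
    fix \<beta> assume \<beta>: "\<beta> \<in> ?D - rowset f (0 # n1 # n2 # l)"
    then consider j where "\<beta> = (f, j)" "j < 2" | j where "\<beta> = (Suc f, j)" "n1 \<le> j" "j < n1 + b"
      | j where "\<beta> = (Suc (Suc f), j)" "n2 \<le> j" "j < n2 + c"
      by (auto; meson not_le)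
    then show "\<exists>g. qform 3 g \<and> g \<beta> \<noteq> 0 \<and> (\<forall>\<alpha>\<in>?D.
        fst \<alpha> < fst \<beta> \<or> fst \<alpha> = fst \<beta> \<and> snd \<beta> < snd \<alpha> \<longrightarrow> g \<alpha> = 0)"
    proof cases
      case (1 j)
      have "\<alpha> = (f, j + 1)" if "\<alpha> \<in> ?D" "fst \<alpha> < f \<or> fst \<alpha> = f \<and> j < snd \<alpha>" for \<alpha>
        using that 1 triple2.hyps by (auto dest: rowset_ge)
      then show ?thesis using 1
        by (intro exI[of _ "\<lambda>\<alpha>. aff (- of_nat (j + 1)) 0 1 \<alpha> * aff 1 0 0 \<alpha>"]
              conjI qform_product) (fastforce simp: algebra_simps)+
    next
      case (2 j)
      have "\<alpha> = (f, 0) \<or> \<alpha> = (f, 1) \<or> \<alpha> = (Suc f, j + 1) \<or> \<alpha> = (Suc f, j + 2)"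
        if "\<alpha> \<in> ?D" "fst \<alpha> < Suc f \<or> fst \<alpha> = Suc f \<and> j < snd \<alpha>" for \<alpha>
        using that 2 triple2.hyps by (auto dest: rowset_ge)
      then show ?thesis using 2
        \<comment> \<open>Two parallel lines, one through \<open>(f, 0)\<close> and
          \<open>(Suc f, j + 1)\<close>, the other through \<open>(f, 1)\<close> and
          \<open>(Suc f, j + 2)\<close>.\<close>
        by (intro exI[of _ "\<lambda>\<alpha>. aff (of_nat f * of_nat (j + 1)) (- of_nat (j + 1)) 1 \<alpha> *
              aff (of_nat f * of_nat (j + 1) - 1) (- of_nat (j + 1)) 1 \<alpha>"] conjI qform_product)
           (fastforce simp: algebra_simps)+
    next
      case (3 j)
      have "fst \<alpha> = f \<or> fst \<alpha> = Suc f" if "\<alpha> \<in> ?D"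
        "fst \<alpha> < Suc (Suc f) \<or> fst \<alpha> = Suc (Suc f) \<and> j < snd \<alpha>" for \<alpha>
        using that 3 triple2.hyps by (auto dest: rowset_ge)
      then show ?thesis using 3
        by (intro exI[of _ "\<lambda>\<alpha>. aff (- of_nat f) 1 0 \<alpha> * aff (- of_nat (Suc f)) 1 0 \<alpha>"]
              conjI qform_product) (fastforce simp: algebra_simps)+
    qed
  qed auto
qed

text \<open>The two trailing empty rows make the rules of the game applicable near the end.\<close>

fun rows :: "nat \<Rightarrow> nat list" where
  "rows 0 = [0, 0]"
| "rows (Suc n) = Suc n # rows n"

lemma rowset_rows: "rowset f (rows n) = {(i, j). f \<le> i \<and> i + j < n + f}"
  by (induction n arbitrary: f) auto

lemma win_more: "win l x y v \<Longrightarrow> win l (x + x') (y + y') (v + v')"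
proof (induction rule: win.induct)
  case (double n0 n1 l x y v a b)
  then show ?case using win.double[of n0 n1 l "x + x'" "y + y'" "v + v'" a b] by simp
next
  case (double1 n1 l x y v b)
  then show ?case using win.double1[of n1 l "x + x'" "y + y'" "v + v'" b] by simp
next
  case (triple n0 n1 n2 l x y v a b c)
  then show ?case using win.triple[of n0 n1 n2 l "x + x'" "y + y'" "v + v'" a b c] by simp
next
  case (triple1 n1 n2 l x y v b c)
  then show ?case using win.triple1[of n1 n2 l "x + x'" "y + y'" "v + v'" b c] by simp
next
  case (triple2 n1 n2 l x y v b c)
  then show ?case using win.triple2[of n1 n2 l "x + x'" "y + y'" "v + v'" b c] by simp
qed (auto intro: win.intros)

lemma win_mono: "win l x y v \<Longrightarrow> x \<le> x' \<Longrightarrow> y \<le> y' \<Longrightarrow> v \<le> v' \<Longrightarrow> win l x' y' v'"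
  using win_more[of l x y v "x' - x" "y' - y" "v' - v"] by simp

lemma win_simple: "sum_list l \<le> v \<Longrightarrow> win l x y v"
proof (induction l arbitrary: v)
  case Nil
  show ?case by (rule win.nil)
next
  case (Cons n l)
  have step: "win (n # l) x y (n + w)" if "win l x y w" for n w
    using that by (induction n) (auto intro: win.intros)
  have "win l x y (v - n)" using Cons.prems by (intro Cons.IH) auto
  from step[OF this, of n] show ?case using Cons.prems by simp
qed

section \<open>Greedy play and finite checks\<close>

text \<open>Like \<open>tplay\<close> below, a greedy move from the front. Truncated subtraction is
  where conditions are wasted: a point may take fewer cells than it has conditions.\<close>

fun dplay :: "nat list \<Rightarrow> nat list" where
  "dplay (n0 # n1 # l) = (if n0 = 0 then dplay (n1 # l)
     else if n0 = 1 then (n1 - 2) # l else (n0 - 2) # (n1 - 1) # l)"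
| "dplay l = l"

fun tplay :: "nat list \<Rightarrow> nat list" where
  "tplay (n0 # n1 # n2 # l) = (if n0 = 0 then tplay (n1 # n2 # l)
     else if n0 = 1 \<and> 3 \<le> n1 then (n1 - 3) # (n2 - 2) # l
     else if n0 = 2 \<and> 3 \<le> n1 then (n1 - 3) # (n2 - 1) # l
     else (n0 - 3) # (n1 - 2) # (n2 - 1) # l)"
| "tplay l = l"

lemma win_dplay: "win (dplay l) x y v \<Longrightarrow> win l x (Suc y) v"
proof (induction l rule: dplay.induct)
  case (1 n0 n1 l)
  consider "n0 = 0" | "n0 = 1" | "n0 \<ge> 2" by linarith
  then show ?case
  proof cases
    case 2
    then have "win (1 # ((n1 - 2) + min 2 n1) # l) x (Suc y) v"
      using 1 by (intro win.double1 win.zero) auto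
    moreover have "(n1 - 2) + min 2 n1 = n1" by auto
    ultimately show ?thesis using 2 by simp
  next
    case 3
    then have "win (((n0 - 2) + 2) # ((n1 - 1) + min 1 n1) # l) x (Suc y) v"
      using 1 by (intro win.double) auto
    moreover have "(n0 - 2) + 2 = n0" "(n1 - 1) + min 1 n1 = n1" using 3 by auto
    ultimately show ?thesis by simp
  qed (use 1 in \<open>auto intro: win.zero\<close>)
qed (auto elim: win_mono)

lemma win_tplay: "win (tplay l) x y v \<Longrightarrow> win l (Suc x) y v"
proof (induction l rule: tplay.induct)
  case (1 n0 n1 n2 l)
  consider "n0 = 0" | "n0 = 1" "n1 \<ge> 3" | "n0 = 2" "n1 \<ge> 3"
    | "n0 \<noteq> 0" "\<not> (n0 = 1 \<and> 3 \<le> n1)" "\<not> (n0 = 2 \<and> 3 \<le> n1)" by linarith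
  then show ?case
  proof cases
    case 2
    then have "win (1 # ((n1 - 3) + 3) # ((n2 - 2) + min 2 n2) # l) (Suc x) y v"
      using 1 by (intro win.triple1 win.zero) auto
    moreover have "(n1 - 3) + 3 = n1" "(n2 - 2) + min 2 n2 = n2" using 2 by auto
    ultimately show ?thesis using 2 by simp
  next
    case 3
    then have "win (2 # ((n1 - 3) + 3) # ((n2 - 1) + min 1 n2) # l) (Suc x) y v"
      using 1 by (intro win.triple2 win.zero) auto
    moreover have "(n1 - 3) + 3 = n1" "(n2 - 1) + min 1 n2 = n2" using 3 by auto
    ultimately show ?thesis using 3 by simp
  next
    case 4
    then have "win (((n0 - 3) + min 3 n0) # ((n1 - 2) + min 2 n1) # ((n2 - 1) + min 1 n2) # l) (Suc x) y v"
      using 1 by (intro win.triple) auto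
    moreover have "(n0 - 3) + min 3 n0 = n0" "(n1 - 2) + min 2 n1 = n1" "(n2 - 1) + min 1 n2 = n2" by auto
    ultimately show ?thesis by simp
  qed (use 1 in \<open>auto intro: win.zero\<close>)
qed (auto elim: win_mono)

fun iter :: "nat \<Rightarrow> ('a \<Rightarrow> 'a) \<Rightarrow> 'a \<Rightarrow> 'a" where
  "iter 0 f s = s"
| "iter (Suc n) f s = iter n f (f s)"

definition remain :: "nat list \<Rightarrow> nat \<Rightarrow> nat \<Rightarrow> nat" where
  "remain l x y = sum_list (iter y dplay (iter x tplay l))"

lemma win_iter_dplay: "win (iter n dplay l) x y v \<Longrightarrow> win l x (n + y) v"
  by (induction n arbitrary: l) (auto dest: win_dplay)

lemma win_iter_tplay: "win (iter n tplay l) x y v \<Longrightarrow> win l (n + x) y v"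
  by (induction n arbitrary: l) (auto dest: win_tplay)

lemma remain_win: "remain l x y \<le> v \<Longrightarrow> win l x y v"
  unfolding remain_def
  using win_iter_tplay[OF win_iter_dplay[OF win_simple], of y x l v 0 0] by simp

text \<open>The \<open>max 1\<close> lets greedy play leave one cell more than the count predicts; a
  single simple point covers it.\<close>

definition defect_ok :: "nat list \<Rightarrow> nat \<Rightarrow> nat \<Rightarrow> nat \<Rightarrow> bool" where
  "defect_ok l y0 x y = (if sum_list l < 6 * x + 3 * y then remain l x y = 0
     else if y < y0 then True else remain l x y \<le> max 1 (sum_list l - 6 * x - 3 * y))"

definition check2 :: "nat \<Rightarrow> nat list \<Rightarrow> nat \<Rightarrow> bool" where
  "check2 y0 l x = list_all (defect_ok l y0 x) [0..<(sum_list l - 6 * x) div 3 + 2]"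

definition check :: "nat \<Rightarrow> nat list \<Rightarrow> bool" where
  "check y0 l = list_all (check2 y0 l) [0..<sum_list l div 6 + 2]"

text \<open>An exact count is required to win when a simple point and \<open>y0\<close> double
  points are at hand. Without simple points one surplus condition is granted, because exact fits
  have exceptions.\<close>

definition good :: "nat \<Rightarrow> nat list \<Rightarrow> nat \<Rightarrow> bool" where
  "good y0 l x \<longleftrightarrow> (\<forall>y v. (y0 \<le> y \<and> 1 \<le> v \<and> sum_list l \<le> 6 * x + 3 * y + v \<or>
      v = 0 \<and> sum_list l < 6 * x + 3 * y) \<longrightarrow> win l x y v)"

lemma check2_good:
  assumes "check2 y0 l x" shows "good y0 l x"
  unfolding good_def
proof (intro allI impI)
  fix y v
  assume A: "y0 \<le> y \<and> 1 \<le> v \<and> sum_list l \<le> 6 * x + 3 * y + v \<or> v = 0 \<and> sum_list l < 6 * x + 3 * y"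
  \<comment> \<open>With \<open>Y\<close> double points the conditions outnumber the cells, so every
    larger \<open>y\<close> follows by monotonicity.\<close>
  define Y where "Y = (sum_list l - 6 * x) div 3 + 1"
  have ok: "defect_ok l y0 x y'" if "y' \<le> Y" for y'
  proof -
    have "y' < (sum_list l - 6 * x) div 3 + 2" using that unfolding Y_def by linarith
    then have "y' \<in> set [0..<(sum_list l - 6 * x) div 3 + 2]" by (simp only: set_upt atLeastLessThan_iff) simp
    then show ?thesis using assms unfolding check2_def list_all_iff by blast
  qed
  show "win l x y v"
  proof (cases "y \<le> Y")
    case True
    then have "remain l x y \<le> v"
      using ok[of y] A by (auto simp: defect_ok_def split: if_splits)
    then show ?thesis by (rule remain_win)
  next
    case False
    have "s < 6 * x + 3 * ((s - 6 * x) div 3 + 1)" for s by presburger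
    then have "sum_list l < 6 * x + 3 * Y" by (simp only: Y_def)
    then have "remain l x Y \<le> 0" using ok[of Y] by (simp add: defect_ok_def)
    then have "win l x Y 0" by (rule remain_win)
    then show ?thesis by (rule win_mono) (use False in auto)
  qed
qed

lemma check_good:
  assumes "check y0 l" shows "good y0 l x"
proof (cases "x \<le> sum_list l div 6 + 1")
  case True
  then have "x < sum_list l div 6 + 2" by linarith
  then have "x \<in> set [0..<sum_list l div 6 + 2]" by (simp only: set_upt atLeastLessThan_iff) simp
  then show ?thesis using assms unfolding check_def list_all_iff by (blast intro: check2_good)
next
  case False
  define X where "X = sum_list l div 6 + 1"
  have "s < 6 * (s div 6 + 1)" for s :: nat by presburger
  then have X: "sum_list l < 6 * X" by (simp only: X_def)
  have "good y0 l X" using assms by (intro check2_good) (auto simp: check_def list_all_iff X_def)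
  then have "win l X 0 0" using X by (auto simp: good_def)
  then show ?thesis using False unfolding good_def by (auto elim!: win_mono simp: X_def)
qed

text \<open>The shapes that the game can reach in front of the full rows from \<open>k\<close> on:
  two partly used rows subject to the inequality that the play preserves.\<close>

definition states :: "nat \<Rightarrow> nat \<Rightarrow> (nat \<times> nat) list" where
  "states c k = filter (\<lambda>(n0, n1). 2 * n0 + c \<le> 3 * n1) (List.product [0..<k + 3] [0..<k + 2])"

lemma states_doubles_check: "list_all (\<lambda>(n0, n1). check2 0 (n0 # n1 # rows 6) 0) (states 5 6)"
  by code_simp

lemma states_triples_check: "list_all (\<lambda>(n0, n1). 1 \<le> n0 \<longrightarrow> check 2 (n0 # n1 # rows 7)) (states 8 7)"
  by code_simp

lemma rows_check: "list_all (\<lambda>n. check 2 (rows n)) [8, 9, 10, 11]"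
  by code_simp

lemma rows_7_check: "check 0 (dplay (dplay (rows 7)))"
  by code_simp

lemma state_doubles: "2 * n0 + 5 \<le> 3 * n1 \<Longrightarrow> n0 \<le> 8 \<Longrightarrow> n1 \<le> 7 \<Longrightarrow> good 0 (n0 # n1 # rows 6) 0"
  using states_doubles_check unfolding list_all_iff by (intro check2_good) (auto simp: states_def simp del: upt.simps)

lemma state_triples:
  "2 * n0 + 8 \<le> 3 * n1 \<Longrightarrow> 1 \<le> n0 \<Longrightarrow> n0 \<le> 9 \<Longrightarrow> n1 \<le> 8 \<Longrightarrow> good 2 (n0 # n1 # rows 7) x"
  using states_triples_check unfolding list_all_iff by (intro check_good) (auto simp: states_def simp del: upt.simps)

lemma good_zero: "good y0 l x \<Longrightarrow> good y0 (0 # l) x"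
  by (auto simp: good_def intro: win.zero)

text \<open>The inequalities between successive rows survive every move that does not exhaust the first row,
  and they ensure that the next move is possible without waste.\<close>

lemma good_doubles:
  assumes "6 \<le> k" "n0 = 0 \<or> 2 * n0 + 5 \<le> 3 * n1" "2 * n1 + 5 \<le> 3 * n2"
    "n0 \<le> k + 3" "n1 \<le> k + 2" "n2 \<le> k + 1"
  shows "good 0 (n0 # n1 # n2 # rows k) 0"
  using assms
\<comment> \<open>When the first row is used up, a row of length \<open>k\<close> joins the front:
  the sum grows by \<open>k\<close>, while the quadratic term drops by
  \<open>4 * k - 2\<close>.\<close>
proof (induction "n0 + n1 + n2 + 2 * k * k" arbitrary: n0 n1 n2 k rule: less_induct)
  case less
  show ?case
  proof (cases "n0 = 0")
    case True
    show ?thesis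
    proof (cases "k = 6")
      case True
      have "good 0 (n1 # n2 # rows 6) 0" using less.prems True by (intro state_doubles) auto
      then show ?thesis using \<open>n0 = 0\<close> True by (auto intro: good_zero)
    next
      case False
      then obtain k' where k': "k = Suc k'" "6 \<le> k'" using less.prems(1) by (cases k) auto
      have "good 0 (n1 # n2 # k # rows k') 0"
        using less.prems k' by (intro less.hyps) auto
      then show ?thesis using \<open>n0 = 0\<close> k' by (auto intro: good_zero)
    qed
  next
    case False
    show ?thesis
      unfolding good_def
    proof (intro allI impI)
      fix y v
      assume A: "0 \<le> y \<and> 1 \<le> v \<and> sum_list (n0 # n1 # n2 # rows k) \<le> 6 * 0 + 3 * y + v \<or>
        v = 0 \<and> sum_list (n0 # n1 # n2 # rows k) < 6 * 0 + 3 * y"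
      show "win (n0 # n1 # n2 # rows k) 0 y v"
      proof (cases y)
        case 0
        then show ?thesis using A by (intro win_simple) auto
      next
        case (Suc y')
        show ?thesis
        proof (cases "n0 = 1")
          case True
          have "good 0 (0 # (n1 - 2) # n2 # rows k) 0" using less.prems True by (intro less.hyps) auto
          from this[unfolded good_def, rule_format, of y' v] have "win (0 # (n1 - 2) # n2 # rows k) 0 y' v"
            using A Suc True less.prems by auto
          then have "win (1 # ((n1 - 2) + 2) # n2 # rows k) 0 (Suc y') v" by (rule win.double1) simp
          moreover have "(n1 - 2) + 2 = n1" using less.prems True by linarith
          ultimately show ?thesis using Suc True by simp
        next
          case False
          then have n0: "n0 \<ge> 2" using \<open>n0 \<noteq> 0\<close> by linarith
          have "good 0 ((n0 - 2) # (n1 - 1) # n2 # rows k) 0" using less.prems n0 by (intro less.hyps) auto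
          from this[unfolded good_def, rule_format, of y' v] have "win ((n0 - 2) # (n1 - 1) # n2 # rows k) 0 y' v"
            using A Suc n0 less.prems by auto
          then have "win ((n0 - 2 + 2) # (n1 - 1 + 1) # n2 # rows k) 0 (Suc y') v" by (rule win.double) auto
          moreover have "n0 - 2 + 2 = n0" "n1 - 1 + 1 = n1" using less.prems n0 by linarith+
          ultimately show ?thesis using Suc by simp
        qed
      qed
    qed
  qed
qed

text \<open>The inequality \<open>2 * n0 + 8 <= 3 * n1\<close> is exactly stable under subtracting 3
  and 2, and stable under subtracting 2 and 1. When the first row is used up, the third has length
  at most \<open>k\<close>, and the new row of length \<open>k\<close> satisfies
  \<open>2 * k + 8 <= 3 * k\<close> once \<open>8 <= k\<close>; the case \<open>k = 7\<close> is
  left to the finite check. The double points come last, with the weaker constant 5.\<close>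

lemma good_triples:
  assumes "7 \<le> k" "2 * n0 + 8 \<le> 3 * n1" "2 * n1 + 8 \<le> 3 * n2"
    "n0 \<le> k + 3" "n1 \<le> k + 2" "n2 \<le> k + 1" "1 \<le> n0"
  shows "good 2 (n0 # n1 # n2 # rows k) x"
  using assms
proof (induction x arbitrary: n0 n1 n2 k)
  case 0
  then show ?case using good_doubles[of k n0 n1 n2] by (auto simp: good_def)
next
  case (Suc x)
  have next_state: "good 2 (m0 # m1 # m2 # rows k) x"
    if m: "m0 = 0 \<or> 2 * m0 + 8 \<le> 3 * m1" "2 * m1 + 8 \<le> 3 * m2" "1 \<le> m1"
      "m0 \<le> k + 3" "m1 \<le> k + 2" "m2 \<le> k" for m0 m1 m2
  proof (cases "m0 = 0")
    case True
    show ?thesis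
    proof (cases "k = 7")
      case True
      have "good 2 (m1 # m2 # rows 7) x" using m True by (intro state_triples) auto
      then show ?thesis using \<open>m0 = 0\<close> True by (auto intro: good_zero)
    next
      case False
      then obtain k' where k': "k = Suc k'" "7 \<le> k'" using Suc.prems(1) by (cases k) auto
      have "good 2 (m1 # m2 # k # rows k') x"
        using m k' by (intro Suc.IH) auto
      then show ?thesis using \<open>m0 = 0\<close> k' by (auto intro: good_zero)
    qed
  next
    case False
    then show ?thesis using m Suc.prems(1) by (intro Suc.IH) auto
  qed
  have step: "good 2 (n0 # n1 # n2 # rows k) (Suc x)"
    if "m0 + m1 + m2 + 6 = n0 + n1 + n2" "good 2 (m0 # m1 # m2 # rows k) x"
      "\<And>y v. win (m0 # m1 # m2 # rows k) x y v \<Longrightarrow> win (n0 # n1 # n2 # rows k) (Suc x) y v" for m0 m1 m2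
    using that(1,2) unfolding good_def by (intro allI impI that(3)) auto
  consider "n0 = 1" | "n0 = 2" | "n0 \<ge> 3" using Suc.prems by linarith
  then show ?case
  proof cases
    case 1
    have n: "n1 - 3 + 3 = n1" "n2 - 2 + 2 = n2" using Suc.prems 1 by linarith+
    show ?thesis
      using win.triple1[of "n1 - 3" "n2 - 2" "rows k" x _ _ 3 2, unfolded n] Suc.prems 1 n
      by (intro step[of 0 "n1 - 3" "n2 - 2"] next_state) auto
  next
    case 2
    have n: "n1 - 3 + 3 = n1" "n2 - 1 + 1 = n2" using Suc.prems 2 by linarith+
    show ?thesis
      using win.triple2[of "n1 - 3" "n2 - 1" "rows k" x _ _ 3 1, unfolded n] Suc.prems 2 n
      by (intro step[of 0 "n1 - 3" "n2 - 1"] next_state) auto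
  next
    case 3
    have n: "n0 - 3 + 3 = n0" "n1 - 2 + 2 = n1" "n2 - 1 + 1 = n2" using Suc.prems 3 by linarith+
    show ?thesis
      using win.triple[of "n0 - 3" "n1 - 2" "n2 - 1" "rows k" x _ _ 3 2 1, unfolded n] Suc.prems 3 n
      by (intro step[of "n0 - 3" "n1 - 2" "n2 - 1"] next_state) auto
  qed
qed

lemma good_rows:
  assumes "8 \<le> n" shows "good 2 (rows n) x"
proof (cases "n \<le> 11")
  case True
  then have "n = 8 \<or> n = 9 \<or> n = 10 \<or> n = 11" using assms by linarith
  then show ?thesis using rows_check by (auto intro: check_good simp del: rows.simps)
next
  case False
  \<comment> \<open>Of the inequalities for the initial rows,
    \<open>2 * (k + 2) + 8 <= 3 * (k + 1)\<close> is the strictest. It needs \<open>9 <= k\<close>,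
    hence the direct checks up to \<open>n = 11\<close>.\<close>
  define k where "k = n - 3"
  have k: "n = Suc (Suc (Suc k))" "9 \<le> k" using False unfolding k_def by linarith+
  show ?thesis unfolding k(1) rows.simps by (rule good_triples) (use k in auto)
qed

text \<open>For plane sextics two double points are played first, without waste; the 22 cells that
  they leave are checked for all numbers of triple points and of further double points.\<close>

lemma good_rows_7: "2 \<le> y \<Longrightarrow> 1 \<le> v \<and> 28 \<le> 6 * x + 3 * y + v \<or> v = 0 \<and> 28 < 6 * x + 3 * y \<Longrightarrow>
  win (rows 7) x y v"
proof -
  assume y: "2 \<le> y" and A: "1 \<le> v \<and> 28 \<le> 6 * x + 3 * y + v \<or> v = 0 \<and> 28 < 6 * x + 3 * y"
  have "sum_list (dplay (dplay (rows 7))) = 22" by code_simp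
  then have "win (dplay (dplay (rows 7))) x (y - 2) v"
    using check_good[OF rows_7_check, of x, unfolded good_def, rule_format, of "y - 2" v] y A by auto
  then have "win (rows 7) x (Suc (Suc (y - 2))) v" by (intro win_dplay)
  moreover have "Suc (Suc (y - 2)) = y" using y by linarith
  ultimately show ?thesis by simp
qed

section \<open>The method of Horace\<close>

text \<open>Exponents of dehomogenised forms of degree \<open>n - 1\<close>; degree \<open>k\<close>
  thus belongs to \<open>n = Suc k\<close>, and at \<open>n = 0\<close> there are no forms
  left.\<close>

definition tri :: "nat \<Rightarrow> (nat \<times> nat) set" where
  "tri n = {\<beta>. fst \<beta> + snd \<beta> < n}"

definition tet :: "nat \<Rightarrow> (nat \<times> nat \<times> nat) set" where
  "tet n = {\<alpha>. fst \<alpha> + fst (snd \<alpha>) + snd (snd \<alpha>) < n}"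

lemma finite_tri [simp]: "finite (tri n)"
  by (rule finite_subset[of _ "{..<n} \<times> {..<n}"]) (auto simp: tri_def)

lemma finite_tet [simp]: "finite (tet n)"
  by (rule finite_subset[of _ "{..<n} \<times> {..<n} \<times> {..<n}"]) (auto simp: tet_def)

lemma tri_eq_rowset: "tri n = rowset 0 (rows n)"
  by (auto simp: tri_def rowset_rows)

definition vanish3 :: "nat \<Rightarrow> (nat \<times> nat \<times> nat \<Rightarrow> complex) \<Rightarrow> nat \<Rightarrow> complex \<times> complex \<times> complex \<Rightarrow> bool" where
  "vanish3 n F m Q \<longleftrightarrow> (\<forall>r p q. r + p + q < m \<longrightarrow>
     (\<Sum>\<alpha>\<in>tet n. F \<alpha> * (hasse r (fst \<alpha>) (fst Q) *
        (hasse p (fst (snd \<alpha>)) (fst (snd Q)) * hasse q (snd (snd \<alpha>)) (snd (snd Q))))) = 0)"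

definition indep3 :: "nat \<Rightarrow> (nat \<times> (complex \<times> complex \<times> complex)) set \<Rightarrow> bool" where
  "indep3 n K \<longleftrightarrow> (\<forall>F. (\<forall>(m, Q)\<in>K. vanish3 n F m Q) \<longrightarrow> (\<forall>\<alpha>\<in>tet n. F \<alpha> = 0))"

lemma hasse_0: "hasse r e 0 = (if e = r then 1 else 0)"
  by (cases "e < r") (auto simp: hasse_def binomial_eq_0)

text \<open>At first coordinate 0, a Hasse derivative of order \<open>r\<close> reads off the
  coefficient of the \<open>r\<close>-th power, that is, one slice of the tetrahedron.\<close>

lemma sum_tet_plane:
  "(\<Sum>\<alpha>\<in>tet n. F \<alpha> * (hasse r (fst \<alpha>) 0 * g (snd \<alpha>))) = (\<Sum>\<beta>\<in>tri (n - r). F (r, \<beta>) * g \<beta>)"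
proof -
  have "(\<Sum>\<alpha>\<in>tet n. F \<alpha> * (hasse r (fst \<alpha>) 0 * g (snd \<alpha>)))
      = (\<Sum>\<alpha>\<in>Pair r ` tri (n - r). F \<alpha> * (hasse r (fst \<alpha>) 0 * g (snd \<alpha>)))"
  proof (rule sum.mono_neutral_right)
    show "\<forall>\<alpha>\<in>tet n - Pair r ` tri (n - r). F \<alpha> * (hasse r (fst \<alpha>) 0 * g (snd \<alpha>)) = 0"
    proof
      fix \<alpha> assume \<alpha>: "\<alpha> \<in> tet n - Pair r ` tri (n - r)"
      then have "fst \<alpha> \<noteq> r" by (cases \<alpha>) (auto simp: tet_def tri_def image_iff)
      then show "F \<alpha> * (hasse r (fst \<alpha>) 0 * g (snd \<alpha>)) = 0" by (simp add: hasse_0)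
    qed
    show "Pair r ` tri (n - r) \<subseteq> tet n" by (auto simp: tet_def tri_def)
  qed simp
  also have "\<dots> = (\<Sum>\<beta>\<in>tri (n - r). F (r, \<beta>) * g \<beta>)"
    by (subst sum.reindex) (auto simp: inj_on_def hasse_0)
  finally show ?thesis .
qed

text \<open>Slice \<open>r\<close> of a point of multiplicity \<open>m\<close> in the plane has
  multiplicity \<open>m - r\<close>: slice 0 is the plane curve, and the others belong to the
  quotient.\<close>

lemma vanish3_plane:
  assumes "vanish3 n F m (0, P)" "r < m"
  shows "vanish2 (tri (n - r)) (\<lambda>\<beta>. F (r, \<beta>)) (m - r) P"
  unfolding vanish2_def
proof (intro allI impI)
  fix p q assume "p + q < m - r"
  then have "r + p + q < m" by linarith
  from assms(1)[unfolded vanish3_def, rule_format, OF this]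
  have "(\<Sum>\<alpha>\<in>tet n. F \<alpha> * (hasse r (fst \<alpha>) 0 *
        (hasse p (fst (snd \<alpha>)) (fst P) * hasse q (snd (snd \<alpha>)) (snd P)))) = 0" by simp
  then show "(\<Sum>\<beta>\<in>tri (n - r). F (r, \<beta>) * (hasse p (fst \<beta>) (fst P) * hasse q (snd \<beta>) (snd P))) = 0"
    unfolding sum_tet_plane[where g = "\<lambda>\<beta>. hasse p (fst \<beta>) (fst P) * hasse q (snd \<beta>) (snd P)"] .
qed

lemma vanish3_planeI:
  assumes "\<And>r. r < m \<Longrightarrow> vanish2 (tri (n - r)) (\<lambda>\<beta>. F (r, \<beta>)) (m - r) P"
  shows "vanish3 n F m (0, P)"
  unfolding vanish3_def
proof (intro allI impI)
  fix r p q assume "r + p + q < m"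
  then have "r < m" "p + q < m - r" by linarith+
  then have "(\<Sum>\<beta>\<in>tri (n - r). F (r, \<beta>) * (hasse p (fst \<beta>) (fst P) * hasse q (snd \<beta>) (snd P))) = 0"
    using assms[OF \<open>r < m\<close>] by (simp add: vanish2_def)
  then show "(\<Sum>\<alpha>\<in>tet n. F \<alpha> * (hasse r (fst \<alpha>) (fst (0, P)) *
        (hasse p (fst (snd \<alpha>)) (fst (snd (0, P))) * hasse q (snd (snd \<alpha>)) (snd (snd (0, P)))))) = 0"
    using sum_tet_plane[where g = "\<lambda>\<beta>. hasse p (fst \<beta>) (fst P) * hasse q (snd \<beta>) (snd P)"] by simp
qed

lemma sum_tet_Suc:
  "(\<Sum>\<alpha>\<in>tet (Suc n). h \<alpha>) = (\<Sum>\<beta>\<in>tri (Suc n). h (0, \<beta>)) + (\<Sum>\<alpha>\<in>tet n. h (Suc (fst \<alpha>), snd \<alpha>))"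
proof -
  have "\<alpha> \<in> Pair 0 ` tri (Suc n) \<union> (\<lambda>\<alpha>. (Suc (fst \<alpha>), snd \<alpha>)) ` tet n" if "\<alpha> \<in> tet (Suc n)" for \<alpha>
    using that by (cases \<alpha>; cases "fst \<alpha>") (auto simp: tet_def tri_def image_iff)
  then have eq: "tet (Suc n) = Pair 0 ` tri (Suc n) \<union> (\<lambda>\<alpha>. (Suc (fst \<alpha>), snd \<alpha>)) ` tet n"
    by (auto simp: tet_def tri_def)
  have "inj_on (\<lambda>\<alpha>. (Suc (fst \<alpha>), snd \<alpha>)) (tet n)" "inj_on (Pair (0 :: nat)) (tri (Suc n))"
    by (auto simp: inj_on_def)
  then show ?thesis
    unfolding eq by (subst sum.union_disjoint) (auto simp: sum.reindex)
qed

lemma hasse_Suc: "hasse r (Suc e) z = z * hasse r e z + (if r = 0 then 0 else hasse (r - 1) e z)"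
proof (cases r)
  case (Suc r')
  consider "e < r'" | "e = r'" | "r' < e" by linarith
  then show ?thesis
  proof cases
    case 3
    then obtain k where "e = r' + Suc k" by (metis add_Suc_right less_imp_Suc_add)
    then show ?thesis using Suc by (simp add: hasse_def algebra_simps)
  qed (use Suc in \<open>auto simp: hasse_def binomial_eq_0\<close>)
qed (simp add: hasse_def)

text \<open>The form is the first coordinate times the quotient. By the Leibniz rule
  \<open>hasse_Suc\<close> the derivatives of the quotient satisfy a recursion in \<open>r\<close>
  with the nonzero leading factor \<open>fst Q\<close>.\<close>

lemma vanish3_off_plane:
  assumes F: "vanish3 (Suc n) F m Q" and z: "fst Q \<noteq> 0" and F0: "\<And>\<beta>. \<beta> \<in> tri (Suc n) \<Longrightarrow> F (0, \<beta>) = 0"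
  shows "vanish3 n (\<lambda>\<alpha>. F (Suc (fst \<alpha>), snd \<alpha>)) m Q"
proof -
  define X where "X r p q = (\<Sum>\<alpha>\<in>tet n. F (Suc (fst \<alpha>), snd \<alpha>) * (hasse r (fst \<alpha>) (fst Q) *
        (hasse p (fst (snd \<alpha>)) (fst (snd Q)) * hasse q (snd (snd \<alpha>)) (snd (snd Q)))))" for r p q
  have rec: "fst Q * X r p q + (if r = 0 then 0 else X (r - 1) p q) = 0" if "r + p + q < m" for r p q
  proof -
    have "0 = (\<Sum>\<alpha>\<in>tet n. F (Suc (fst \<alpha>), snd \<alpha>) * (hasse r (Suc (fst \<alpha>)) (fst Q) *
        (hasse p (fst (snd \<alpha>)) (fst (snd Q)) * hasse q (snd (snd \<alpha>)) (snd (snd Q)))))"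
      using F[unfolded vanish3_def, rule_format, OF that] by (simp add: sum_tet_Suc F0)
    also have "\<dots> = fst Q * X r p q + (if r = 0 then 0 else X (r - 1) p q)"
      unfolding X_def hasse_Suc by (simp add: sum_distrib_left algebra_simps flip: sum.distrib)
    finally show ?thesis by simp
  qed
  have "X r p q = 0" if "r + p + q < m" for r p q
    using that
  proof (induction r)
    case (Suc r)
    then show ?case using rec[of "Suc r" p q] z by simp
  qed (use rec[of 0 p q] z in simp)
  then show ?thesis by (simp add: vanish3_def X_def)
qed

text \<open>Kinds 0 to 3 are triple, double, double in the plane, simple in the plane.\<close>

definition conds3 :: "nat \<Rightarrow> nat \<Rightarrow> nat \<Rightarrow> nat \<Rightarrow> (nat \<times> nat) set" where
  "conds3 a b u v = {0} \<times> {..<a} \<union> {1} \<times> {..<b} \<union> {2} \<times> {..<u} \<union> {3} \<times> {..<v}"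

text \<open>A configuration assigns a number to (kind of point, number of the point, number of the coordinate).
  Points of kind 0 and 1 are arbitrary, the others lie in the plane where the first coordinate is 0.\<close>

definition point3 :: "(nat \<times> nat \<times> nat \<Rightarrow> complex) \<Rightarrow> nat \<times> nat \<Rightarrow> nat \<times> complex \<times> complex \<times> complex" where
  "point3 P \<kappa> = (if fst \<kappa> = 0 then 3 else if fst \<kappa> = 3 then 1 else 2,
     if fst \<kappa> \<le> 1 then P (fst \<kappa>, snd \<kappa>, 0) else 0, P (fst \<kappa>, snd \<kappa>, 1), P (fst \<kappa>, snd \<kappa>, 2))"

definition spatial :: "nat \<Rightarrow> nat \<Rightarrow> nat \<Rightarrow> nat \<Rightarrow> nat \<Rightarrow> (nat \<times> nat \<times> nat \<Rightarrow> complex) set" where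
  "spatial n a b u v = {P. indep3 n (point3 P ` conds3 a b u v)}"

text \<open>Kinds 2, 3, 4 have multiplicities 3, 2, 1 on the plane curve. They are numbered so that
  kinds 2 and 3 of the same \<open>P\<close> become, through \<open>point3\<close>, the double and
  simple points of the quotient.\<close>

definition point2 :: "(nat \<times> nat \<times> nat \<Rightarrow> complex) \<Rightarrow> nat \<times> nat \<Rightarrow> nat \<times> complex \<times> complex" where
  "point2 P \<kappa> = (5 - fst \<kappa>, P (fst \<kappa>, snd \<kappa>, 1), P (fst \<kappa>, snd \<kappa>, 2))"

definition plane_conf :: "nat \<Rightarrow> nat \<Rightarrow> nat \<Rightarrow> nat \<Rightarrow> (nat \<times> nat \<times> nat \<Rightarrow> complex) set" where
  "plane_conf n x y v = {P. indep2 (tri n) (point2 P ` ({2} \<times> {..<x} \<union> {3} \<times> {..<y} \<union> {4} \<times> {..<v}))}"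

lemma polyfun_hasse [intro]: "polyfun f \<Longrightarrow> polyfun (\<lambda>t. hasse r e (f t))"
  unfolding hasse_def by (intro polyfun_mult polyfun_const polyfun_power)

lemma polyfun_if: "polyfun f \<Longrightarrow> polyfun g \<Longrightarrow> polyfun (\<lambda>t. if c then f t else g t)"
  by (cases c) simp_all

lemma line_open_spatial: "line_open (spatial n a b u v)"
proof -
  define mlt :: "nat \<times> nat \<Rightarrow> nat" where "mlt \<kappa> = (if fst \<kappa> = 0 then 3 else if fst \<kappa> = 3 then 1 else 2)" for \<kappa>
  define R where "R = {(\<kappa>, r, p, q). \<kappa> \<in> conds3 a b u v \<and> r + p + q < mlt \<kappa>}"
  define A where "A = (\<lambda>(\<kappa>, r, p, q) \<alpha> P. hasse r (fst \<alpha>) (fst (snd (point3 P \<kappa>))) *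
        (hasse p (fst (snd \<alpha>)) (fst (snd (snd (point3 P \<kappa>)))) * hasse q (snd (snd \<alpha>)) (snd (snd (snd (point3 P \<kappa>))))))"
  have ballR: "(\<forall>\<rho>\<in>R. \<phi> \<rho>) \<longleftrightarrow> (\<forall>\<kappa>\<in>conds3 a b u v. \<forall>r p q. r + p + q < mlt \<kappa> \<longrightarrow> \<phi> (\<kappa>, r, p, q))" for \<phi>
    unfolding R_def by blast
  have fst: "fst (point3 P \<kappa>) = mlt \<kappa>" for P \<kappa> by (simp add: point3_def mlt_def)
  have "(\<forall>(m, Q)\<in>point3 P ` conds3 a b u v. vanish3 n F m Q) \<longleftrightarrow> (\<forall>\<rho>\<in>R. (\<Sum>\<alpha>\<in>tet n. F \<alpha> * A \<rho> \<alpha> P) = 0)" for F P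
    by (simp add: ballR A_def case_prod_beta fst vanish3_def)
  then have "spatial n a b u v = {P. \<forall>F. (\<forall>\<rho>\<in>R. (\<Sum>\<alpha>\<in>tet n. F \<alpha> * A \<rho> \<alpha> P) = 0) \<longrightarrow> (\<forall>\<alpha>\<in>tet n. F \<alpha> = 0)}"
    by (simp only: spatial_def indep3_def)
  also have "line_open \<dots>"
  proof (rule line_open_injective)
    show "polyfun (\<lambda>t. A \<rho> \<alpha> (along P Q t))" for \<rho> \<alpha> P Q
      unfolding A_def case_prod_beta point3_def fst_conv snd_conv
      by (intro polyfun_mult polyfun_hasse polyfun_if polyfun_along polyfun_const)
  qed simp
  finally show ?thesis .
qed

lemma line_open_plane_conf: "line_open (plane_conf n x y v)"
proof -
  let ?I = "{2} \<times> {..<x} \<union> {3} \<times> {..<y} \<union> {4 :: nat} \<times> {..<v}"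
  define R where "R = {(\<kappa>, p, q). \<kappa> \<in> ?I \<and> p + q < 5 - fst \<kappa>}"
  define A where "A = (\<lambda>(\<kappa>, p, q) \<alpha> P. hasse p (fst \<alpha>) (fst (snd (point2 P \<kappa>))) *
     hasse q (snd \<alpha>) (snd (snd (point2 P \<kappa>))))"
  have ballR: "(\<forall>\<rho>\<in>R. \<phi> \<rho>) \<longleftrightarrow> (\<forall>\<kappa>\<in>?I. \<forall>p q. p + q < 5 - fst \<kappa> \<longrightarrow> \<phi> (\<kappa>, p, q))" for \<phi>
    unfolding R_def by blast
  have fst: "fst (point2 P \<kappa>) = 5 - fst \<kappa>" for P \<kappa> by (simp add: point2_def)
  have "(\<forall>(m, Q)\<in>point2 P ` ?I. vanish2 (tri n) F m Q) \<longleftrightarrow> (\<forall>\<rho>\<in>R. (\<Sum>\<alpha>\<in>tri n. F \<alpha> * A \<rho> \<alpha> P) = 0)" for F P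
    by (simp add: ballR A_def case_prod_beta fst vanish2_def del: ball_Un)
  then have "plane_conf n x y v = {P. \<forall>F. (\<forall>\<rho>\<in>R. (\<Sum>\<alpha>\<in>tri n. F \<alpha> * A \<rho> \<alpha> P) = 0) \<longrightarrow> (\<forall>\<alpha>\<in>tri n. F \<alpha> = 0)}"
    by (simp only: plane_conf_def indep2_def)
  also have "line_open \<dots>"
  proof (rule line_open_injective)
    show "polyfun (\<lambda>t. A \<rho> \<alpha> (along P Q t))" for \<rho> \<alpha> P Q
      unfolding A_def case_prod_beta point2_def fst_conv snd_conv
      by (intro polyfun_mult polyfun_hasse polyfun_along)
  qed simp
  finally show ?thesis .
qed

lemma indep2D: "indep2 D K \<Longrightarrow> (\<And>m P. (m, P) \<in> K \<Longrightarrow> vanish2 D c m P) \<Longrightarrow> \<alpha> \<in> D \<Longrightarrow> c \<alpha> = 0"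
  unfolding indep2_def by fastforce

lemma indep3D: "indep3 n K \<Longrightarrow> (\<And>m Q. (m, Q) \<in> K \<Longrightarrow> vanish3 n F m Q) \<Longrightarrow> \<alpha> \<in> tet n \<Longrightarrow> F \<alpha> = 0"
  unfolding indep3_def by fastforce

lemma indep2_mono:
  assumes "indep2 D K" "K \<subseteq> K'" shows "indep2 D K'"
  unfolding indep2_def
proof (intro allI impI ballI)
  fix c \<alpha> assume c: "\<forall>(m, P)\<in>K'. vanish2 D c m P" and "\<alpha> \<in> D"
  show "c \<alpha> = 0"
  proof (rule indep2D[OF assms(1) _ \<open>\<alpha> \<in> D\<close>])
    fix m P assume "(m, P) \<in> K"
    from bspec[OF c subsetD[OF assms(2) this]] show "vanish2 D c m P" by simp
  qed
qed

lemma planar_plane_conf: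
  assumes "planar (tri n) x y v" shows "plane_conf n x y v \<noteq> {}"
proof -
  obtain T U V where TUV: "length T = x" "length U = y" "length V = v"
    "indep2 (tri n) (Pair 3 ` set T \<union> Pair 2 ` set U \<union> Pair 1 ` set V)"
    using assms by (auto simp: planar_def)
  define P :: "nat \<times> nat \<times> nat \<Rightarrow> complex" where "P = (\<lambda>(t, i, c). (if c = 1 then fst else snd)
    (if t = 2 then T ! i else if t = 3 then U ! i else V ! i))"
  have pts: "(3, T ! i) = point2 P (2, i)" "(2, U ! i) = point2 P (3, i)" "(1, V ! i) = point2 P (4, i)" for i
    by (simp_all add: point2_def P_def)
  have "Pair 3 ` set T \<union> Pair 2 ` set U \<union> Pair 1 ` set V
      \<subseteq> point2 P ` ({2} \<times> {..<x} \<union> {3} \<times> {..<y} \<union> {4} \<times> {..<v})"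
  proof (intro Un_least image_subsetI)
    fix p assume "p \<in> set T"
    then obtain i where "i < x" "p = T ! i" using TUV(1-3) by (auto simp: in_set_conv_nth)
    then show "(3, p) \<in> point2 P ` ({2} \<times> {..<x} \<union> {3} \<times> {..<y} \<union> {4} \<times> {..<v})"
      by (simp only: pts) (rule imageI, simp)
  next
    fix p assume "p \<in> set U"
    then obtain i where "i < y" "p = U ! i" using TUV(1-3) by (auto simp: in_set_conv_nth)
    then show "(2, p) \<in> point2 P ` ({2} \<times> {..<x} \<union> {3} \<times> {..<y} \<union> {4} \<times> {..<v})"
      by (simp only: pts) (rule imageI, simp)
  next
    fix p assume "p \<in> set V"
    then obtain i where "i < v" "p = V ! i" using TUV(1-3) by (auto simp: in_set_conv_nth)
    then show "(1, p) \<in> point2 P ` ({2} \<times> {..<x} \<union> {3} \<times> {..<y} \<union> {4} \<times> {..<v})"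
      by (simp only: pts) (rule imageI, simp)
  qed
  then have "P \<in> plane_conf n x y v"
    using indep2_mono[OF TUV(4)] by (simp only: plane_conf_def mem_Collect_eq)
  then show ?thesis by blast
qed

text \<open>Both hypotheses give nonempty sets that are cofinite on lines, so a single
  \<open>P\<close> serves for the plane curve and for the quotient, with its free points off the
  plane.\<close>

lemma horace:
  assumes plane: "planar (tri (Suc n)) x (y + u) v" and space: "spatial n a b x (y + u) \<noteq> {}"
  shows "spatial (Suc n) (a + x) (b + y) u v \<noteq> {}"
proof -
  define N where "N = (\<lambda>\<kappa>. {P :: nat \<times> nat \<times> nat \<Rightarrow> complex. P (fst \<kappa>, snd \<kappa>, 0) \<noteq> 0})"
  let ?I = "{0} \<times> {..<a} \<union> {1} \<times> {..<b}"
  have N: "line_open (\<Inter>\<kappa>\<in>?I. N \<kappa>) \<and> (\<Inter>\<kappa>\<in>?I. N \<kappa>) \<noteq> {}"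
  proof (rule line_open_INT)
    show "N \<kappa> \<noteq> {}" for \<kappa> unfolding N_def by (rule ex_in_conv[THEN iffD1], rule exI[of _ "\<lambda>_. 1"]) simp
  qed (auto simp: N_def line_open_neq0)
  have SP: "spatial n a b x (y + u) \<inter> plane_conf (Suc n) x (y + u) v \<noteq> {}"
    by (rule line_open_Int_nonempty[OF line_open_spatial line_open_plane_conf space planar_plane_conf[OF plane]])
  have "spatial n a b x (y + u) \<inter> plane_conf (Suc n) x (y + u) v \<inter> (\<Inter>\<kappa>\<in>?I. N \<kappa>) \<noteq> {}"
    by (rule line_open_Int_nonempty[OF line_open_Int[OF line_open_spatial line_open_plane_conf]
        conjunct1[OF N] SP conjunct2[OF N]])
  then obtain P where P0: "P \<in> spatial n a b x (y + u) \<inter> plane_conf (Suc n) x (y + u) v \<inter> (\<Inter>\<kappa>\<in>?I. N \<kappa>)"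
    by (meson ex_in_conv)
  have P: "P \<in> spatial n a b x (y + u)" "P \<in> plane_conf (Suc n) x (y + u) v"
    "\<And>\<kappa>. \<kappa> \<in> ?I \<Longrightarrow> P \<in> N \<kappa>"
    using P0[THEN IntD1, THEN IntD1] P0[THEN IntD1, THEN IntD2] INT_D[OF P0[THEN IntD2]] by simp_all
  \<comment> \<open>The last \<open>x\<close> triple and \<open>y\<close> double points move into
    the plane, to the places of kind 2 and the first \<open>y\<close> places of kind 3 of
    \<open>P\<close>. The other \<open>u\<close> places of kind 3 and those of kind 4 hold the
    points that were already in the plane.\<close>
  define Q :: "nat \<times> nat \<times> nat \<Rightarrow> complex" where "Q = (\<lambda>(t, i, c).
     if t = 0 then if i < a then P (0, i, c) else if c = 0 then 0 else P (2, i - a, c)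
     else if t = 1 then if i < b then P (1, i, c) else if c = 0 then 0 else P (3, i - b, c)
     else if t = 2 then P (3, y + i, c) else P (4, i, c))"
  have "Q \<in> spatial (Suc n) (a + x) (b + y) u v"
    unfolding spatial_def indep3_def
  proof (intro CollectI allI impI)
    fix F assume F: "\<forall>(m, R)\<in>point3 Q ` conds3 (a + x) (b + y) u v. vanish3 (Suc n) F m R"
    have on: "vanish3 (Suc n) F (5 - t) (0, P (t, i, 1), P (t, i, 2))"
      if "(t, i) \<in> {2} \<times> {..<x} \<union> {3} \<times> {..<y + u} \<union> {4} \<times> {..<v}" for t i
    proof -
      have "(5 - t, 0, P (t, i, 1), P (t, i, 2)) \<in> point3 Q ` conds3 (a + x) (b + y) u v"
      proof (cases "t = 2")
        case True
        then have "(5 - t, 0, P (t, i, 1), P (t, i, 2)) = point3 Q (0, a + i)" "(0, a + i) \<in> conds3 (a + x) (b + y) u v"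
          using that by (auto simp: point3_def Q_def conds3_def)
        then show ?thesis by blast
      next
        case t2: False
        show ?thesis
        proof (cases "t = 3")
          case True
          show ?thesis
          proof (cases "i < y")
            case i: True
            then have "(5 - t, 0, P (t, i, 1), P (t, i, 2)) = point3 Q (1, b + i)" "(1, b + i) \<in> conds3 (a + x) (b + y) u v"
              using that True by (auto simp: point3_def Q_def conds3_def)
            then show ?thesis by blast
          next
            case i: False
            then have "(5 - t, 0, P (t, i, 1), P (t, i, 2)) = point3 Q (2, i - y)" "(2, i - y) \<in> conds3 (a + x) (b + y) u v"
              using that True by (auto simp: point3_def Q_def conds3_def)
            then show ?thesis by blast
          qed
        next
          case False
          then have "(5 - t, 0, P (t, i, 1), P (t, i, 2)) = point3 Q (3, i)" "(3, i) \<in> conds3 (a + x) (b + y) u v"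
            using that t2 by (auto simp: point3_def Q_def conds3_def)
          then show ?thesis by blast
        qed
      qed
      from bspec[OF F this] show ?thesis by simp
    qed
    have "vanish2 (tri (Suc n)) (\<lambda>\<beta>. F (0, \<beta>)) m R"
      if "(m, R) \<in> point2 P ` ({2} \<times> {..<x} \<union> {3} \<times> {..<y + u} \<union> {4} \<times> {..<v})" for m R
    proof -
      from that obtain \<kappa> where \<kappa>: "\<kappa> \<in> {2} \<times> {..<x} \<union> {3} \<times> {..<y + u} \<union> {4} \<times> {..<v}" "(m, R) = point2 P \<kappa>"
        by (rule imageE)
      obtain t i where "\<kappa> = (t, i)" by (cases \<kappa>)
      note ti = \<kappa>[unfolded this]
      have "vanish2 (tri (Suc n - 0)) (\<lambda>\<beta>. F (0, \<beta>)) (5 - t - 0) (P (t, i, 1), P (t, i, 2))"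
        by (rule vanish3_plane[OF on[OF ti(1)]]) (use ti(1) in auto)
      then show ?thesis using ti(2) by (simp add: point2_def)
    qed
    with P(2) have F0: "F (0, \<beta>) = 0" if "\<beta> \<in> tri (Suc n)" for \<beta>
      unfolding plane_conf_def mem_Collect_eq using that by (rule indep2D)
    \<comment> \<open>The restriction to the plane is zero, so the form is the first coordinate
      times \<open>G\<close>. The division lowers multiplicities in the plane by one and keeps the
      others.\<close>
    define G where "G \<alpha> = F (Suc (fst \<alpha>), snd \<alpha>)" for \<alpha>
    have on': "vanish3 n G (5 - Suc t) (0, P (t, i, 1), P (t, i, 2))"
      if "(t, i) \<in> {2} \<times> {..<x} \<union> {3} \<times> {..<y + u} \<union> {4} \<times> {..<v}" for t i
    proof (rule vanish3_planeI)
      fix r assume "r < 5 - Suc t"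
      then have "vanish2 (tri (Suc n - Suc r)) (\<lambda>\<beta>. F (Suc r, \<beta>)) (5 - t - Suc r) (P (t, i, 1), P (t, i, 2))"
        by (intro vanish3_plane[OF on[OF that]]) auto
      then show "vanish2 (tri (n - r)) (\<lambda>\<beta>. G (r, \<beta>)) (5 - Suc t - r) (P (t, i, 1), P (t, i, 2))"
        by (simp add: G_def)
    qed
    have off: "vanish3 n G (fst (point3 P \<kappa>)) (snd (point3 P \<kappa>))" if "\<kappa> \<in> ?I" for \<kappa>
    proof -
      have "point3 P \<kappa> = point3 Q \<kappa>" "\<kappa> \<in> conds3 (a + x) (b + y) u v"
        using that by (auto simp: point3_def Q_def conds3_def)
      moreover have "fst (snd (point3 P \<kappa>)) \<noteq> 0"
        using P(3)[OF that] that by (auto simp: point3_def N_def)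
      ultimately show ?thesis
        using bspec[OF F imageI[of \<kappa> _ "point3 Q"]] F0 unfolding G_def
        by (intro vanish3_off_plane) (simp_all add: case_prod_beta)
    qed
    have "vanish3 n G m R" if "(m, R) \<in> point3 P ` conds3 a b x (y + u)" for m R
    proof -
      from that obtain \<kappa> where \<kappa>: "\<kappa> \<in> conds3 a b x (y + u)" "(m, R) = point3 P \<kappa>" by (rule imageE)
      obtain t i where "\<kappa> = (t, i)" by (cases \<kappa>)
      note ti = \<kappa>[unfolded this]
      show ?thesis
      proof (cases "t \<le> 1")
        case True
        then have "(t, i) \<in> ?I" using ti(1) by (auto simp: conds3_def)
        from off[OF this] show ?thesis unfolding ti(2)[symmetric] by simp
      next
        case False
        then have "(t, i) \<in> {2} \<times> {..<x} \<union> {3} \<times> {..<y + u} \<union> {4} \<times> {..<v}" using ti by (auto simp: conds3_def)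
        from on'[OF this] have "vanish3 n G (5 - Suc t) (0, P (t, i, 1), P (t, i, 2))" .
        moreover have "point3 P (t, i) = (5 - Suc t, 0, P (t, i, 1), P (t, i, 2))"
          using False ti(1) by (auto simp: point3_def conds3_def)
        ultimately show ?thesis using ti(2) by simp
      qed
    qed
    with P(1) have G0: "G \<alpha> = 0" if "\<alpha> \<in> tet n" for \<alpha>
      unfolding spatial_def mem_Collect_eq using that by (rule indep3D)
    show "\<forall>\<alpha>\<in>tet (Suc n). F \<alpha> = 0"
    proof
      fix \<alpha> assume \<alpha>: "\<alpha> \<in> tet (Suc n)"
      obtain l \<beta> where l: "\<alpha> = (l, \<beta>)" by (cases \<alpha>)
      show "F \<alpha> = 0"
      proof (cases l)
        case 0
        then show ?thesis using \<alpha> F0[of \<beta>] l by (simp add: tet_def tri_def)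
      next
        case (Suc l')
        then show ?thesis using \<alpha> G0[of "(l', \<beta>)"] l by (simp add: tet_def G_def)
      qed
    qed
  qed
  then show ?thesis by blast
qed

section \<open>Counting\<close>

definition solvable :: "nat \<Rightarrow> nat \<Rightarrow> nat \<Rightarrow> nat \<Rightarrow> nat \<Rightarrow> bool" where
  "solvable n a b u v \<longleftrightarrow> spatial n a b u v \<noteq> {}"

lemma solvable_0: "solvable 0 a b u v"
  by (auto simp: solvable_def spatial_def indep3_def tet_def)

lemma solvable_Suc:
  assumes "x \<le> a" "y \<le> b" "win (rows (Suc n)) x (y + u) v" "solvable n (a - x) (b - y) x (y + u)"
  shows "solvable (Suc n) a b u v"
  using horace[of n x y u v "a - x" "b - y"] win_planar[OF assms(3), of 0] assms
  by (simp add: solvable_def tri_eq_rowset)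

lemma indep3_mono:
  assumes "indep3 n K" "K \<subseteq> K'" shows "indep3 n K'"
  unfolding indep3_def
proof (intro allI impI ballI)
  fix F \<alpha> assume F: "\<forall>(m, P)\<in>K'. vanish3 n F m P" and "\<alpha> \<in> tet n"
  show "F \<alpha> = 0"
  proof (rule indep3D[OF assms(1) _ \<open>\<alpha> \<in> tet n\<close>])
    fix m P assume "(m, P) \<in> K"
    from bspec[OF F subsetD[OF assms(2) this]] show "vanish3 n F m P" by simp
  qed
qed

lemma solvable_mono:
  assumes "solvable n a b u v" "a \<le> a'" "b \<le> b'" shows "solvable n a' b' u v"
proof -
  have "conds3 a b u v \<subseteq> conds3 a' b' u v" using assms by (auto simp: conds3_def)
  then have "spatial n a b u v \<subseteq> spatial n a' b' u v"
    unfolding spatial_def by (auto elim!: indep3_mono)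
  then show ?thesis using assms(1) by (auto simp: solvable_def)
qed

section \<open>Small degrees by search\<close>

text \<open>Numbers of triple and double points near the greedy choice; \<open>c x\<close> is the
  number of double points, rounded up, that fills what \<open>x\<close> triple points leave.\<close>

definition candidates :: "nat \<Rightarrow> nat \<Rightarrow> nat \<Rightarrow> nat \<Rightarrow> (nat \<times> nat) list" where
  "candidates s a u v = (let x0 = min a ((s - 3 * u - v) div 6); c = (\<lambda>x. (s - 6 * x - 3 * u - v + 2) div 3) in
     [(x0, c x0), (x0, c x0 + 1), (x0 + 1, c (x0 + 1)), (x0 + 1, c (x0 + 1) + 1), (x0 + 2, c (x0 + 2)), (x0 + 2, c (x0 + 2) + 1)])"

fun solve :: "nat \<Rightarrow> nat \<Rightarrow> nat \<Rightarrow> nat \<Rightarrow> nat \<Rightarrow> bool" where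
  "solve 0 a b u v = True"
| "solve (Suc n) a b u v =
     (case find (\<lambda>(x, y). x \<le> a \<and> y \<le> b \<and> remain (rows (Suc n)) x (y + u) \<le> v)
        (candidates (sum_list (rows (Suc n))) a u v) of
      None \<Rightarrow> False | Some (x, y) \<Rightarrow> solve n (a - x) (b - y) x (y + u))"

lemma solve_solvable: "solve n a b u v \<Longrightarrow> solvable n a b u v"
proof (induction n arbitrary: a b u v)
  case (Suc n)
  then obtain x y where xy: "find (\<lambda>(x, y). x \<le> a \<and> y \<le> b \<and> remain (rows (Suc n)) x (y + u) \<le> v)
      (candidates (sum_list (rows (Suc n))) a u v) = Some (x, y)" "solve n (a - x) (b - y) x (y + u)"
    by (auto simp del: rows.simps split: option.splits)
  then have "x \<le> a" "y \<le> b" "remain (rows (Suc n)) x (y + u) \<le> v"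
    by (auto simp: find_Some_iff simp del: rows.simps)
  then show ?case using xy(2) Suc.IH by (intro solvable_Suc[of x a y b]) (auto intro: remain_win simp del: rows.simps)
qed (rule solvable_0)

text \<open>The least \<open>b\<close> with
  \<open>64 + 3 * (1 - b) <= 10 * a + 4 * b + 4 * u + v\<close>. The number 67 occurs twice for
  different reasons: as the bound for \<open>b = 0\<close>, and as 64 plus 3 for rounding the
  quotient by 4 up.\<close>

definition need :: "nat \<Rightarrow> nat \<Rightarrow> nat \<Rightarrow> nat" where
  "need a u v = (if 67 \<le> 10 * a + 4 * u + v then 0 else max 1 ((67 - 10 * a - 4 * u - v) div 4))"

lemma solve_quintics:
  "list_all (\<lambda>u. list_all (\<lambda>v. list_all (\<lambda>a. solve 6 a (need a u v) u v)
     (if u = 0 then [0] else [0..<8])) [2..<16 - 3 * u]) [0..<6]"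
  by code_simp

text \<open>For each number of triple points the least number of double points that the hypothesis
  allows, in degrees 4, 5 and 6; all other pairs follow by monotonicity.\<close>

lemma solve_small:
  "list_all (\<lambda>(a, b). solve 5 a b 0 0) [(0, 11), (1, 9), (2, 6), (3, 4), (4, 1), (5, 0)]"
  "list_all (\<lambda>(a, b). solve 6 a b 0 0) [(0, 17), (1, 14), (2, 12), (3, 9), (4, 7), (5, 4), (6, 2), (7, 0)]"
  "list_all (\<lambda>(a, b). solve 7 a b 0 0) [(0, 24), (1, 22), (2, 19), (3, 17), (4, 14), (5, 12), (6, 9), (7, 7),
     (8, 4), (9, 2), (10, 1), (11, 0)]"
  by code_simp+

lemma solvable_quintics:
  assumes "a = 0 \<or> 1 \<le> u" "2 \<le> v" "3 * u + v \<le> 15" "64 + 3 * (1 - b) \<le> 10 * a + 4 * b + 4 * u + v"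
  shows "solvable 6 a b u v"
proof -
  \<comment> \<open>Seven triple points have 70 conditions, more than 67, and need no double
    point.\<close>
  define a' where "a' = min a 7"
  have "u < 6" "2 \<le> v" "v < 16 - 3 * u" "a' < 8" using assms by (auto simp: a'_def)
  then have mem: "u \<in> set [0..<6]" "v \<in> set [2..<16 - 3 * u]" "a' \<in> set [0..<8]"
    by (simp_all only: set_upt atLeastLessThan_iff zero_le)
  have "a' \<in> set (if u = 0 then [0] else [0..<8])"
    using mem(3) assms(1) by (cases "u = 0") (simp_all add: a'_def del: upt.simps upt_rec_numeral)
  from solve_quintics[unfolded list_all_iff, THEN bspec, OF mem(1), THEN bspec, OF mem(2), THEN bspec, OF this]
  have "solve 6 a' (need a' u v) u v" .
  moreover have "need a' u v \<le> b"
    using assms unfolding need_def a'_def by (auto simp: min_def max_def)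
  ultimately show ?thesis by (intro solvable_mono[OF solve_solvable]) (auto simp: a'_def)
qed

section \<open>Arithmetic of the descent\<close>

definition cells :: "nat \<Rightarrow> nat" where "cells d = sum_list (rows (Suc d))"

lemma cells_Suc: "cells (Suc d) = cells d + d + 2"
  by (simp add: cells_def)

lemma cells_numerals: "cells 5 = 21" "cells 6 = 28" "cells 7 = 36" "cells 8 = 45" "cells 9 = 55"
  by (simp_all add: cells_def numeral_eq_Suc)

lemma cells_choose: "cells d = (d + 2) choose 2"
  by (induction d) (simp_all add: cells_def numeral_eq_Suc)

lemma choose_Suc: "(Suc d + 3) choose 3 = ((d + 3) choose 3) + cells (Suc d)"
  unfolding cells_choose by (simp add: numeral_eq_Suc)

lemma cells_bound: "5 \<le> d \<Longrightarrow> 4 * d + 1 \<le> cells d"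
  by (induction d rule: dec_induct) (simp_all add: cells_Suc cells_numerals)

lemma cells_bound': "9 \<le> d \<Longrightarrow> 2 * d + 37 \<le> cells d"
  by (induction d rule: dec_induct) (simp_all add: cells_Suc cells_numerals)

text \<open>The quotient of the binomial by \<open>cells d\<close> is \<open>(d + 3) / 3\<close>.
  The resulting 8/3 is played off against 5/3, the largest ratio of spatial to planar conditions of
  a point.\<close>

lemma choose_bound: "5 \<le> d \<Longrightarrow> 8 * cells d \<le> 3 * ((d + 3) choose 3)"
proof (induction d rule: dec_induct)
  case base
  show ?case by (simp add: cells_numerals) (simp add: numeral_eq_Suc)
next
  case (step d)
  show ?case using step cells_bound[OF step.hyps(1)] unfolding choose_Suc cells_Suc distrib_left by linarith
qed

text \<open>One step of the method: use triple points as long as they fit, then fill up by a double point,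
  or by a triple point if that wastes less. The term \<open>d - b - 4\<close> is \<open>\<gamma>\<close>.\<close>

lemma step_numbers:
  fixes a b u v d T R C N :: nat
  assumes T: "T = 3 * u + v + R" "N \<le> T" "T \<le> N + 1" "6 \<le> R"
    and bounds: "8 * N \<le> 3 * C" "4 * d + 1 \<le> N" "5 \<le> d"
    and count: "C + 2 * d + 3 * (d - b - 4) \<le> 10 * a + 4 * b + 4 * u + v + 2"
  shows "\<exists>x y E. x \<le> a \<and> y \<le> b \<and> 6 * x + 3 * y + 3 * u + v = T + E \<and>
    E + 3 * (d - 1 - (b - y) - 4) \<le> 2 + 3 * (d - b - 4) \<and>
    (E \<le> 2 \<or> E \<le> 5 \<and> b = 0) \<and> (R div 6 \<le> x \<or> a = x \<and> 2 \<le> y)"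
proof -
  define m r where "m = R div 6" and "r = R mod 6"
  have R: "R = 6 * m + r" "r < 6" unfolding m_def r_def by simp_all
  show ?thesis
  proof (cases "m \<le> a")
    case ma: True
    \<comment> \<open>After \<open>m\<close> triple points \<open>r\<close> conditions are open. One
      double point wastes \<open>3 - r\<close>, one triple point \<open>6 - r\<close>, and so do two
      double points when no triple point is left. Only for \<open>b = 0\<close> can the waste exceed
      2; there \<open>d - b - 4\<close> drops by 1, which pays for the other 3.\<close>
    consider "r = 0" | "1 \<le> r" "r \<le> 3" "1 \<le> b" | "1 \<le> r" "b = 0" | "4 \<le> r" "1 \<le> b" "m < a" | "4 \<le> r" "1 \<le> b" "a = m"
      using ma by linarith
    then show ?thesis
    proof cases
      case 1
      then show ?thesis using ma R T by (intro exI[of _ m] exI[of _ 0]) (auto simp: m_def[symmetric])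
    next
      case 2
      then show ?thesis using ma R T bounds
        by (intro exI[of _ m] exI[of _ 1] exI[of _ "3 - r"]) (auto simp: m_def[symmetric])
    next
      case 3
      have "m < a"
      proof (rule ccontr)
        assume "\<not> m < a"
        then have "a = m" using ma by linarith
        then show False using 3 R T bounds count by linarith
      qed
      then show ?thesis using ma R T bounds 3
        by (intro exI[of _ "m + 1"] exI[of _ 0] exI[of _ "6 - r"]) (auto simp: m_def[symmetric])
    next
      case 4
      then show ?thesis using ma R T bounds
        by (intro exI[of _ "m + 1"] exI[of _ 0] exI[of _ "6 - r"]) (auto simp: m_def[symmetric])
    next
      case 5
      \<comment> \<open>Spending two double points in one degree could raise
        \<open>\<gamma>\<close>. But all triple points are in the plane now, so by the comparison of
        5/3 with 8/3 many double points are left, and the new \<open>\<gamma>\<close> is 0.\<close>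
      then have "d \<le> b + 3" using R T bounds count by linarith
      then show ?thesis using ma R T bounds 5
        by (intro exI[of _ m] exI[of _ 2] exI[of _ "6 - r"]) (auto simp: m_def[symmetric])
    qed
  next
    case False
    define s y where "s = R - 6 * a" and "y = (s + 2) div 3"
    have s: "R = 6 * a + s" "6 \<le> s" using False R unfolding s_def by linarith+
    have y: "3 * y \<le> s + 2" "s \<le> 3 * y" "2 \<le> y" unfolding y_def using s by linarith+
    \<comment> \<open>The same comparison shows that even after \<open>y\<close> double points the
      new \<open>\<gamma>\<close> is 0.\<close>
    have "d + y \<le> b + 5" "y \<le> b" using s y T bounds count by linarith+
    then show ?thesis using s y T bounds
      by (intro exI[of _ a] exI[of _ y] exI[of _ "3 * y - s"]) auto
  qed
qed

text \<open>The lower bounds on \<open>u\<close> and \<open>v\<close> provide the simple point, and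
  together with the chosen \<open>y\<close> the two double points, that make exact counts win. The
  upper bounds on \<open>3 * u + v\<close> leave room for two new triple points, or for one when
  \<open>d\<close> is 5 or 6, which renews the bound on \<open>u\<close>. The final 2 in the count
  was saved for the surplus of the two steps before.\<close>

lemma solvable_third:
  assumes "5 \<le> d" "a = 0 \<or> (if d = 5 then 1 else 2) \<le> u" "2 \<le> v"
    and "if d = 5 then 3 * u + v \<le> 15 else if d = 6 then 3 * u + v \<le> 22 else 3 * u + v + 12 \<le> cells d"
    and "((d + 3) choose 3) + 2 * d + 3 * (d - b - 4) \<le> 10 * a + 4 * b + 4 * u + v + 2"
  shows "solvable (Suc d) a b u v"
  using assms
proof (induction d arbitrary: a b u v rule: dec_induct)
  case base
  have "(5 + 3) choose 3 = (56 :: nat)" by (simp add: numeral_eq_Suc)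
  moreover have "5 - b - 4 = 1 - b" by simp
  ultimately have "solvable 6 a b u v" using base by (intro solvable_quintics) auto
  then show ?case by simp
next
  case (step d)
  define e where "e = Suc d"
  define R where "R = cells e - 3 * u - v"
  have e6: "6 \<le> e" using step.hyps by (simp add: e_def)
  have mon: "cells e = cells d + d + 2" by (simp add: e_def cells_Suc)
  have small: "e = 6 \<Longrightarrow> cells e = 28" "e = 7 \<Longrightarrow> cells e = 36" "e = 8 \<Longrightarrow> cells e = 45"
    by (simp_all add: cells_numerals)
  have R: "cells e = 3 * u + v + R" "6 \<le> R" "e \<noteq> 6 \<Longrightarrow> 12 \<le> R"
    using step.prems(3) e6 small(1) unfolding R_def by (auto simp: e_def[symmetric] simp del: rows.simps split: if_splits)
  have "5 \<le> e" using e6 by simp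
  have "\<exists>x y E. x \<le> a \<and> y \<le> b \<and> 6 * x + 3 * y + 3 * u + v = cells e + E \<and>
    E + 3 * (e - 1 - (b - y) - 4) \<le> 2 + 3 * (e - b - 4) \<and>
    (E \<le> 2 \<or> E \<le> 5 \<and> b = 0) \<and> (R div 6 \<le> x \<or> a = x \<and> 2 \<le> y)"
    by (rule step_numbers[OF R(1) order.refl _ R(2) choose_bound[OF \<open>5 \<le> e\<close>] cells_bound[OF \<open>5 \<le> e\<close>]
      \<open>5 \<le> e\<close> step.prems(4)[folded e_def]]) simp
  then obtain x y E where xy: "x \<le> a" "y \<le> b" "6 * x + 3 * y + 3 * u + v = cells e + E"
    "E + 3 * (e - 1 - (b - y) - 4) \<le> 2 + 3 * (e - b - 4)"
    "E \<le> 2 \<or> E \<le> 5 \<and> b = 0" "R div 6 \<le> x \<or> a = x \<and> 2 \<le> y"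
    by blast
  have div: "1 \<le> R div 6" "e \<noteq> 6 \<Longrightarrow> 2 \<le> R div 6" using R by linarith+
  have yu: "2 \<le> y + u"
    using step.prems(1) e6 xy div by (auto simp: e_def[symmetric] split: if_splits)
  have win: "win (rows (Suc e)) x (y + u) v"
  proof (cases "e = 6")
    case True
    then have "win (rows 7) x (y + u) v"
      using yu xy(3) step.prems(2) small(1) by (intro good_rows_7) auto
    then show ?thesis using True by (simp add: numeral_eq_Suc)
  next
    case False
    then have "good 2 (rows (Suc e)) x" using e6 by (intro good_rows) simp
    then show ?thesis using yu xy(3) step.prems(2) unfolding good_def by (simp add: cells_def del: rows.simps)
  qed
  have "solvable (Suc d) (a - x) (b - y) x (y + u)"
  proof (rule step.IH)
    show "a - x = 0 \<or> (if d = 5 then 1 else 2) \<le> x"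
      using xy(6) div by (auto simp: e_def)
    show "2 \<le> y + u" by (rule yu)
    show "if d = 5 then 3 * x + (y + u) \<le> 15 else if d = 6 then 3 * x + (y + u) \<le> 22
      else 3 * x + (y + u) + 12 \<le> cells d"
    proof -
      have "E \<le> 5" using xy(5) by linarith
      \<comment> \<open>The waste of at most 5 is reduced by 4 because \<open>2 <= y + u\<close> and
        \<open>2 <= v\<close>. The left side is twice the number \<open>3 * x + (y + u)\<close> to
        be bounded.\<close>
      then have *: "6 * x + 2 * y + 2 * u \<le> cells e + 1" using xy(3) yu step.prems(2) by linarith
      consider "d = 5" | "d = 6" | "d = 7" | "8 \<le> d" using step.hyps by linarith
      then show ?thesis
      proof cases
        case 4
        then have "2 * e + 37 \<le> cells e" by (intro cells_bound') (simp add: e_def)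
        then show ?thesis using * mon 4 by (simp add: e_def del: rows.simps)
      qed (use * mon small in \<open>auto simp: e_def simp del: rows.simps\<close>)
    qed
    show "((d + 3) choose 3) + 2 * d + 3 * (d - (b - y) - 4)
        \<le> 10 * (a - x) + 4 * (b - y) + 4 * x + (y + u) + 2"
    proof -
      have "(e + 3) choose 3 = ((d + 3) choose 3) + cells e" unfolding e_def by (rule choose_Suc)
      moreover have "e - 1 = d" by (simp add: e_def)
      moreover obtain a' b' where "a = x + a'" "b = y + b'" using xy(1,2) by (auto simp: le_iff_add)
      ultimately show ?thesis using step.prems(4)[folded e_def] xy by (simp add: e_def distrib_left)
    qed
  qed
  then show ?case
    using solvable_Suc[OF xy(1,2) win] by (simp add: e_def)
qed

text \<open>The second step; here \<open>v\<close> may be \<open>0\<close>, so the plane gets one condition more than needed.\<close>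

lemma solvable_second:
  assumes d: "6 \<le> d" and u: "a = 0 \<or> 3 \<le> u"
    and side: "if d = 6 then 3 * u + v \<le> 22 else 3 * u + v + 12 \<le> cells d"
    and count: "((d + 3) choose 3) + 2 * d + 3 * (d - b - 4) \<le> 10 * a + 4 * b + 4 * u + v + 1"
  shows "solvable (Suc d) a b u v"
proof -
  define R where "R = cells d + 1 - 3 * u - v"
  have "5 \<le> d" using d by simp
  have R: "cells d + 1 = 3 * u + v + R" "6 \<le> R" "d \<noteq> 6 \<Longrightarrow> 12 \<le> R"
    using side d unfolding R_def by (auto simp: cells_numerals split: if_splits)
  have "\<exists>x y E. x \<le> a \<and> y \<le> b \<and> 6 * x + 3 * y + 3 * u + v = cells d + 1 + E \<and>
    E + 3 * (d - 1 - (b - y) - 4) \<le> 2 + 3 * (d - b - 4) \<and>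
    (E \<le> 2 \<or> E \<le> 5 \<and> b = 0) \<and> (R div 6 \<le> x \<or> a = x \<and> 2 \<le> y)"
    by (rule step_numbers[OF R(1) _ order.refl R(2) choose_bound[OF \<open>5 \<le> d\<close>] cells_bound[OF \<open>5 \<le> d\<close>]
      \<open>5 \<le> d\<close>]) (use count in auto)
  then obtain x y E where xy: "x \<le> a" "y \<le> b" "6 * x + 3 * y + 3 * u + v = cells d + 1 + E"
    "E + 3 * (d - 1 - (b - y) - 4) \<le> 2 + 3 * (d - b - 4)"
    "E \<le> 2 \<or> E \<le> 5 \<and> b = 0" "R div 6 \<le> x \<or> a = x \<and> 2 \<le> y"
    by blast
  have div: "1 \<le> R div 6" "d \<noteq> 6 \<Longrightarrow> 2 \<le> R div 6" using R by linarith+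
  have yu: "2 \<le> y + u" using u xy div by auto
  have win: "win (rows (Suc d)) x (y + u) v"
  proof (cases "d = 6")
    case True
    then have "win (rows 7) x (y + u) v"
      using yu xy(3) by (intro good_rows_7) (auto simp: cells_numerals)
    then show ?thesis using True by (simp add: numeral_eq_Suc)
  next
    case False
    then have "good 2 (rows (Suc d)) x" using d by (intro good_rows) simp
    from this[unfolded good_def, rule_format, of "y + u" v] show ?thesis
      using yu xy(3) by (cases v) (auto simp: cells_def simp del: rows.simps)
  qed
  obtain e where e: "d = Suc e" using d by (cases d) auto
  have side': "6 * x + 2 * y + 2 * u \<le> cells d + 4" "d \<le> 8 \<Longrightarrow> 6 * x + 2 * y + 2 * u \<le> cells d + 3"
    using xy(1,2,3,5,6) yu u div by auto
  have "solvable (Suc e) (a - x) (b - y) x (y + u)"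
  proof (rule solvable_third)
    show "5 \<le> e" using d e by simp
    show "a - x = 0 \<or> (if e = 5 then 1 else 2) \<le> x" using xy(6) div e by auto
    show "2 \<le> y + u" by (rule yu)
    show "if e = 5 then 3 * x + (y + u) \<le> 15 else if e = 6 then 3 * x + (y + u) \<le> 22
      else 3 * x + (y + u) + 12 \<le> cells e"
    proof -
      consider "d = 6" | "d = 7" | "d = 8" | "9 \<le> d" using d by linarith
      then show ?thesis
      proof cases
        case 4
        then show ?thesis using side'(1) cells_bound'[OF 4] cells_Suc[of e] unfolding e[symmetric] by (auto simp: e)
      qed (use side' cells_numerals cells_Suc[of e] e in auto)
    qed
    show "((e + 3) choose 3) + 2 * e + 3 * (e - (b - y) - 4)
        \<le> 10 * (a - x) + 4 * (b - y) + 4 * x + (y + u) + 2"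
    proof -
      have "(d + 3) choose 3 = ((e + 3) choose 3) + cells d" unfolding e by (rule choose_Suc)
      moreover have "d - 1 = e" by (simp add: e)
      moreover obtain a' b' where "a = x + a'" "b = y + b'" using xy(1,2) by (auto simp: le_iff_add)
      ultimately show ?thesis using count xy e by (simp add: distrib_left)
    qed
  qed
  then show ?thesis using solvable_Suc[OF xy(1,2) win] by (simp add: e)
qed

text \<open>No point lies in the plane yet, so one surplus condition is put there. It costs the 1
  that \<open>solvable_second\<close> has as slack; likewise that lemma passes slack 2 to
  \<open>solvable_third\<close>.\<close>

lemma solvable_first:
  assumes d: "7 \<le> d" and count: "((d + 3) choose 3) + 2 * d + 3 * (d - b - 4) \<le> 10 * a + 4 * b"
  shows "solvable (Suc d) a b 0 0"
proof -
  define R where "R = cells d + 1"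
  have "5 \<le> d" using d by simp
  have R: "cells d + 1 = 3 * 0 + 0 + R" "29 \<le> R"
    using cells_bound[OF \<open>5 \<le> d\<close>] d unfolding R_def by simp_all
  have "\<exists>x y E. x \<le> a \<and> y \<le> b \<and> 6 * x + 3 * y + 3 * 0 + 0 = cells d + 1 + E \<and>
    E + 3 * (d - 1 - (b - y) - 4) \<le> 2 + 3 * (d - b - 4) \<and>
    (E \<le> 2 \<or> E \<le> 5 \<and> b = 0) \<and> (R div 6 \<le> x \<or> a = x \<and> 2 \<le> y)"
    by (rule step_numbers[OF R(1) _ order.refl _ choose_bound[OF \<open>5 \<le> d\<close>] cells_bound[OF \<open>5 \<le> d\<close>]
      \<open>5 \<le> d\<close>]) (use count R in auto)
  then obtain x y E where xy: "x \<le> a" "y \<le> b" "6 * x + 3 * y + 3 * 0 + 0 = cells d + 1 + E"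
    "E + 3 * (d - 1 - (b - y) - 4) \<le> 2 + 3 * (d - b - 4)"
    "E \<le> 2 \<or> E \<le> 5 \<and> b = 0" "R div 6 \<le> x \<or> a = x \<and> 2 \<le> y"
    by blast
  have div: "4 \<le> R div 6" using R by linarith
  have "good 2 (rows (Suc d)) x" using d by (intro good_rows) simp
  then have win: "win (rows (Suc d)) x (y + 0) 0"
    using xy(3) unfolding good_def by (simp add: cells_def del: rows.simps)
  obtain e where e: "d = Suc e" using d by (cases d) auto
  have side': "6 * x + 2 * y \<le> cells d + 6" using xy(3,5) by auto
  have "solvable (Suc e) (a - x) (b - y) x (y + 0)"
  proof (rule solvable_second)
    show "6 \<le> e" using d e by simp
    show "a - x = 0 \<or> 3 \<le> x" using xy(6) div by auto
    show "if e = 6 then 3 * x + (y + 0) \<le> 22 else 3 * x + (y + 0) + 12 \<le> cells e"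
    proof -
      consider "d = 7" | "d = 8" | "9 \<le> d" using d by linarith
      then show ?thesis
      proof cases
        case 2
        \<comment> \<open>The generic bound would only give 25. Divisibility of
          \<open>46 + E\<close> by 3 leaves \<open>E = 2\<close> or \<open>E = 5\<close>, and the
          latter would mean \<open>y = 0\<close> and \<open>6 * x = 51\<close>.\<close>
        then have "3 * x + y \<le> 24" using xy(2,3,5) cells_numerals by auto
        then show ?thesis using 2 cells_numerals e by auto
      next
        case 3
        then show ?thesis using side' cells_bound'[OF 3] cells_Suc[of e] unfolding e[symmetric] by (auto simp: e)
      qed (use side' cells_numerals e in auto)
    qed
    show "((e + 3) choose 3) + 2 * e + 3 * (e - (b - y) - 4)
        \<le> 10 * (a - x) + 4 * (b - y) + 4 * x + (y + 0) + 1"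
    proof -
      have "(d + 3) choose 3 = ((e + 3) choose 3) + cells d" unfolding e by (rule choose_Suc)
      moreover have "d - 1 = e" by (simp add: e)
      moreover obtain a' b' where "a = x + a'" "b = y + b'" using xy(1,2) by (auto simp: le_iff_add)
      ultimately show ?thesis using count xy e by (simp add: distrib_left)
    qed
  qed
  then show ?thesis using solvable_Suc[OF xy(1,2) win] by (simp add: e)
qed

theorem solvable_main:
  assumes k: "4 \<le> k" and count: "((k + 3) choose 3) + 2 * k + 3 * (k - b - 4) \<le> 10 * a + 4 * b"
  shows "solvable (Suc k) a b 0 0"
proof -
  have reduce: "solvable n a b 0 0"
    if "list_all (\<lambda>(a, b). solve n a b 0 0) L" "\<exists>(a', b')\<in>set L. a' \<le> a \<and> b' \<le> b" for n L
    using that solvable_mono[OF solve_solvable] unfolding list_all_iff by fast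
  consider "k = 4" | "k = 5" | "k = 6" | "7 \<le> k" using k by linarith
  then show ?thesis
  proof cases
    case 1
    have "(4 + 3) choose 3 = (35 :: nat)" by (simp add: numeral_eq_Suc)
    with 1 count have c: "43 \<le> 10 * a + 4 * b" by simp
    have "solvable 5 a b 0 0"
    proof (rule reduce[OF solve_small(1)])
      have "a = 0 \<or> a = 1 \<or> a = 2 \<or> a = 3 \<or> a = 4 \<or> 5 \<le> a" by linarith
      then show "\<exists>(a', b')\<in>set [(0, 11), (1, 9), (2, 6), (3, 4), (4, 1), (5, 0)]. a' \<le> a \<and> b' \<le> b"
        using c by (elim disjE; cases b) simp_all
    qed
    then show ?thesis using 1 by simp
  next
    case 2
    have "(5 + 3) choose 3 = (56 :: nat)" by (simp add: numeral_eq_Suc)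
    with 2 count have c: "66 + 3 * (1 - b) \<le> 10 * a + 4 * b" by simp
    have "solvable 6 a b 0 0"
    proof (rule reduce[OF solve_small(2)])
      have "a = 0 \<or> a = 1 \<or> a = 2 \<or> a = 3 \<or> a = 4 \<or> a = 5 \<or> a = 6 \<or> 7 \<le> a" by linarith
      then show "\<exists>(a', b')\<in>set [(0, 17), (1, 14), (2, 12), (3, 9), (4, 7), (5, 4), (6, 2), (7, 0)]. a' \<le> a \<and> b' \<le> b"
        using c by (elim disjE; cases b) simp_all
    qed
    then show ?thesis using 2 by simp
  next
    case 3
    have "(6 + 3) choose 3 = (84 :: nat)" by (simp add: numeral_eq_Suc)
    with 3 count have c: "96 + 3 * (2 - b) \<le> 10 * a + 4 * b" by simp
    have "solvable 7 a b 0 0"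
    proof (rule reduce[OF solve_small(3)])
      have "a = 0 \<or> a = 1 \<or> a = 2 \<or> a = 3 \<or> a = 4 \<or> a = 5 \<or> a = 6 \<or> a = 7 \<or> a = 8 \<or> a = 9
          \<or> a = 10 \<or> 11 \<le> a" by presburger
      then show "\<exists>(a', b')\<in>set [(0, 24), (1, 22), (2, 19), (3, 17), (4, 14), (5, 12), (6, 9), (7, 7),
          (8, 4), (9, 2), (10, 1), (11, 0)]. a' \<le> a \<and> b' \<le> b"
        using c by (elim disjE; cases b) simp_all
    qed
    then show ?thesis using 3 by simp
  next
    case 4
    then show ?thesis using count by (rule solvable_first)
  qed
qed

section \<open>Evaluation of polynomials\<close>

definition mono_val :: "('v \<Rightarrow> 'a::comm_ring_1) \<Rightarrow> ('v \<Rightarrow>\<^sub>0 nat) \<Rightarrow> 'a" where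
  "mono_val x m = (\<Prod>j\<in>Poly_Mapping.keys m. x j ^ Poly_Mapping.lookup m j)"

text \<open>The coefficient map \<open>h\<close> allows one set of rules for complex values and for
  restrictions to a line, whose values are polynomials in one variable.\<close>

definition subst :: "(complex \<Rightarrow> 'a::comm_ring_1) \<Rightarrow> ('v \<Rightarrow> 'a) \<Rightarrow> 'v cpoly \<Rightarrow> 'a" where
  "subst h x f = (\<Sum>m\<in>Poly_Mapping.keys f. h (Poly_Mapping.lookup f m) * mono_val x m)"

definition ring_map :: "(complex \<Rightarrow> 'a::comm_ring_1) \<Rightarrow> bool" where
  "ring_map h \<longleftrightarrow> h 0 = 0 \<and> h 1 = 1 \<and> (\<forall>a b. h (a + b) = h a + h b) \<and> (\<forall>a b. h (a * b) = h a * h b)"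

lemma poly_eval_subst: "poly_eval f x = subst (\<lambda>c. c) x f"
  by (simp add: poly_eval_def subst_def mono_val_def)

lemma ring_map_id: "ring_map (\<lambda>c. c)"
  by (simp add: ring_map_def)

lemma ring_map_const: "ring_map (\<lambda>c. [:c:])"
  by (simp add: ring_map_def one_pCons)

lemma mono_val_superset:
  assumes "finite S" "Poly_Mapping.keys m \<subseteq> S"
  shows "mono_val x m = (\<Prod>j\<in>S. x j ^ Poly_Mapping.lookup m j)"
  unfolding mono_val_def
  by (rule prod.mono_neutral_left[OF assms]) (auto simp: in_keys_iff)

lemma mono_val_add: "mono_val x (m + m') = mono_val x m * mono_val x m'"
proof -
  let ?S = "Poly_Mapping.keys m \<union> Poly_Mapping.keys m'"
  have "finite ?S" by simp
  moreover have "Poly_Mapping.keys (m + m') \<subseteq> ?S" by (rule keys_add)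
  ultimately show ?thesis
    by (simp add: mono_val_superset[of ?S] lookup_add power_add prod.distrib)
qed

lemma subst_superset:
  assumes "ring_map h" "finite S" "Poly_Mapping.keys f \<subseteq> S"
  shows "subst h x f = (\<Sum>m\<in>S. h (Poly_Mapping.lookup f m) * mono_val x m)"
  unfolding subst_def
  by (rule sum.mono_neutral_left[OF assms(2,3)]) (use assms(1) in \<open>auto simp: in_keys_iff ring_map_def\<close>)

lemma subst_add:
  assumes "ring_map h" shows "subst h x (f + g) = subst h x f + subst h x g"
proof -
  let ?S = "Poly_Mapping.keys f \<union> Poly_Mapping.keys g"
  have "finite ?S" by simp
  moreover have "Poly_Mapping.keys (f + g) \<subseteq> ?S" by (rule keys_add)
  moreover have "h (a + b) = h a + h b" for a b using assms by (simp add: ring_map_def)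
  ultimately show ?thesis
    by (simp add: subst_superset[OF assms, of ?S] lookup_add distrib_right sum.distrib)
qed

lemma subst_single:
  assumes "ring_map h" shows "subst h x (Poly_Mapping.single m c) = h c * mono_val x m"
  using assms by (simp add: subst_def ring_map_def)

lemma subst_0 [simp]: "subst h x 0 = 0"
  by (simp add: subst_def)

lemma cpoly_induct [case_names zero single]:
  assumes "P 0" and "\<And>f m c. P f \<Longrightarrow> P (Poly_Mapping.single m c + f)"
  shows "P (f :: 'v cpoly)"
proof (induction f rule: Poly_Mapping.update_induct)
  case (update f a b)
  have "Poly_Mapping.update a b f = Poly_Mapping.single a b + f"
    using update.hyps(1)
    by (intro poly_mapping_eqI) (auto simp: lookup_update lookup_add lookup_single when_def in_keys_iff)
  then show ?case using assms(2)[OF update.IH] by simp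
qed (rule assms(1))

lemma subst_mult:
  assumes "ring_map h" shows "subst h x (f * g) = subst h x f * subst h x g"
proof (induction f rule: cpoly_induct)
  case (single f m c)
  have "subst h x (Poly_Mapping.single m c * g) = h c * mono_val x m * subst h x g"
  proof (induction g rule: cpoly_induct)
    case (single g m' c')
    have "h (c * c') = h c * h c'" using assms by (simp add: ring_map_def)
    then show ?case
      using single by (simp add: distrib_left subst_add[OF assms] mult_single subst_single[OF assms] mono_val_add mult_ac)
  qed simp
  then show ?case
    using single by (simp add: distrib_right subst_add[OF assms] subst_single[OF assms])
qed simp

lemma subst_minus:
  assumes "ring_map h" shows "subst h x (- f) = - subst h x f"
  using subst_add[OF assms, of x f "- f"] by (simp add: eq_neg_iff_add_eq_0 add.commute)

lemma subst_diff:
  assumes "ring_map h" shows "subst h x (f - g) = subst h x f - subst h x g"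
  using subst_add[OF assms, of x f "- g"] by (simp add: subst_minus[OF assms])

lemma subst_one:
  assumes "ring_map h" shows "subst h x 1 = 1"
  using subst_single[OF assms, of x 0 1] assms by (simp add: mono_val_def ring_map_def)

lemmas poly_eval_mult = subst_mult[OF ring_map_id, folded poly_eval_subst]
lemmas poly_eval_diff = subst_diff[OF ring_map_id, folded poly_eval_subst]

section \<open>Multihomogeneous functions\<close>

definition multihom :: "nat \<Rightarrow> (nat \<Rightarrow> nat) \<Rightarrow> ((nat \<Rightarrow> complex ^ 4) \<Rightarrow> complex) \<Rightarrow> bool" where
  "multihom n \<delta> f \<longleftrightarrow> (\<exists>g :: (nat \<times> 4) cpoly.
     (\<forall>m\<in>Poly_Mapping.keys g. Poly_Mapping.keys m \<subseteq> {..<n} \<times> UNIV \<and>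
        (\<forall>i<n. (\<Sum>j\<in>UNIV. Poly_Mapping.lookup m (i, j)) = \<delta> i)) \<and>
     (\<forall>v. f v = poly_eval g (\<lambda>(i, j). v i $ j)))"

lemma multihom_const: "multihom n (\<lambda>_. 0) (\<lambda>_. c)"
  unfolding multihom_def
  by (rule exI[of _ "Poly_Mapping.single 0 c"])
     (simp add: poly_eval_subst subst_single[OF ring_map_id] mono_val_def)

lemma multihom_0: "multihom n \<delta> (\<lambda>_. 0)"
  unfolding multihom_def by (rule exI[of _ 0]) (simp add: poly_eval_def)

lemma multihom_mult:
  assumes "multihom n a f" "multihom n b g" shows "multihom n (\<lambda>i. a i + b i) (\<lambda>v. f v * g v)"
proof -
  obtain p where p: "\<And>m. m \<in> Poly_Mapping.keys p \<Longrightarrow> Poly_Mapping.keys m \<subseteq> {..<n} \<times> UNIV"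
    "\<And>m i. m \<in> Poly_Mapping.keys p \<Longrightarrow> i < n \<Longrightarrow> (\<Sum>j\<in>UNIV. Poly_Mapping.lookup m (i, j)) = a i"
    "\<And>v. f v = poly_eval p (\<lambda>(i, j). v i $ j)" using assms(1) unfolding multihom_def by blast
  obtain q where q: "\<And>m. m \<in> Poly_Mapping.keys q \<Longrightarrow> Poly_Mapping.keys m \<subseteq> {..<n} \<times> UNIV"
    "\<And>m i. m \<in> Poly_Mapping.keys q \<Longrightarrow> i < n \<Longrightarrow> (\<Sum>j\<in>UNIV. Poly_Mapping.lookup m (i, j)) = b i"
    "\<And>v. g v = poly_eval q (\<lambda>(i, j). v i $ j)" using assms(2) unfolding multihom_def by blast
  show ?thesis
    unfolding multihom_def
  proof (rule exI[of _ "p * q"], intro conjI ballI allI impI)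
    fix m assume "m \<in> Poly_Mapping.keys (p * q)"
    then obtain m1 m2 where m: "m = m1 + m2" "m1 \<in> Poly_Mapping.keys p" "m2 \<in> Poly_Mapping.keys q"
      using keys_mult[of p q] by blast
    show "Poly_Mapping.keys m \<subseteq> {..<n} \<times> UNIV"
      using keys_add[of m1 m2] p(1)[OF m(2)] q(1)[OF m(3)] m(1) by blast
    show "(\<Sum>j\<in>UNIV. Poly_Mapping.lookup m (i, j)) = a i + b i" if "i < n" for i
      using p(2)[OF m(2) that] q(2)[OF m(3) that] by (simp add: m(1) lookup_add sum.distrib)
  qed (simp add: p(3) q(3) poly_eval_mult)
qed

lemma multihom_diff:
  assumes "multihom n a f" "multihom n a g" shows "multihom n a (\<lambda>v. f v - g v)"
proof -
  obtain p where p: "\<forall>m\<in>Poly_Mapping.keys p. Poly_Mapping.keys m \<subseteq> {..<n} \<times> UNIV \<and>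
        (\<forall>i<n. (\<Sum>j\<in>UNIV. Poly_Mapping.lookup m (i, j)) = a i)"
    "\<And>v. f v = poly_eval p (\<lambda>(i, j). v i $ j)" using assms(1) unfolding multihom_def by blast
  obtain q where q: "\<forall>m\<in>Poly_Mapping.keys q. Poly_Mapping.keys m \<subseteq> {..<n} \<times> UNIV \<and>
        (\<forall>i<n. (\<Sum>j\<in>UNIV. Poly_Mapping.lookup m (i, j)) = a i)"
    "\<And>v. g v = poly_eval q (\<lambda>(i, j). v i $ j)" using assms(2) unfolding multihom_def by blast
  show ?thesis
    unfolding multihom_def
  proof (rule exI[of _ "p - q"], intro conjI ballI)
    fix m assume "m \<in> Poly_Mapping.keys (p - q)"
    then have "m \<in> Poly_Mapping.keys p \<or> m \<in> Poly_Mapping.keys q" using keys_diff[of p q] by blast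
    then show "Poly_Mapping.keys m \<subseteq> {..<n} \<times> UNIV" "\<forall>i<n. (\<Sum>j\<in>UNIV. Poly_Mapping.lookup m (i, j)) = a i"
      using p(1) q(1) by blast+
  qed (simp add: p(2) q(2) poly_eval_diff)
qed

lemma multihom_coord:
  assumes "i < n" shows "multihom n (\<lambda>i'. if i' = i then 1 else 0) (\<lambda>v. v i $ j)"
  unfolding multihom_def
proof (rule exI[of _ "Poly_Mapping.single (Poly_Mapping.single (i, j) 1) 1"], intro conjI ballI allI impI)
  fix m :: "nat \<times> 4 \<Rightarrow>\<^sub>0 nat"
  assume "m \<in> Poly_Mapping.keys (Poly_Mapping.single (Poly_Mapping.single (i, j) 1) (1 :: complex))"
  then have m: "m = Poly_Mapping.single (i, j) 1" by simp
  show "Poly_Mapping.keys m \<subseteq> {..<n} \<times> UNIV" using assms by (simp add: m)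
  show "(\<Sum>j\<in>UNIV. Poly_Mapping.lookup m (i', j)) = (if i' = i then 1 else 0)" for i'
    by (auto simp: m lookup_single when_def)
next
  fix v :: "nat \<Rightarrow> complex ^ 4"
  show "v i $ j = poly_eval (Poly_Mapping.single (Poly_Mapping.single (i, j) 1) 1) (\<lambda>(i, j). v i $ j)"
    by (simp add: poly_eval_subst subst_single[OF ring_map_id] mono_val_def)
qed

lemma multihom_power:
  assumes "multihom n a f" shows "multihom n (\<lambda>i. e * a i) (\<lambda>v. f v ^ e)"
proof (induction e)
  case (Suc e)
  from multihom_mult[OF assms this] show ?case by simp
qed (simp add: multihom_const)

text \<open>The degree at the point \<open>i\<close> is the same for all monomials, as
  \<open>elimination\<close> demands of a row. Entries with too small an exponent are zero and have
  every degree.\<close>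

lemma multihom_monomial:
  assumes i: "i < n"
    and k: "l + p + q \<le> k"
  shows "multihom n (\<lambda>i'. if i' = i then k - (r + s + t) else 0)
    (\<lambda>v. hasse r l (v i $ 1) * (hasse s p (v i $ 2) * (hasse t q (v i $ 3) * (v i $ 4) ^ (k - l - p - q))))"
proof (cases "r \<le> l \<and> s \<le> p \<and> t \<le> q")
  case False
  then have "(\<lambda>v :: nat \<Rightarrow> complex ^ 4. hasse r l (v i $ 1) * (hasse s p (v i $ 2) *
      (hasse t q (v i $ 3) * (v i $ 4) ^ (k - l - p - q)))) = (\<lambda>_. 0)" by (auto simp: hasse_def fun_eq_iff binomial_eq_0)
  then show ?thesis by (simp only: multihom_0)
next
  case True
  have h: "multihom n (\<lambda>i'. (e - r) * (if i' = i then 1 else 0)) (\<lambda>v. hasse r e (v i $ j))" for e r j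
    using multihom_mult[OF multihom_const multihom_power[OF multihom_coord[OF i, of j]]]
    by (simp add: hasse_def)
  have "multihom n (\<lambda>i'. (l - r) * (if i' = i then 1 else 0) + ((p - s) * (if i' = i then 1 else 0) +
      ((q - t) * (if i' = i then 1 else 0) + (k - l - p - q) * (if i' = i then 1 else 0))))
    (\<lambda>v. hasse r l (v i $ 1) * (hasse s p (v i $ 2) * (hasse t q (v i $ 3) * (v i $ 4) ^ (k - l - p - q))))"
    by (intro multihom_mult h multihom_power multihom_coord i)
  also have "(\<lambda>i'. (l - r) * (if i' = i then 1 else 0) + ((p - s) * (if i' = i then 1 else 0) +
      ((q - t) * (if i' = i then 1 else 0) + (k - l - p - q) * (if i' = i then 1 else 0))))
    = (\<lambda>i'. if i' = i then k - (r + s + t) else 0)"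
    using True k by (auto simp: fun_eq_iff)
  finally show ?thesis .
qed

definition row :: "nat \<Rightarrow> nat \<times> nat \<times> nat \<times> nat \<Rightarrow> nat \<times> nat \<times> nat \<Rightarrow> (nat \<Rightarrow> complex ^ 4) \<Rightarrow> complex" where
  "row k = (\<lambda>(i, r, s, t) (l, p, q) v.
     hasse r l (v i $ 1) * (hasse s p (v i $ 2) * (hasse t q (v i $ 3) * (v i $ 4) ^ (k - l - p - q))))"

text \<open>The affine configuration found by the descent makes the evaluation matrix injective;
  \<open>g\<close> plays the role of a maximal minor that detects this.\<close>

lemma minor:
  assumes "solvable (Suc k) a b 0 0"
  shows "\<exists>\<delta> g v0. multihom (a + b) \<delta> g \<and> g v0 \<noteq> 0 \<and> (\<forall>i. v0 i \<noteq> 0) \<and> (\<forall>v. g v \<noteq> 0 \<longrightarrow>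
    (\<forall>c. (\<forall>i r s t. i < a + b \<longrightarrow> r + s + t < (if i < a then 3 else 2) \<longrightarrow>
        (\<Sum>\<alpha>\<in>tet (Suc k). c \<alpha> * row k (i, r, s, t) \<alpha> v) = 0) \<longrightarrow> (\<forall>\<alpha>\<in>tet (Suc k). c \<alpha> = 0)))"
proof -
  obtain P where P: "indep3 (Suc k) (point3 P ` conds3 a b 0 0)"
    using assms by (auto simp: solvable_def spatial_def)
  define R where "R = {(i, r, s, t). i < a + b \<and> r + s + t < (if i < a then 3 else 2 :: nat)}"
  define Q where "Q i = (if i < a then (0, i) else (1 :: nat, i - a))" for i
  \<comment> \<open>The affine configuration sits in the chart where the fourth coordinate is
    1.\<close>
  define v0 :: "nat \<Rightarrow> complex ^ 4" where "v0 i = (\<chi> j. if j = 1 then P (fst (Q i), snd (Q i), 0)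
     else if j = 2 then P (fst (Q i), snd (Q i), 1) else if j = 3 then P (fst (Q i), snd (Q i), 2) else 1)" for i
  have coords: "v0 i $ 1 = P (fst (Q i), snd (Q i), 0)" "v0 i $ 2 = P (fst (Q i), snd (Q i), 1)"
    "v0 i $ 3 = P (fst (Q i), snd (Q i), 2)" "v0 i $ 4 = 1" for i
    by (simp_all add: v0_def)
  have R: "(\<forall>\<rho>\<in>R. \<phi> \<rho>) \<longleftrightarrow> (\<forall>i r s t. i < a + b \<longrightarrow> r + s + t < (if i < a then 3 else 2) \<longrightarrow> \<phi> (i, r, s, t))" for \<phi>
    unfolding R_def by blast
  have inj: "\<forall>\<alpha>\<in>tet (Suc k). c \<alpha> = 0"
    if c: "\<forall>\<rho>\<in>R. (\<Sum>\<alpha>\<in>tet (Suc k). c \<alpha> * row k \<rho> \<alpha> v0) = 0" for c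
  proof
    fix \<alpha> assume \<alpha>: "\<alpha> \<in> tet (Suc k)"
    have van: "vanish3 (Suc k) c (if i < a then 3 else 2)
        (P (fst (Q i), snd (Q i), 0), P (fst (Q i), snd (Q i), 1), P (fst (Q i), snd (Q i), 2))" if "i < a + b" for i
      unfolding vanish3_def
    proof (intro allI impI)
      fix r s t :: nat assume "r + s + t < (if i < a then 3 else 2)"
      then have "(i, r, s, t) \<in> R" using \<open>i < a + b\<close> by (simp add: R_def)
      from bspec[OF c this] show "(\<Sum>\<alpha>\<in>tet (Suc k). c \<alpha> * (hasse r (fst \<alpha>) (fst (P (fst (Q i), snd (Q i), 0),
          P (fst (Q i), snd (Q i), 1), P (fst (Q i), snd (Q i), 2))) * (hasse s (fst (snd \<alpha>)) (fst (snd (P (fst (Q i), snd (Q i), 0),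
          P (fst (Q i), snd (Q i), 1), P (fst (Q i), snd (Q i), 2)))) * hasse t (snd (snd \<alpha>)) (snd (snd (P (fst (Q i), snd (Q i), 0),
          P (fst (Q i), snd (Q i), 1), P (fst (Q i), snd (Q i), 2))))))) = 0"
        by (simp add: row_def case_prod_beta coords)
    qed
    show "c \<alpha> = 0"
    proof (rule indep3D[OF P _ \<alpha>])
      fix m X assume "(m, X) \<in> point3 P ` conds3 a b 0 0"
      then obtain \<kappa> where \<kappa>: "\<kappa> \<in> conds3 a b 0 0" "(m, X) = point3 P \<kappa>" by (rule imageE)
      then consider i where "i < a" "\<kappa> = (0, i)" | i where "i < b" "\<kappa> = (1, i)"
        by (auto simp: conds3_def)
      then show "vanish3 (Suc k) c m X"
      proof cases
        case (1 i)
        then show ?thesis using van[of i] \<kappa>(2) by (simp add: Q_def point3_def)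
      next
        case (2 i)
        then show ?thesis using van[of "a + i"] \<kappa>(2) by (simp add: Q_def point3_def)
      qed
    qed
  qed
  have "\<exists>\<delta> g. multihom (a + b) \<delta> g \<and> g v0 \<noteq> 0 \<and> (\<forall>v. g v \<noteq> 0 \<longrightarrow>
    (\<forall>c. (\<forall>\<rho>\<in>R. (\<Sum>\<alpha>\<in>tet (Suc k). c \<alpha> * row k \<rho> \<alpha> v) = 0) \<longrightarrow> (\<forall>\<alpha>\<in>tet (Suc k). c \<alpha> = 0)))"
  proof (rule elimination[where dg = "\<lambda>(i, r, s, t) i'. if i' = i then k - (r + s + t) else 0"])
    show "multihom (a + b) (\<lambda>_. 0) (\<lambda>_. 1)" by (rule multihom_const)
    show "multihom (a + b) (case \<rho> of (i, r, s, t) \<Rightarrow> \<lambda>i'. if i' = i then k - (r + s + t) else 0) (row k \<rho> \<alpha>)"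
      if "\<rho> \<in> R" "\<alpha> \<in> tet (Suc k)" for \<rho> \<alpha>
    proof -
      obtain i r s t l p q where e: "\<rho> = (i, r, s, t)" "\<alpha> = (l, p, q)" by (metis surj_pair)
      have "multihom (a + b) (\<lambda>i'. if i' = i then k - (r + s + t) else 0) (\<lambda>v. row k (i, r, s, t) (l, p, q) v)"
        unfolding row_def prod.case by (rule multihom_monomial) (use that in \<open>auto simp: e R_def tet_def\<close>)
      then show ?thesis by (simp add: e)
    qed
  qed (use inj in \<open>auto intro: multihom_mult multihom_diff\<close>)
  then obtain \<delta> g where g: "multihom (a + b) \<delta> g" "g v0 \<noteq> 0" "\<forall>v. g v \<noteq> 0 \<longrightarrow>
    (\<forall>c. (\<forall>\<rho>\<in>R. (\<Sum>\<alpha>\<in>tet (Suc k). c \<alpha> * row k \<rho> \<alpha> v) = 0) \<longrightarrow> (\<forall>\<alpha>\<in>tet (Suc k). c \<alpha> = 0))" by blast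
  have "v0 i \<noteq> 0" for i using coords(4)[of i] by (metis zero_index zero_neq_one)
  then show ?thesis using g unfolding R by blast
qed

section \<open>Order of vanishing\<close>

text \<open>The restriction of \<open>f\<close> to the line through \<open>v\<close> with direction
  \<open>w\<close>, with \<open>v\<close> at parameter 0.\<close>

definition line_poly :: "complex ^ 4 \<Rightarrow> (4 \<Rightarrow> complex) \<Rightarrow> 4 cpoly \<Rightarrow> complex poly" where
  "line_poly v w f = subst (\<lambda>c. [:c:]) (\<lambda>j. [:v $ j, w j:]) f"

lemma coeff_line_poly_0: "coeff (line_poly v w f) 0 = poly_eval f (\<lambda>j. v $ j)"
  by (simp add: line_poly_def subst_def mono_val_def poly_eval_def poly_sum poly_prod flip: poly_0_coeff_0)

text \<open>Multiplicity at least \<open>m\<close> at \<open>v\<close>, tested on all lines through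
  \<open>v\<close> in the affine cone. Orders add under products and ignore factors that do not
  vanish at \<open>v\<close>, which is what fractions require.\<close>

definition order_ge :: "nat \<Rightarrow> complex ^ 4 \<Rightarrow> 4 cpoly \<Rightarrow> bool" where
  "order_ge m v f \<longleftrightarrow> (\<forall>w. \<forall>s<m. coeff (line_poly v w f) s = 0)"

lemma order_ge_mult:
  assumes "order_ge m v f" "order_ge n v g" shows "order_ge (m + n) v (f * g)"
  unfolding order_ge_def
proof (intro allI impI)
  fix w s assume s: "s < m + n"
  have "line_poly v w (f * g) = line_poly v w f * line_poly v w g"
    by (simp add: line_poly_def subst_mult[OF ring_map_const])
  moreover have "coeff (line_poly v w f) i * coeff (line_poly v w g) (s - i) = 0" if "i \<le> s" for i
    using assms s that unfolding order_ge_def by (cases "i < m") auto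
  ultimately show "coeff (line_poly v w (f * g)) s = 0" by (simp add: coeff_mult sum.neutral)
qed

lemma order_ge_add:
  assumes "order_ge m v f" "order_ge m v g" shows "order_ge m v (f + g)"
  using assms by (simp add: order_ge_def line_poly_def subst_add[OF ring_map_const])

lemma order_ge_mult_right: "order_ge m v f \<Longrightarrow> order_ge m v (f * g)"
  using order_ge_mult[of m v f 0 g] by (simp add: order_ge_def)

text \<open>On each line the constant coefficient of \<open>g\<close> is nonzero, so the
  coefficients of \<open>f\<close> vanish one after the other.\<close>

lemma order_ge_cancel:
  assumes "order_ge m v (f * g)" "poly_eval g (\<lambda>j. v $ j) \<noteq> 0" shows "order_ge m v f"
  unfolding order_ge_def
proof (intro allI impI)
  fix w s assume "s < m"
  then show "coeff (line_poly v w f) s = 0"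
  proof (induction s rule: less_induct)
    case (less s)
    have "line_poly v w (f * g) = line_poly v w f * line_poly v w g"
      by (simp add: line_poly_def subst_mult[OF ring_map_const])
    moreover have "coeff (line_poly v w (f * g)) s = 0"
      using assms(1) less.prems by (simp add: order_ge_def)
    ultimately have "0 = (\<Sum>i\<le>s. coeff (line_poly v w f) i * coeff (line_poly v w g) (s - i))"
      by (simp add: coeff_mult)
    also have "\<dots> = (\<Sum>i\<in>{s}. coeff (line_poly v w f) i * coeff (line_poly v w g) (s - i))"
      by (rule sum.mono_neutral_right) (use less in auto)
    finally show ?case using assms(2) by (simp add: coeff_line_poly_0)
  qed
qed

definition monom4 :: "nat \<Rightarrow> nat \<times> nat \<times> nat \<Rightarrow> 4 \<Rightarrow>\<^sub>0 nat" where
  "monom4 k = (\<lambda>(l, p, q). Poly_Mapping.single 1 l + Poly_Mapping.single 2 p + Poly_Mapping.single 3 q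
     + Poly_Mapping.single 4 (k - l - p - q))"

lemma lookup_monom4:
  "Poly_Mapping.lookup (monom4 k (l, p, q)) 1 = l" "Poly_Mapping.lookup (monom4 k (l, p, q)) 2 = p"
  "Poly_Mapping.lookup (monom4 k (l, p, q)) 3 = q" "Poly_Mapping.lookup (monom4 k (l, p, q)) 4 = k - l - p - q"
  by (simp_all add: monom4_def lookup_add lookup_single when_def)

lemma keys_homogeneous:
  assumes "homogeneous k F" shows "Poly_Mapping.keys F \<subseteq> monom4 k ` tet (Suc k)"
proof
  fix m assume "m \<in> Poly_Mapping.keys F"
  then have s: "Poly_Mapping.lookup m 1 + Poly_Mapping.lookup m 2 + Poly_Mapping.lookup m 3 + Poly_Mapping.lookup m 4 = k"
    using assms by (auto simp: homogeneous_def sum_4)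
  have "\<forall>j. Poly_Mapping.lookup m j = Poly_Mapping.lookup
      (monom4 k (Poly_Mapping.lookup m 1, Poly_Mapping.lookup m 2, Poly_Mapping.lookup m 3)) j"
    unfolding forall_4 lookup_monom4 using s by auto
  then have "m = monom4 k (Poly_Mapping.lookup m 1, Poly_Mapping.lookup m 2, Poly_Mapping.lookup m 3)"
    by (intro poly_mapping_eqI) blast
  moreover have "(Poly_Mapping.lookup m 1, Poly_Mapping.lookup m 2, Poly_Mapping.lookup m 3) \<in> tet (Suc k)"
    using s by (simp add: tet_def)
  ultimately show "m \<in> monom4 k ` tet (Suc k)" by blast
qed

lemma mono_val_monom4:
  "mono_val x (monom4 k (l, p, q)) = x 1 ^ l * (x 2 ^ p * (x 3 ^ q * x 4 ^ (k - l - p - q)))"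
proof -
  have "mono_val x (monom4 k (l, p, q)) = (\<Prod>j\<in>{1, 2, 3, 4}. x j ^ Poly_Mapping.lookup (monom4 k (l, p, q)) j)"
    by (rule mono_val_superset) (auto simp flip: UNIV_4)
  also have "\<dots> = x 1 ^ l * (x 2 ^ p * (x 3 ^ q * x 4 ^ (k - l - p - q)))"
    by (simp add: lookup_monom4)
  finally show ?thesis .
qed

lemma inj_on_monom4: "inj_on (monom4 k) A"
proof (rule inj_onI)
  fix \<alpha> \<beta> assume "monom4 k \<alpha> = monom4 k \<beta>"
  moreover obtain l p q l' p' q' where "\<alpha> = (l, p, q)" "\<beta> = (l', p', q')" by (metis surj_pair)
  ultimately show "\<alpha> = \<beta>" by (metis lookup_monom4(1-3))
qed

lemma subst_homogeneous:
  assumes "homogeneous k F" "ring_map h"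
  shows "subst h x F = (\<Sum>\<alpha>\<in>tet (Suc k). h (Poly_Mapping.lookup F (monom4 k \<alpha>)) * mono_val x (monom4 k \<alpha>))"
  by (simp add: subst_superset[OF assms(2) _ keys_homogeneous[OF assms(1)]] sum.reindex[OF inj_on_monom4])

lemma coeff_linear_hasse: "coeff ([:x, w:] ^ e) i = hasse i e x * w ^ i"
proof (cases "i \<le> e")
  case False
  then have "degree ([:x, w:] ^ e) < i"
    by (intro le_less_trans[OF degree_power_le]) (auto intro: le_less_trans[of _ "1 * e"])
  then show ?thesis using False by (simp add: coeff_eq_0 hasse_def binomial_eq_0)
qed (simp add: coeff_linear_poly_power hasse_def)

text \<open>Unit vectors give the pure coefficients, sums of two unit vectors the mixed
  ones.\<close>

lemma forms_vanish:
  fixes X :: "nat \<Rightarrow> nat \<Rightarrow> nat \<Rightarrow> complex"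
  assumes n: "n \<le> 2"
    and 0: "\<And>x y z. (\<Sum>i\<le>n. \<Sum>j\<le>n - i. x ^ i * y ^ j * z ^ (n - i - j) * X i j (n - i - j)) = 0"
    and rst: "r + s + t = n"
  shows "X r s t = 0"
proof -
  have sums: "(\<Sum>i\<le>2. h i) = h 0 + h 1 + h 2" "(\<Sum>i\<le>1. h i) = h 0 + h 1" for h :: "nat \<Rightarrow> complex"
    by (simp_all add: numeral_2_eq_2)
  consider "n = 0" | "n = 1" | "n = 2" using n by linarith
  then show ?thesis
  proof cases
    case 1
    then show ?thesis using 0[of 0 0 0] rst by simp
  next
    case 2
    have e: "z * X 0 0 1 + y * X 0 1 0 + x * X 1 0 0 = 0" for x y z
      using 0[of x y z, unfolded 2 sums] by simp
    have "X 1 0 0 = 0" "X 0 1 0 = 0" "X 0 0 1 = 0"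
      using e[of 0 0 1] e[of 0 1 0] e[of 1 0 0] by simp_all
    moreover have "r = 1 \<and> s = 0 \<and> t = 0 \<or> r = 0 \<and> s = 1 \<and> t = 0 \<or> r = 0 \<and> s = 0 \<and> t = 1"
      using rst 2 by presburger
    ultimately show ?thesis by (elim disjE) simp_all
  next
    case 3
    have e: "z ^ 2 * X 0 0 2 + y * z * X 0 1 1 + y ^ 2 * X 0 2 0 + (x * z * X 1 0 1 + x * y * X 1 1 0) + x ^ 2 * X 2 0 0 = 0"
      for x y z
    proof -
      have "2 - 0 = (2 :: nat)" "2 - 1 = (1 :: nat)" "2 - 2 = (0 :: nat)" "1 - 0 = (1 :: nat)" "1 - 1 = (0 :: nat)"
        by simp_all
      from 0[of x y z, unfolded 3 sums this, unfolded sums this] show ?thesis by simp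
    qed
    have a: "X 2 0 0 = 0" "X 0 2 0 = 0" "X 0 0 2 = 0"
      using e[of 1 0 0] e[of 0 1 0] e[of 0 0 1] by simp_all
    then have "X 1 1 0 = 0" "X 1 0 1 = 0" "X 0 1 1 = 0"
      using e[of 1 1 0] e[of 1 0 1] e[of 0 1 1] by simp_all
    moreover have "r = 2 \<and> s = 0 \<and> t = 0 \<or> r = 0 \<and> s = 2 \<and> t = 0 \<or> r = 0 \<and> s = 0 \<and> t = 2 \<or>
        r = 1 \<and> s = 1 \<and> t = 0 \<or> r = 1 \<and> s = 0 \<and> t = 1 \<or> r = 0 \<and> s = 1 \<and> t = 1"
      using rst 3 by presburger
    ultimately show ?thesis using a by (elim disjE) simp_all
  qed
qed

text \<open>On a line with direction \<open>(x, y, z, 0)\<close> the coefficient of degree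
  \<open>n\<close> is a form of degree \<open>n\<close> in \<open>x, y, z\<close>, whose
  coefficients are the rows with \<open>r + s + t = n\<close>. It vanishes for all directions, and
  \<open>n <= 2\<close> since \<open>m <= 3\<close>.\<close>

lemma order_ge_rows:
  assumes F: "homogeneous k F" and ord: "order_ge m (v i) F" and m: "m \<le> 3" "r + s + t < m"
  shows "(\<Sum>\<alpha>\<in>tet (Suc k). Poly_Mapping.lookup F (monom4 k \<alpha>) * row k (i, r, s, t) \<alpha> v) = 0"
proof (rule forms_vanish[where n = "r + s + t" and X = "\<lambda>r s t. \<Sum>\<alpha>\<in>tet (Suc k).
    Poly_Mapping.lookup F (monom4 k \<alpha>) * row k (i, r, s, t) \<alpha> v"])
  fix x y z :: complex
  let ?n = "r + s + t"
  define w :: "4 \<Rightarrow> complex" where "w j = (if j = 1 then x else if j = 2 then y else if j = 3 then z else 0)" for j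
  have co: "coeff (mono_val (\<lambda>j. [:v i $ j, w j:]) (monom4 k \<alpha>)) ?n
      = (\<Sum>a\<le>?n. \<Sum>b\<le>?n - a. x ^ a * y ^ b * z ^ (?n - a - b) * row k (i, a, b, ?n - a - b) \<alpha> v)" for \<alpha>
  proof -
    obtain l p q where \<alpha>: "\<alpha> = (l, p, q)" by (metis surj_pair)
    have w: "w 1 = x" "w 2 = y" "w 3 = z" "w 4 = 0" by (simp_all add: w_def)
    have c: "[:c, 0:] ^ e = [:c ^ e:]" for c :: complex and e
      by (induction e) (simp_all add: one_pCons)
    have last: "coeff (A * [:u:]) e = coeff A e * u" for A :: "complex poly" and u e
      by (simp add: mult.commute[of A])
    have "coeff (mono_val (\<lambda>j. [:v i $ j, w j:]) (monom4 k \<alpha>)) ?n = (\<Sum>a\<le>?n. \<Sum>b\<le>?n - a.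
        hasse a l (v i $ 1) * x ^ a * (hasse b p (v i $ 2) * y ^ b *
          (hasse (?n - a - b) q (v i $ 3) * z ^ (?n - a - b) * (v i $ 4) ^ (k - l - p - q))))"
      unfolding \<alpha> mono_val_monom4 w c
      unfolding coeff_mult[of "[:v i $ 1, x:] ^ l"] coeff_mult[of "[:v i $ 2, y:] ^ p"] last coeff_linear_hasse
        sum_distrib_left ..
    also have "\<dots> = (\<Sum>a\<le>?n. \<Sum>b\<le>?n - a. x ^ a * y ^ b * z ^ (?n - a - b) * row k (i, a, b, ?n - a - b) \<alpha> v)"
      unfolding \<alpha> row_def prod.case by (intro sum.cong refl) (simp only: mult_ac)
    finally show ?thesis .
  qed
  have "0 = coeff (line_poly (v i) w F) ?n" using ord m(2) by (simp add: order_ge_def)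
  also have "\<dots> = (\<Sum>\<alpha>\<in>tet (Suc k). Poly_Mapping.lookup F (monom4 k \<alpha>) *
      (\<Sum>a\<le>?n. \<Sum>b\<le>?n - a. x ^ a * y ^ b * z ^ (?n - a - b) * row k (i, a, b, ?n - a - b) \<alpha> v))"
    unfolding line_poly_def subst_homogeneous[OF F ring_map_const] by (simp add: coeff_sum co)
  also have "\<dots> = (\<Sum>a\<le>?n. \<Sum>b\<le>?n - a. x ^ a * y ^ b * z ^ (?n - a - b) *
      (\<Sum>\<alpha>\<in>tet (Suc k). Poly_Mapping.lookup F (monom4 k \<alpha>) * row k (i, a, b, ?n - a - b) \<alpha> v))"
    unfolding sum_distrib_left
    by (subst sum.swap, intro sum.cong refl, subst sum.swap) (simp add: mult_ac)
  finally show "(\<Sum>a\<le>?n. \<Sum>b\<le>?n - a. x ^ a * y ^ b * z ^ (?n - a - b) *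
      (\<Sum>\<alpha>\<in>tet (Suc k). Poly_Mapping.lookup F (monom4 k \<alpha>) * row k (i, a, b, ?n - a - b) \<alpha> v)) = 0" by simp
qed (use m in auto)

section \<open>Stalks\<close>

lemma hcoords_scale:
  assumes "v \<in> hcoords P" "v' \<in> hcoords P" shows "\<exists>c. v' = c *s v"
proof -
  obtain u where "Rep_proj3 P = vec.span {u}" using Rep_proj3[of P] by blast
  then obtain c c' where c: "v = c *s u" "v' = c' *s u" "v \<noteq> 0"
    using assms by (auto simp: hcoords_def vec.span_singleton)
  then have "c \<noteq> 0" by auto
  then have "v' = (c' / c) *s v" using c by (simp add: vector_smult_assoc)
  then show ?thesis by blast
qed

lemma poly_eval_scale:
  assumes "homogeneous d g" shows "poly_eval g (\<lambda>j. (c *s v) $ j) = c ^ d * poly_eval g (\<lambda>j. v $ j)"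
proof -
  have "(\<Prod>j\<in>Poly_Mapping.keys m. (c * v $ j) ^ Poly_Mapping.lookup m j)
      = c ^ d * (\<Prod>j\<in>Poly_Mapping.keys m. (v $ j) ^ Poly_Mapping.lookup m j)" if "m \<in> Poly_Mapping.keys g" for m
  proof -
    have "(\<Sum>j\<in>Poly_Mapping.keys m. Poly_Mapping.lookup m j) = (\<Sum>j\<in>UNIV. Poly_Mapping.lookup m j)"
      by (rule sum.mono_neutral_left) (auto simp: in_keys_iff)
    then have d: "(\<Sum>j\<in>Poly_Mapping.keys m. Poly_Mapping.lookup m j) = d"
      using assms that by (simp add: homogeneous_def)
    have "(\<Prod>j\<in>Poly_Mapping.keys m. c ^ Poly_Mapping.lookup m j) = c ^ d"
      unfolding d[symmetric] by (rule power_sum[symmetric])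
    then show ?thesis by (simp add: power_mult_distrib prod.distrib)
  qed
  then have "Poly_Mapping.lookup g m * (\<Prod>j\<in>Poly_Mapping.keys m. (c * v $ j) ^ Poly_Mapping.lookup m j)
      = c ^ d * (Poly_Mapping.lookup g m * (\<Prod>j\<in>Poly_Mapping.keys m. (v $ j) ^ Poly_Mapping.lookup m j))"
    if "m \<in> Poly_Mapping.keys g" for m
    using that by simp
  then show ?thesis
    unfolding poly_eval_def sum_distrib_left vector_smult_component by (rule sum.cong[OF refl])
qed

text \<open>The negation of \<open>vanishes_at\<close> offers one system of coordinates; homogeneity
  carries it over to all of them.\<close>

lemma not_vanishes_at:
  assumes "homogeneous d g" "\<not> vanishes_at g P" "v \<in> hcoords P" shows "poly_eval g (\<lambda>j. v $ j) \<noteq> 0"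
proof -
  obtain v' where v': "v' \<in> hcoords P" "poly_eval g (\<lambda>j. v' $ j) \<noteq> 0"
    using assms(2) unfolding vanishes_at_def by blast
  obtain c where c: "v' = c *s v" using hcoords_scale[OF assms(3) v'(1)] by blast
  from v'(2) show ?thesis unfolding c poly_eval_scale[OF assms(1)] by (rule contrapos_nn) simp
qed

text \<open>An upper bound for the stalks of the ideal powers, with homogeneity dropped so that sums
  and products need no bookkeeping of degrees.\<close>

definition vanishing_fractions :: "nat \<Rightarrow> complex ^ 4 \<Rightarrow> ratfun set" where
  "vanishing_fractions m v =
     {Fraction_Field.Fract f g | f g. order_ge m v f \<and> poly_eval g (\<lambda>j. v $ j) \<noteq> 0}"

lemma poly_eval_neq_0: "poly_eval g x \<noteq> 0 \<Longrightarrow> g \<noteq> 0"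
  by (auto simp: poly_eval_def)

lemma ideal_mult_vanishing:
  assumes "A \<subseteq> vanishing_fractions m v" "B \<subseteq> vanishing_fractions n v"
  shows "ideal_mult A B \<subseteq> vanishing_fractions (m + n) v"
proof
  fix z assume "z \<in> ideal_mult A B"
  then show "z \<in> vanishing_fractions (m + n) v"
  proof induction
    case zero
    have "order_ge (m + n) v 0" by (simp add: order_ge_def line_poly_def)
    moreover have "poly_eval (1 :: 4 cpoly) (\<lambda>j. v $ j) \<noteq> 0"
      by (simp add: poly_eval_subst subst_one[OF ring_map_id])
    ultimately show ?case
      unfolding vanishing_fractions_def Zero_fract_def by blast
  next
    case (add x y z)
    obtain f g where x: "x = Fraction_Field.Fract f g" "order_ge m v f" "poly_eval g (\<lambda>j. v $ j) \<noteq> 0"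
      using add.hyps(1) assms(1) unfolding vanishing_fractions_def by blast
    obtain f' g' where y: "y = Fraction_Field.Fract f' g'" "order_ge n v f'" "poly_eval g' (\<lambda>j. v $ j) \<noteq> 0"
      using add.hyps(2) assms(2) unfolding vanishing_fractions_def by blast
    obtain f'' g'' where z: "z = Fraction_Field.Fract f'' g''" "order_ge (m + n) v f''" "poly_eval g'' (\<lambda>j. v $ j) \<noteq> 0"
      using add.IH unfolding vanishing_fractions_def by blast
    have "g * g' \<noteq> 0" "g'' \<noteq> 0" using x(3) y(3) z(3) by (auto dest: poly_eval_neq_0)
    then have "x * y + z = Fraction_Field.Fract (f * f' * g'' + f'' * (g * g')) (g * g' * g'')"
      by (simp add: x(1) y(1) z(1))
    moreover have "order_ge (m + n) v (f * f' * g'' + f'' * (g * g'))"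
      by (intro order_ge_add order_ge_mult_right order_ge_mult x y z)
    moreover have "poly_eval (g * g' * g'') (\<lambda>j. v $ j) \<noteq> 0"
      using x(3) y(3) z(3) by (simp add: poly_eval_mult)
    ultimately show ?case unfolding vanishing_fractions_def by blast
  qed
qed

lemma stalk_O_vanishing:
  assumes "v \<in> hcoords P" shows "stalk_O k P \<subseteq> vanishing_fractions 0 v"
proof
  fix x assume "x \<in> stalk_O k P"
  then obtain f g d where fg: "x = Fraction_Field.Fract f g" "homogeneous d g" "\<not> vanishes_at g P"
    unfolding stalk_O_def by blast
  moreover have "order_ge 0 v f" by (simp add: order_ge_def)
  ultimately show "x \<in> vanishing_fractions 0 v"
    using not_vanishes_at[OF fg(2,3) assms] unfolding vanishing_fractions_def by blast
qed

lemma point_ideal_vanishing: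
  assumes "v \<in> hcoords P" shows "point_ideal P P \<subseteq> vanishing_fractions 1 v"
proof
  fix x assume "x \<in> point_ideal P P"
  then obtain f g d where fg: "x = Fraction_Field.Fract f g" "homogeneous d g" "\<not> vanishes_at g P" "vanishes_at f P"
    unfolding point_ideal_def by blast
  moreover have "order_ge 1 v f"
    using fg(4) assms by (simp add: order_ge_def coeff_line_poly_0 vanishes_at_def)
  ultimately show "x \<in> vanishing_fractions 1 v"
    using not_vanishes_at[OF fg(2,3) assms] unfolding vanishing_fractions_def by blast
qed

lemma ideal_sheaf_power_vanishing:
  assumes "v \<in> hcoords P" shows "ideal_sheaf_power (point_ideal P) m P \<subseteq> vanishing_fractions m v"
proof (induction m)
  case 0
  show ?case using stalk_O_vanishing[OF assms] by simp
next
  case (Suc m)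
  show ?case using ideal_mult_vanishing[OF point_ideal_vanishing[OF assms] Suc] by simp
qed

lemma Fract_vanishing:
  assumes "Fraction_Field.Fract F 1 \<in> vanishing_fractions m v" shows "order_ge m v F"
proof -
  obtain f g where fg: "Fraction_Field.Fract F 1 = Fraction_Field.Fract f g" "order_ge m v f"
    "poly_eval g (\<lambda>j. v $ j) \<noteq> 0"
    using assms unfolding vanishing_fractions_def by blast
  then have "F * g = f" using poly_eval_neq_0[OF fg(3)] by (simp add: eq_fract)
  then show ?thesis using order_ge_cancel[of m v F g] fg by simp
qed

lemma multiple_points_union_vanishing:
  assumes i: "i < a + b" and v: "v \<in> hcoords (p i)"
  shows "multiple_points_union a b p (p i) \<subseteq> vanishing_fractions (if i < a then 3 else 2) v"
proof (cases "i < a")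
  case True
  then have "multiple_points_union a b p (p i) \<subseteq> triple_point (p i) (p i)"
    unfolding multiple_points_union_def by blast
  then show ?thesis
    using ideal_sheaf_power_vanishing[OF v, of 3] True by (auto simp: triple_point_def)
next
  case False
  then have "i \<in> {a..<a + b}" using i by simp
  then have "multiple_points_union a b p (p i) \<subseteq> double_point (p i) (p i)"
    unfolding multiple_points_union_def by blast
  then show ?thesis
    using ideal_sheaf_power_vanishing[OF v, of 2] False by (auto simp: double_point_def)
qed

lemma kernel_order_ge:
  assumes I: "I Q \<subseteq> vanishing_fractions m v" and m: "1 \<le> m" and v: "v \<in> hcoords Q"
    and FG: "F \<in> H0_proj3 k" "G \<in> H0_proj3 k" "restriction I k F = restriction I k G"
  shows "order_ge m v (F - G)"
proof -
  \<comment> \<open>Restrictions are recorded only on the support. The section 1 has order 0, so it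
    is not in the ideal at \<open>Q\<close>, and \<open>Q\<close> belongs to the support.\<close>
  have "1 \<in> H0_proj3 0" by (simp add: H0_proj3_def homogeneous_def)
  from Fract_1_in_stalk_O[OF this] have "Fraction_Field.Fract 1 1 \<in> stalk_O 0 Q" .
  moreover have "Fraction_Field.Fract 1 1 \<notin> vanishing_fractions m v"
  proof
    assume "Fraction_Field.Fract 1 1 \<in> vanishing_fractions m v"
    from Fract_vanishing[OF this] have "coeff (line_poly v (\<lambda>_. 0) 1) 0 = 0" using m by (simp add: order_ge_def)
    then show False by (simp add: line_poly_def subst_one[OF ring_map_const])
  qed
  ultimately have "Q \<in> scheme_support I" using I by (auto simp: scheme_support_def)
  then have eq: "stalk_cong I k Q `` {Fraction_Field.Fract F 1} = stalk_cong I k Q `` {Fraction_Field.Fract G 1}"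
    using fun_cong[OF FG(3), of Q] by (simp add: restriction_def)
  have "(Fraction_Field.Fract G 1, Fraction_Field.Fract G 1) \<in> stalk_cong I k Q"
    using Fract_1_in_stalk_O[OF FG(2)] by (auto simp: stalk_cong_def ideal_mult.zero simp del: diff_fract)
  then have "(Fraction_Field.Fract F 1, Fraction_Field.Fract G 1) \<in> stalk_cong I k Q" using eq by blast
  then have "Fraction_Field.Fract F 1 - Fraction_Field.Fract G 1 \<in> ideal_mult (I Q) (stalk_O k Q)"
    by (simp add: stalk_cong_def)
  moreover have "Fraction_Field.Fract F 1 - Fraction_Field.Fract G 1 = Fraction_Field.Fract (F - G) 1" by simp
  moreover have "ideal_mult (I Q) (stalk_O k Q) \<subseteq> vanishing_fractions (m + 0) v"
    by (rule ideal_mult_vanishing[OF I stalk_O_vanishing[OF v]])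
  ultimately show ?thesis using Fract_vanishing[of "F - G" m v] by auto
qed

lemma span_coords:
  assumes "v \<noteq> 0" shows "v \<in> hcoords (Abs_proj3 (vec.span {v}))"
  using assms by (subst hcoords_def, subst Abs_proj3_inverse) (auto simp: vec.span_base)

theorem proposition4:
  fixes k a b :: nat and \<gamma> :: int
  assumes "k \<ge> 4"
    and "\<gamma> = max 0 (int k - int b - 4)"
    and "10 * int a + 4 * int b \<ge> int ((k + 3) choose 3) + 3 * \<gamma> + 2 * int k"
  shows "\<exists>U. zariski_open (a + b) U \<and> U \<noteq> {} \<and>
           (\<forall>p\<in>U. inj_on (restriction (multiple_points_union a b p) k) (H0_proj3 k))"
proof -
  have "\<gamma> = int (k - b - 4)" using assms(2) by linarith
  then have "int (((k + 3) choose 3) + 2 * k + 3 * (k - b - 4)) \<le> int (10 * a + 4 * b)"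
    using assms(3) by simp
  then have "((k + 3) choose 3) + 2 * k + 3 * (k - b - 4) \<le> 10 * a + 4 * b" by (simp only: of_nat_le_iff)
  from minor[OF solvable_main[OF assms(1) this]]
  obtain \<delta> g v0 where g: "multihom (a + b) \<delta> g" "g v0 \<noteq> 0" "\<forall>i. v0 i \<noteq> 0"
    "\<forall>v. g v \<noteq> 0 \<longrightarrow> (\<forall>c. (\<forall>i r s t. i < a + b \<longrightarrow> r + s + t < (if i < a then 3 else 2) \<longrightarrow>
        (\<Sum>\<alpha>\<in>tet (Suc k). c \<alpha> * row k (i, r, s, t) \<alpha> v) = 0) \<longrightarrow> (\<forall>\<alpha>\<in>tet (Suc k). c \<alpha> = 0))"
    by (elim exE conjE)
  obtain f where f: "\<forall>m\<in>Poly_Mapping.keys f. Poly_Mapping.keys m \<subseteq> {..<a + b} \<times> UNIV \<and>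
        (\<forall>i<a + b. (\<Sum>j\<in>UNIV. Poly_Mapping.lookup m (i, j)) = \<delta> i)"
    "\<And>v. poly_eval f (\<lambda>(i, j). v i $ j) = g v"
    using g(1) unfolding multihom_def by metis
  define U where "U = {p \<in> proj3_power (a + b). \<not> multi_vanishes_at (a + b) f p}"
  have "multihomogeneous (a + b) f" using f(1) unfolding multihomogeneous_def by blast
  moreover have "proj3_power (a + b) - U = {p \<in> proj3_power (a + b). \<forall>h\<in>{f}. multi_vanishes_at (a + b) h p}"
    by (auto simp: U_def)
  ultimately have "zariski_open (a + b) U"
    unfolding zariski_open_def zariski_closed_def U_def by blast
  moreover have "(\<lambda>i\<in>{..<a + b}. Abs_proj3 (vec.span {v0 i})) \<in> U"
  proof -
    have "\<forall>i<a + b. v0 i \<in> hcoords ((\<lambda>i\<in>{..<a + b}. Abs_proj3 (vec.span {v0 i})) i)"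
      using span_coords g(3) by simp
    moreover have "(\<lambda>i\<in>{..<a + b}. Abs_proj3 (vec.span {v0 i})) \<in> {..<a + b} \<rightarrow>\<^sub>E UNIV" by simp
    ultimately show ?thesis
      using g(2) unfolding U_def proj3_power_def multi_vanishes_at_def f(2) by blast
  qed
  moreover have "inj_on (restriction (multiple_points_union a b p) k) (H0_proj3 k)" if p: "p \<in> U" for p
  proof (rule inj_onI)
    fix F G assume FG: "F \<in> H0_proj3 k" "G \<in> H0_proj3 k"
      "restriction (multiple_points_union a b p) k F = restriction (multiple_points_union a b p) k G"
    \<comment> \<open>Membership in \<open>U\<close> supplies one choice of homogeneous coordinates
      with \<open>g v\<close> nonzero; all orders of vanishing are measured at this choice.\<close>
    obtain v where v: "\<And>i. i < a + b \<Longrightarrow> v i \<in> hcoords (p i)" "g v \<noteq> 0"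
      using p unfolding U_def multi_vanishes_at_def f(2) by blast
    have hom: "homogeneous k (F - G)"
      using FG(1,2) keys_diff[of F G] unfolding H0_proj3_def homogeneous_def by blast
    have rows: "(\<Sum>\<alpha>\<in>tet (Suc k). Poly_Mapping.lookup (F - G) (monom4 k \<alpha>) * row k (i, r, s, t) \<alpha> v) = 0"
      if i: "i < a + b" and rst: "r + s + t < (if i < a then 3 else 2)" for i r s t
    proof (rule order_ge_rows[OF hom _ _ rst])
      show "order_ge (if i < a then 3 else 2) (v i) (F - G)"
        by (rule kernel_order_ge[OF multiple_points_union_vanishing[where p = p and v = "v i", OF i v(1)[OF i]] _ v(1)[OF i] FG]) simp
    qed simp
    have "\<forall>\<alpha>\<in>tet (Suc k). Poly_Mapping.lookup (F - G) (monom4 k \<alpha>) = 0"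
      by (rule g(4)[THEN spec, THEN mp, OF v(2), THEN spec, THEN mp]) (intro allI impI rows)
    then have "Poly_Mapping.lookup (F - G) m = 0" for m
      using keys_homogeneous[OF hom] by (cases "m \<in> Poly_Mapping.keys (F - G)") (auto simp: in_keys_iff)
    then have "F - G = 0" by (intro poly_mapping_eqI) simp
    then show "F = G" by simp
  qed
  ultimately show ?thesis by blast
qed

end
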